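(* Fix $m,k\in\mathbb{Z}$, $u\in\mathbb{C}$ with $\operatorname{Im}u\in(-1,0)$, and $v\in\mathbb{R}$. For $\delta>0$ with $1/\delta\in\mathbb{Z}_{>0}$ put $$\omega_1=i+\delta,\qquad \omega_2=-i+\delta,\qquad g=i\sqrt{\omega_1\omega_2}\,(m+u\delta),\qquad \lambda=i\sqrt{\omega_1\omega_2}\,(k+v\delta),$$ and let $$\mathcal{I}(z)=e^{\frac{2\pi i}{\omega_1\omega_2}\lambda z}\;\gamma^{(2)}\Bigl(z+\tfrac{\omega_1+\omega_2}{2}-g;\omega_1,\omega_2\Bigr)\,\gamma^{(2)}\Bigl(-z+\tfrac{\omega_1+\omega_2}{2}-g;\omega_1,\omega_2\Bigr).$$ For $(\alpha,\beta)\in\mathbb{R}^2$ with $\sinh\pi(\alpha+i\beta)\neq0$ let $$\mathcal{J}(\alpha,\beta)=\frac{e^{-2\pi i(\alpha v+\beta k)}}{\bigl(2\sinh\pi(\alpha+i\beta)\bigr)^{m+iu}\,\bigl(2\sinh\pi(\alpha-i\beta)\bigr)^{-m+iu}}.$$ Then, as $\delta\to0^+$ along the values with $1/\delta\in\mathbb{Z}_{>0}$, $$\lim_{\delta\to0^+}\ \delta\int_{i\mathbb{R}}\mathcal{I}(z)\,\frac{dz}{i\sqrt{\omega_1\omega_2}}=\int_{\mathbb{R}}d\alpha\int_{-1/2}^{1/2}\mathcal{J}(\alpha,\beta)\,d\beta .$$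
   Context: Here $\sqrt{\omega_1\omega_2}=\sqrt{1+\delta^2}>0$, and $i\mathbb{R}$ is the imaginary axis oriented upwards. Hyperbolic gamma function: for $\operatorname{Im}(\omega_1/\omega_2)>0$, $$\gamma^{(2)}(z;\omega_1,\omega_2)=e^{-\frac{\pi i}{2}B_{2,2}(z;\omega_1,\omega_2)}\,\frac{(\tilde q\,e^{2\pi i z/\omega_1};\tilde q)_\infty}{(e^{2\pi i z/\omega_2};q)_\infty},\quad q=e^{2\pi i\omega_1/\omega_2},\ \tilde q=e^{-2\pi i\omega_2/\omega_1},$$ $$(x;q)_\infty=\prod_{j=0}^\infty(1-xq^j),\qquad B_{2,2}(z;\omega_1,\omega_2)=\frac{1}{\omega_1\omega_2}\Bigl(\bigl(z-\tfrac{\omega_1+\omega_2}{2}\bigr)^2-\tfrac{\omega_1^2+\omega_2^2}{12}\Bigr).$$ It is a meromorphic function of $z$. Powers: a product $w^{a}\,\bar w^{\,a'}$ with $a,a'\in\mathbb{C}$, $a-a'\in\mathbb{Z}$, $w\in\mathbb{C}\setminus\{0\}$ means $|w|^{a+a'}e^{i(a-a')\arg w}$, which does not depend on the choice of $\arg w$. In $\mathcal{J}$ this is used with $w=2\sinh\pi(\alpha+i\beta)$, $\bar w=2\sinh\pi(\alpha-i\beta)$, $a=m+iu$, $a'=-m+iu$. *)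

theory Defs
  imports "HOL-Complex_Analysis.Complex_Analysis"
begin

definition qpoch_inf :: "complex \<Rightarrow> complex \<Rightarrow> complex" where
  "qpoch_inf x q = (\<Prod>j. 1 - x * q ^ j)"

definition B22 :: "complex \<Rightarrow> complex \<Rightarrow> complex \<Rightarrow> complex" where
  "B22 z w1 w2 =
     1 / (w1 * w2) * ((z - (w1 + w2) / 2)\<^sup>2 - (w1\<^sup>2 + w2\<^sup>2) / 12)"

(* Intended for Im (w1 / w2) > 0. The quotient of infinite products has removable singularities,
   at common zeros of numerator and denominator, where division in HOL would return 0;
   remove_sings turns it into the meromorphic function (with value 0 at the poles). *)
definition hyp_gamma :: "complex \<Rightarrow> complex \<Rightarrow> complex \<Rightarrow> complex" where
  "hyp_gamma z w1 w2 =
     (let q = exp (2 * of_real pi * \<i> * w1 / w2);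
          q' = exp (- 2 * of_real pi * \<i> * w2 / w1)
      in remove_sings
           (\<lambda>z. exp (- (of_real pi * \<i> / 2) * B22 z w1 w2) *
                (qpoch_inf (q' * exp (2 * of_real pi * \<i> * z / w1)) q' /
                 qpoch_inf (exp (2 * of_real pi * \<i> * z / w2)) q)) z)"

(* w^a * (cnj w)^a' for a - a' an integer and w nonzero *)
definition cpow_pair :: "complex \<Rightarrow> complex \<Rightarrow> complex \<Rightarrow> complex" where
  "cpow_pair w a a' =
     of_real (norm w) powr (a + a') * exp (\<i> * (a - a') * of_real (Arg w))"

definition omega1 :: "real \<Rightarrow> complex" where
  "omega1 \<delta> = \<i> + of_real \<delta>"

definition omega2 :: "real \<Rightarrow> complex" where
  "omega2 \<delta> = - \<i> + of_real \<delta>"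

(* The positive square root of omega1 \<delta> * omega2 \<delta> = 1 + \<delta>^2 *)
definition sqrt_omega :: "real \<Rightarrow> complex" where
  "sqrt_omega \<delta> = of_real (sqrt (1 + \<delta>\<^sup>2))"

definition g_par :: "int \<Rightarrow> complex \<Rightarrow> real \<Rightarrow> complex" where
  "g_par m u \<delta> = \<i> * sqrt_omega \<delta> * (of_int m + u * of_real \<delta>)"

definition lambda_par :: "int \<Rightarrow> real \<Rightarrow> real \<Rightarrow> complex" where
  "lambda_par k v \<delta> = \<i> * sqrt_omega \<delta> * (of_int k + of_real v * of_real \<delta>)"

definition I_integrand ::
  "int \<Rightarrow> int \<Rightarrow> complex \<Rightarrow> real \<Rightarrow> real \<Rightarrow> complex \<Rightarrow> complex" where
  "I_integrand m k u v \<delta> z =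
     (let w1 = omega1 \<delta>; w2 = omega2 \<delta>; g = g_par m u \<delta>
      in exp (2 * of_real pi * \<i> / (w1 * w2) * lambda_par k v \<delta> * z) *
         hyp_gamma (z + (w1 + w2) / 2 - g) w1 w2 *
         hyp_gamma (- z + (w1 + w2) / 2 - g) w1 w2)"

definition J_integrand ::
  "int \<Rightarrow> int \<Rightarrow> complex \<Rightarrow> real \<Rightarrow> real \<Rightarrow> real \<Rightarrow> complex" where
  "J_integrand m k u v \<alpha> \<beta> =
     exp (- 2 * of_real pi * \<i> * (of_real \<alpha> * of_real v + of_real \<beta> * of_int k)) /
     cpow_pair (2 * sinh (of_real pi * (of_real \<alpha> + \<i> * of_real \<beta>)))
       (of_int m + \<i> * u) (- of_int m + \<i> * u)"

(* Integration over the imaginary axis oriented upwards, parametrised by z = \<i> * t *)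
definition imag_axis_integrable :: "(complex \<Rightarrow> complex) \<Rightarrow> bool" where
  "imag_axis_integrable f \<longleftrightarrow> integrable lborel (\<lambda>t::real. f (\<i> * of_real t) * \<i>)"

definition imag_axis_integral :: "(complex \<Rightarrow> complex) \<Rightarrow> complex" where
  "imag_axis_integral f = (LINT t|lborel. f (\<i> * of_real (t::real)) * \<i>)"

end

theory Submission
  imports Defs
begin

text \<open>
  Write \<open>d\<close> for \<open>\<delta>\<close> and put \<open>z = \<i> * (1 + d\<^sup>2) * y\<close>. By the reflection formula \<open>\<gamma>(z) * \<gamma>(\<omega>\<^sub>1 + \<omega>\<^sub>2 - z) = 1\<close> the product of
  the two hyperbolic gamma functions is a quotient of them, hence, for \<open>y > 0\<close>, a product of ratios
  \<open>(q powr a * x; q) / (q powr b * x; q)\<close> with \<open>x = exp (- 2 * pi * (d + \<i>) * y)\<close> and \<open>q \<rightarrow> 1\<close>, each of which tends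
  to a power of \<open>1 - x\<close>. Negative \<open>y\<close> are covered by the symmetry \<open>z \<mapsto> - z\<close>. The phase of \<open>x\<close> varies
  with the fractional part \<open>\<beta>\<close> of \<open>y\<close> and its modulus with \<open>\<alpha> = d * y\<close>, so \<open>d\<close> times the integral over \<open>y\<close>
  is a double integral over \<open>\<alpha>\<close> and \<open>\<beta>\<close> (with \<open>y = \<lfloor>\<alpha> / d\<rfloor> + \<beta>\<close>), to which dominated convergence applies:
  uniformly in \<open>d\<close>, the integrand is bounded by a constant times
  \<open>exp (- c * \<bar>\<alpha>\<bar>) * min 1 \<bar>\<alpha>\<bar> powr (- \<nu>) * \<bar>\<beta>\<bar> powr (- \<nu>)\<close> with \<open>\<nu> < 1\<close>.

  The reflection formula is the modular transformation of a theta function. The quotient of its two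
  sides is an entire doubly periodic function, hence a constant; its cube is \<open>1\<close> by Euler's identity,
  it depends continuously on \<open>d\<close>, and it equals \<open>1\<close> at \<open>d = 1\<close>.
\<close>

section \<open>Infinite q-Pochhammer symbols\<close>

text \<open>The periods are conjugate, \<open>omega2 d = cnj (omega1 d)\<close>, so the dual base is
  \<open>cnj q\<close>. Hence the modulus of a gamma factor is an elementary exponential times the
  modulus of a single ratio with real exponent, and only one base needs bounds. The factor
  \<open>1 + d\<^sup>2\<close> in the substitution gives the phase of \<open>x\<close> period
  exactly 1 in \<open>y\<close>; hence the unit cells. Two different estimates are required.
  Pointwise convergence matters only for \<open>\<alpha> \<noteq> 0\<close>, where (up to the
  symmetry) \<open>norm x\<close> has a limit below 1 and a logarithmic power series suffices.
  Domination must reach \<open>\<alpha> = \<beta> = 0\<close>, where \<open>x\<close> tends to 1;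
  there the product is compared factor by factor with a telescoping one. The singularity at the
  origin is that of \<open>norm (1 - x) powr (- 2 * \<nu>)\<close> with \<open>2 * \<nu>\<close>
  possibly above 1, integrable in two dimensions but not in one. Splitting the power evenly between
  \<open>\<alpha>\<close> and \<open>\<beta>\<close> leaves an exponent below 1 in each. For
  \<open>m \<noteq> 0\<close> the shift \<open>g / d\<close> is unbounded as \<open>d\<close> tends
  to 0; subtracting \<open>m\<close> periods leaves a bounded exponent.\<close>

lemma summable_norm_qpoch:
  fixes x q :: complex
  assumes "norm q < 1"
  shows "summable (\<lambda>j. norm (- (x * q ^ j)))"
  using assms by (auto simp: norm_mult norm_power intro!: summable_mult summable_geometric)

lemma has_prod_qpoch:
  assumes "norm q < 1"
  shows "(\<lambda>j. 1 - x * q ^ j) has_prod qpoch_inf x q"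
proof -
  have "abs_convergent_prod (\<lambda>j. 1 - x * q ^ j)"
    using summable_norm_qpoch[OF assms, of x] by (subst abs_convergent_prod_conv_summable) simp
  then have "convergent_prod (\<lambda>j. 1 - x * q ^ j)"
    by (rule abs_convergent_prod_imp_convergent_prod)
  then show ?thesis
    unfolding qpoch_inf_def by (rule convergent_prod_has_prod)
qed

lemma LIMSEQ_qpoch:
  assumes "norm q < 1"
  shows "(\<lambda>n. \<Prod>j<n. 1 - x * q ^ j) \<longlonglongrightarrow> qpoch_inf x q"
  using has_prod_imp_tendsto'[OF has_prod_qpoch[OF assms]] .

lemma qpoch_eq_0_iff:
  assumes "norm q < 1"
  shows "qpoch_inf x q = 0 \<longleftrightarrow> (\<exists>j. x * q ^ j = 1)"
  by (subst has_prod_eq_0_iff[OF has_prod_qpoch[OF assms]]) (force simp: image_def)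

lemma qpoch_eqI:
  assumes "norm q < 1" "(\<lambda>n. \<Prod>j<n. 1 - x * q ^ j) \<longlonglongrightarrow> l"
  shows "qpoch_inf x q = l"
  using LIMSEQ_unique[OF LIMSEQ_qpoch[OF assms(1)] assms(2)] .

lemma qpoch_step:
  assumes "norm q < 1"
  shows "qpoch_inf x q = (1 - x) * qpoch_inf (x * q) q"
proof (rule LIMSEQ_unique)
  show "(\<lambda>n. \<Prod>j<Suc n. 1 - x * q ^ j) \<longlonglongrightarrow> qpoch_inf x q"
    using LIMSEQ_qpoch[OF assms] by (rule LIMSEQ_Suc)
  show "(\<lambda>n. \<Prod>j<Suc n. 1 - x * q ^ j) \<longlonglongrightarrow> (1 - x) * qpoch_inf (x * q) q"
    using tendsto_mult_left[OF LIMSEQ_qpoch[OF assms, of "x * q"], of "1 - x"]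
    by (simp add: prod.lessThan_Suc_shift mult_ac o_def del: prod.lessThan_Suc)
qed

lemma qpoch_cnj:
  assumes "norm q < 1"
  shows "qpoch_inf (cnj x) (cnj q) = cnj (qpoch_inf x q)"
  using tendsto_cnj[OF LIMSEQ_qpoch[OF assms, of x]] assms
  by (intro qpoch_eqI) auto

lemma qpoch_0 [simp]: "qpoch_inf 0 q = 1"
  by (simp add: qpoch_inf_def)

text \<open>Uniformity is wanted jointly in the argument and the base, because the continuity
  argument in \<open>d\<close> moves both. The majorant is the geometric series
  \<open>M * r ^ n\<close>.\<close>

lemma uniform_limit_qpoch:
  assumes "r < 1"
  shows "uniform_limit (cball 0 M \<times> cball 0 r) (\<lambda>n z. \<Prod>j<n. 1 - fst z * snd z ^ j)
           (\<lambda>z. qpoch_inf (fst z) (snd z)) sequentially"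
proof -
  let ?A = "cball (0::complex) M \<times> cball (0::complex) r"
  show ?thesis
  proof (cases "r < 0")
    case True
    then have "?A = {}" by auto
    then show ?thesis unfolding \<open>?A = {}\<close> by (simp add: uniform_limit_iff)
  next
    case False
    have "uniformly_convergent_on ?A (\<lambda>n z. \<Sum>j<n. norm ((1 - fst z * snd z ^ j) - 1))"
    proof (rule Weierstrass_m_test')
      fix n z assume z: "z \<in> ?A"
      have "norm (fst z) \<le> M" "norm (snd z) \<le> r" using z by auto
      then show "norm (norm ((1 - fst z * snd z ^ n) - 1)) \<le> M * r ^ n"
        by (auto simp: norm_mult norm_power intro!: mult_mono power_mono
              intro: order_trans[OF norm_ge_zero])
    next
      show "summable (\<lambda>n. M * r ^ n)"
        using assms False by (auto intro!: summable_mult summable_geometric)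
    qed
    moreover have "compact ?A" by (intro compact_Times compact_cball)
    ultimately have "uniformly_convergent_on ?A (\<lambda>n z. \<Prod>j<n. 1 - fst z * snd z ^ j)"
      by (intro uniformly_convergent_on_prod') (auto intro!: continuous_intros)
    then obtain l where l: "uniform_limit ?A (\<lambda>n z. \<Prod>j<n. 1 - fst z * snd z ^ j) l sequentially"
      by (auto simp: uniformly_convergent_on_def)
    have "l z = qpoch_inf (fst z) (snd z)" if "z \<in> ?A" for z
      using tendsto_uniform_limitI[OF l that] that assms
      by (intro qpoch_eqI[symmetric]) auto
    then show ?thesis using l
      by (metis (no_types, lifting) uniform_limit_cong')
  qed
qed

lemma isCont_qpoch:
  assumes "norm q < 1"
  shows "isCont (\<lambda>z. qpoch_inf (fst z) (snd z)) (x, q)"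
proof -
  define r where "r = (1 + norm q) / 2"
  have r: "norm q < r" "r < 1" using assms by (auto simp: r_def)
  let ?A = "cball (0::complex) (norm x + 1) \<times> cball (0::complex) r"
  have "continuous_on ?A (\<lambda>z. qpoch_inf (fst z) (snd z))"
    by (rule uniform_limit_theorem[OF _ uniform_limit_qpoch[OF r(2)]])
       (auto intro!: always_eventually continuous_intros)
  moreover have "(x, q) \<in> interior ?A"
    using r by (simp add: interior_Times dist_norm)
  ultimately show ?thesis
    by (rule continuous_on_interior)
qed

lemma tendsto_qpoch:
  assumes "(f \<longlongrightarrow> x) F" "(g \<longlongrightarrow> q) F" "norm q < 1"
  shows "((\<lambda>t. qpoch_inf (f t) (g t)) \<longlongrightarrow> qpoch_inf x q) F"
  using isCont_tendsto_compose[OF isCont_qpoch[OF assms(3)] tendsto_Pair[OF assms(1,2)]]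
  by simp

lemma continuous_on_qpoch [continuous_intros]:
  assumes "continuous_on S f" "continuous_on S g" "\<And>t. t \<in> S \<Longrightarrow> norm (g t) < 1"
  shows "continuous_on S (\<lambda>t. qpoch_inf (f t) (g t))"
  using assms unfolding continuous_on_def by (auto intro: tendsto_qpoch)

lemma holomorphic_qpoch:
  assumes "norm q < 1"
  shows "(\<lambda>x. qpoch_inf x q) holomorphic_on UNIV"
proof (rule holomorphic_uniform_sequence)
  show "(\<lambda>x. \<Prod>j<n. 1 - x * q ^ j) holomorphic_on UNIV" for n
    by (intro holomorphic_intros)
  fix x :: complex
  let ?f = "\<lambda>n z. \<Prod>j<n. 1 - fst z * snd z ^ j"
  have "uniform_limit (cball 0 (norm x + 1) \<times> cball 0 (norm q)) ?f
           (\<lambda>z. qpoch_inf (fst z) (snd z)) sequentially"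
    by (rule uniform_limit_qpoch[OF assms])
  moreover have "(y, q) \<in> cball 0 (norm x + 1) \<times> cball 0 (norm q)" if "y \<in> cball x 1" for y
    using that norm_triangle_sub[of y x] by (simp add: dist_norm norm_minus_commute)
  ultimately have "uniform_limit (cball x 1) (\<lambda>n y. ?f n (y, q)) (\<lambda>y. qpoch_inf y q) sequentially"
    unfolding uniform_limit_iff by (fastforce elim!: eventually_mono)
  then show "\<exists>d>0. cball x d \<subseteq> UNIV \<and>
      uniform_limit (cball x d) (\<lambda>n x. \<Prod>j<n. 1 - x * q ^ j) (\<lambda>x. qpoch_inf x q) sequentially"
    by (intro exI[of _ 1]) simp
qed auto

lemma holomorphic_on_qpoch [holomorphic_intros]:
  assumes "f holomorphic_on S" "norm q < 1"
  shows "(\<lambda>z. qpoch_inf (f z) q) holomorphic_on S"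
  using holomorphic_on_compose[OF assms(1) holomorphic_on_subset[OF holomorphic_qpoch[OF assms(2)]]]
  by (simp add: o_def)

lemma qpoch_split:
  assumes "norm q < 1"
  shows "qpoch_inf x q = qpoch_inf x (q\<^sup>2) * qpoch_inf (x * q) (q\<^sup>2)"
proof (rule LIMSEQ_unique)
  show "(\<lambda>n. \<Prod>j<2 * n. 1 - x * q ^ j) \<longlonglongrightarrow> qpoch_inf x q"
    using LIMSEQ_subseq_LIMSEQ[OF LIMSEQ_qpoch[OF assms, of x], of "\<lambda>n. 2 * n"]
    by (simp add: o_def strict_mono_def)
  have eq: "(\<Prod>j<2 * n. 1 - x * q ^ j) =
      (\<Prod>j<n. 1 - x * (q\<^sup>2) ^ j) * (\<Prod>j<n. 1 - x * q * (q\<^sup>2) ^ j)" for n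
    by (induction n) (simp_all add: mult_ac flip: power_mult)
  have "norm (q\<^sup>2) < 1" using assms by (simp add: norm_power power_less_one_iff abs_square_less_1)
  then show "(\<lambda>n. \<Prod>j<2 * n. 1 - x * q ^ j) \<longlonglongrightarrow> qpoch_inf x (q\<^sup>2) * qpoch_inf (x * q) (q\<^sup>2)"
    unfolding eq by (intro tendsto_mult LIMSEQ_qpoch)
qed

lemma qpoch_mult_minus:
  assumes "norm q < 1"
  shows "qpoch_inf x q * qpoch_inf (- x) q = qpoch_inf (x\<^sup>2) (q\<^sup>2)"
proof (rule LIMSEQ_unique)
  show "(\<lambda>n. (\<Prod>j<n. 1 - x * q ^ j) * (\<Prod>j<n. 1 - (- x) * q ^ j)) \<longlonglongrightarrow> qpoch_inf x q * qpoch_inf (- x) q"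
    by (intro tendsto_mult LIMSEQ_qpoch assms)
  have eq: "(\<Prod>j<n. 1 - x * q ^ j) * (\<Prod>j<n. 1 - (- x) * q ^ j) = (\<Prod>j<n. 1 - x\<^sup>2 * (q\<^sup>2) ^ j)" for n
    unfolding prod.distrib[symmetric]
    by (intro prod.cong refl) (simp add: algebra_simps power2_eq_square power_mult_distrib)
  have "norm (q\<^sup>2) < 1" using assms by (simp add: norm_power power_less_one_iff abs_square_less_1)
  then show "(\<lambda>n. (\<Prod>j<n. 1 - x * q ^ j) * (\<Prod>j<n. 1 - (- x) * q ^ j)) \<longlonglongrightarrow> qpoch_inf (x\<^sup>2) (q\<^sup>2)"
    unfolding eq by (intro LIMSEQ_qpoch)
qed

text \<open>The left-hand side is invariant under \<open>t \<mapsto> t\<^sup>2\<close>, so its value is the limit at \<open>t = 0\<close>.\<close>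

lemma qpoch_mult_qpoch_minus:
  assumes "norm t < 1"
  shows "qpoch_inf t (t\<^sup>2) * qpoch_inf (- t) t = 1"
proof -
  define S where "S t = qpoch_inf t (t\<^sup>2) * qpoch_inf (- t) t" for t :: complex
  have sq: "norm (t\<^sup>2) < 1" if "norm t < 1" for t :: complex
    using that by (simp add: norm_power power_less_one_iff abs_square_less_1)
  have step: "S t = S (t\<^sup>2)" if "norm t < 1" for t
    using qpoch_split[OF that, of "- t"] qpoch_mult_minus[OF sq[OF that], of t]
    by (simp add: S_def power2_eq_square mult_ac)
  have nn: "norm (t ^ 2 ^ n) < 1" for n
    using assms by (simp add: norm_power power_less_one_iff)
  have S: "S t = S (t ^ 2 ^ n)" for n
  proof (induction n)
    case (Suc n)
    have "t ^ 2 ^ Suc n = (t ^ 2 ^ n)\<^sup>2" by (simp add: mult.commute flip: power_mult)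
    then show ?case using Suc step[OF nn[of n]] by simp
  qed simp
  have "strict_mono (\<lambda>n. 2 ^ n :: nat)" by (simp add: strict_mono_def)
  from LIMSEQ_subseq_LIMSEQ[OF LIMSEQ_power_zero[OF assms] this]
  have lim: "(\<lambda>n. t ^ 2 ^ n) \<longlonglongrightarrow> 0" by (simp add: o_def)
  have "(\<lambda>n. S (t ^ 2 ^ n)) \<longlonglongrightarrow> qpoch_inf 0 (0\<^sup>2) * qpoch_inf (- 0) 0"
    unfolding S_def by (intro tendsto_mult tendsto_qpoch tendsto_intros lim) auto
  then have "(\<lambda>n. S t) \<longlonglongrightarrow> 1" using S by simp
  then show ?thesis by (simp add: S_def LIMSEQ_const_iff)
qed

text \<open>The first two factors multiply to the symbol with argument \<open>p\<^sup>2\<close> and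
  base \<open>p ^ 4\<close>, so the previous identity applies at \<open>t = p\<^sup>2\<close>. Up to
  squares and a factor 2, the three factors are the theta values at the three half periods.\<close>

lemma qpoch_euler:
  assumes "norm p < 1"
  shows "qpoch_inf p (p\<^sup>2) * qpoch_inf (- p) (p\<^sup>2) * qpoch_inf (- p\<^sup>2) (p\<^sup>2) = 1"
proof -
  have sq: "norm (p\<^sup>2) < 1"
    using assms by (simp add: norm_power power_less_one_iff abs_square_less_1)
  show ?thesis
    using qpoch_mult_minus[OF sq, of p] qpoch_mult_qpoch_minus[OF sq] by simp
qed

text \<open>The series \<open>G\<close> satisfies
  \<open>exp (- G x) = (1 - x) * exp (- G (x * q))\<close>, because \<open>G x - G (x * q)\<close>
  is the series of \<open>- Ln (1 - x)\<close>. Iteration produces the partial products, and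
  continuity of \<open>G\<close> at 0 disposes of the remaining factor; no logarithm of an infinite
  product is taken.\<close>

lemma qpoch_exp_series:
  assumes x: "norm x < 1" and q: "norm q < 1"
  shows "summable (\<lambda>n. x ^ Suc n / (of_nat (Suc n) * (1 - q ^ Suc n)))" (is ?A)
    and "qpoch_inf x q = exp (- (\<Sum>n. x ^ Suc n / (of_nat (Suc n) * (1 - q ^ Suc n))))" (is ?B)
proof -
  \<comment> \<open>Coefficient 0 at index 0 turns the series, which starts at exponent 1, into an
    ordinary power series.\<close>
  define c where "c n = (if n = 0 then 0 else 1 / (of_nat n * (1 - q ^ n)))" for n
  define G where "G x = (\<Sum>n. c n * x ^ n)" for x
  have nq: "norm (q ^ n) \<le> norm q" if "n > 0" for n
    using q that by (simp add: norm_power power_le_one_iff power_le_imp_le_exp self_le_power)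
       (metis Suc_leI norm_ge_zero less_imp_le power_decreasing power_one_right One_nat_def)
  have lower: "norm (1 - q ^ n) \<ge> 1 - norm q" if "n > 0" for n
    using norm_triangle_ineq2[of 1 "q ^ n"] nq[OF that] by simp
  have q1: "1 - q ^ n \<noteq> 0" if "n > 0" for n
    using lower[OF that] q by auto
  have c: "norm (c n) \<le> 1 / (1 - norm q)" for n
  proof (cases "n = 0")
    case False
    have "norm (c n) = 1 / (real n * norm (1 - q ^ n))"
      using False by (simp add: c_def norm_divide norm_mult)
    also have "\<dots> \<le> 1 / (1 * (1 - norm q))"
      using False lower[of n] q by (intro divide_left_mono mult_mono mult_pos_pos) auto
    finally show ?thesis by simp
  qed (use q in \<open>auto simp: c_def\<close>)
  have summ: "summable (\<lambda>n. c n * x ^ n)" if "norm x < 1" for x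
  proof (rule summable_comparison_test')
    show "summable (\<lambda>n. 1 / (1 - norm q) * norm x ^ n)"
      using that by (intro summable_mult summable_geometric) auto
    show "norm (c n * x ^ n) \<le> 1 / (1 - norm q) * norm x ^ n" for n
      unfolding norm_mult norm_power by (intro mult_right_mono c) auto
  qed
  have G0: "G 0 = 0" by (simp add: G_def c_def)
  have Suc: "(\<Sum>n. x ^ Suc n / (of_nat (Suc n) * (1 - q ^ Suc n))) = G x" "?A"
  proof -
    have *: "(\<lambda>n. x ^ Suc n / (of_nat (Suc n) * (1 - q ^ Suc n))) = (\<lambda>n. c (Suc n) * x ^ Suc n)"
      by (auto simp: c_def fun_eq_iff simp del: of_nat_Suc power_Suc)
    show "?A" unfolding * using summ[OF x] by (subst summable_Suc_iff)
    show "(\<Sum>n. x ^ Suc n / (of_nat (Suc n) * (1 - q ^ Suc n))) = G x"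
      unfolding * G_def using suminf_split_head[OF summ[OF x]] by (simp add: c_def)
  qed
  have contG: "isCont G 0"
  proof -
    have "isCont (\<lambda>x. \<Sum>n. c n * x ^ n) 0"
      by (rule isCont_powser[of c "1/2"]) (auto intro!: summ)
    then show ?thesis by (simp add: G_def [abs_def])
  qed
  have step: "exp (- G x) = (1 - x) * exp (- G (x * q))" if x: "norm x < 1" for x
  proof -
    have xq: "norm (x * q) < 1"
      using x q by (metis mult_le_less_imp_less norm_ge_zero norm_mult mult.right_neutral less_eq_real_def mult_strict_mono' )
    have "(\<lambda>n. c n * x ^ n - c n * (x * q) ^ n) sums (G x - G (x * q))"
      unfolding G_def by (intro sums_diff summable_sums summ x xq)
    moreover have "(\<lambda>n. c n * x ^ n - c n * (x * q) ^ n) = (\<lambda>n. - ((-1)^(Suc n) / of_nat n * (- x) ^ n))"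
    proof
      fix n
      show "c n * x ^ n - c n * (x * q) ^ n = - ((-1)^(Suc n) / of_nat n * (- x) ^ n)"
      proof (cases "n = 0")
        case False
        have "c n * x ^ n - c n * (x * q) ^ n = c n * (1 - q ^ n) * x ^ n"
          by (simp add: algebra_simps power_mult_distrib)
        also have "c n * (1 - q ^ n) = 1 / of_nat n" using False q1[of n] by (simp add: c_def)
        also have "1 / of_nat n * x ^ n = - ((-1)^(Suc n) / of_nat n * (- x) ^ n)"
        proof -
          have "(- 1) ^ n * (- x) ^ n = x ^ n" by (simp flip: power_mult_distrib)
          then show ?thesis by simp
        qed
        finally show ?thesis .
      qed (simp add: c_def)
    qed
    ultimately have "(\<lambda>n. - ((-1)^(Suc n) / of_nat n * (- x) ^ n)) sums (G x - G (x * q))" by simp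
    moreover have "(\<lambda>n. - ((-1)^(Suc n) / of_nat n * (- x) ^ n)) sums (- ln (1 + (- x)))"
      using Ln_series[of "- x"] x by (intro sums_minus) simp
    ultimately have "G x - G (x * q) = - ln (1 - x)"
      using sums_unique2 by fastforce
    then have "- G x = ln (1 - x) + (- G (x * q))" by (simp add: algebra_simps)
    then have "exp (- G x) = exp (ln (1 - x)) * exp (- G (x * q))" by (simp only: exp_add)
    moreover have "1 - x \<noteq> 0" using x by auto
    ultimately show ?thesis by simp
  qed
  have nle: "norm (x * q ^ n) < 1" for n
  proof -
    have "norm q ^ n \<le> 1" using q by (simp add: power_le_one)
    then have "norm x * norm q ^ n \<le> norm x" by (simp add: mult_left_le)
    then show ?thesis using x by (simp add: norm_mult norm_power)
  qed
  have "exp (- G x) = (\<Prod>j<n. 1 - x * q ^ j) * exp (- G (x * q ^ n))" for n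
  proof (induction n)
    case (Suc n)
    show ?case using Suc step[OF nle[of n]] by (simp add: mult_ac)
  qed simp
  moreover have "(\<lambda>n. (\<Prod>j<n. 1 - x * q ^ j) * exp (- G (x * q ^ n))) \<longlonglongrightarrow> qpoch_inf x q * exp (- G 0)"
  proof (intro tendsto_mult LIMSEQ_qpoch q tendsto_exp tendsto_minus)
    have "(\<lambda>n. x * q ^ n) \<longlonglongrightarrow> x * 0" by (intro tendsto_mult_left LIMSEQ_power_zero q)
    then show "(\<lambda>n. G (x * q ^ n)) \<longlonglongrightarrow> G 0"
      using isCont_tendsto_compose[OF contG] by simp
  qed
  ultimately have "exp (- G x) = qpoch_inf x q"
    using G0 by (simp add: LIMSEQ_const_iff)
  then show ?B using Suc by simp
  show ?A by fact
qed

section \<open>The reflection formula\<close>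

text \<open>With \<open>q = exp (- 2 * h)\<close>, \<open>p = exp (- h)\<close> and
  \<open>w = exp (- h * t)\<close> this is the Jacobi theta product
  \<open>(p * w; q) * (p / w; q)\<close> without its factor \<open>(q; q)\<close>. In the variable
  \<open>t\<close> it is even, with period \<open>2 * pi * \<i> / h\<close> and quasi-period
  2.\<close>

definition qtheta :: "complex \<Rightarrow> complex \<Rightarrow> complex" where
  "qtheta h t = qpoch_inf (exp (- h * (1 + t))) (exp (- 2 * h)) * qpoch_inf (exp (- h * (1 - t))) (exp (- 2 * h))"

lemma norm_exp_minus2_lt_1: "Re h > 0 \<Longrightarrow> norm (exp (- 2 * h)) < 1"
  by simp

lemma qtheta_cnj: "Re h > 0 \<Longrightarrow> qtheta (cnj h) (cnj t) = cnj (qtheta h t)"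
  using qpoch_cnj[of "exp (- 2 * h)" "exp (- h * (1 + t))"] qpoch_cnj[of "exp (- 2 * h)" "exp (- h * (1 - t))"]
  by (simp add: qtheta_def exp_cnj)

lemma qtheta_period:
  assumes "h \<noteq> 0"
  shows "qtheta h (t + 2 * pi * \<i> / h) = qtheta h t"
proof -
  have "- h * (1 + (t + 2 * pi * \<i> / h)) = - h * (1 + t) - 2 * pi * \<i>"
    "- h * (1 - (t + 2 * pi * \<i> / h)) = - h * (1 - t) + 2 * pi * \<i>"
    using assms by (simp_all add: field_simps)
  then have "exp (- h * (1 + (t + 2 * pi * \<i> / h))) = exp (- h * (1 + t))"
    "exp (- h * (1 - (t + 2 * pi * \<i> / h))) = exp (- h * (1 - t))"
    by (simp_all only: exp_add exp_diff) (simp_all add: exp_two_pi_i)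
  then show ?thesis unfolding qtheta_def by (simp only:)
qed

text \<open>The shift removes the leading factor \<open>1 - w\<close> from one symbol and adds
  \<open>1 - inverse w\<close> to the other; the quotient of the two is
  \<open>- inverse w\<close>.\<close>

lemma qtheta_add_2:
  assumes "Re h > 0"
  shows "qtheta h (t + 2) = - exp (h * (1 + t)) * qtheta h t"
proof -
  define w where "w = exp (- h * (1 + t))"
  define q where "q = exp (- 2 * h)"
  have q: "norm q < 1" using assms by (simp add: q_def)
  have w0: "w \<noteq> 0" by (simp add: w_def)
  have e: "exp (- h * (1 + (t + 2))) = w * q" "exp (- h * (1 - (t + 2))) = inverse w"
    "exp (- h * (1 - t)) = inverse w * q" "exp (h * (1 + t)) = inverse w"
    by (simp_all add: w_def q_def algebra_simps flip: exp_add exp_minus)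
  have "qtheta h (t + 2) = qpoch_inf (w * q) q * qpoch_inf (inverse w) q"
    by (simp only: qtheta_def e q_def)
  also have "qpoch_inf (inverse w) q = (1 - inverse w) * qpoch_inf (inverse w * q) q"
    by (rule qpoch_step[OF q])
  also have "qpoch_inf (w * q) q * ((1 - inverse w) * qpoch_inf (inverse w * q) q) =
      - inverse w * ((1 - w) * qpoch_inf (w * q) q * qpoch_inf (inverse w * q) q)"
    using w0 by (simp add: field_simps)
  also have "(1 - w) * qpoch_inf (w * q) q = qpoch_inf w q"
    by (rule qpoch_step[OF q, symmetric])
  also have "qpoch_inf w q * qpoch_inf (inverse w * q) q = qtheta h t"
    by (simp only: qtheta_def e q_def w_def)
  finally show ?thesis by (simp only: e)
qed

lemma qtheta_eq_0:
  assumes "Re h > 0" "qtheta h t = 0"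
  shows "\<exists>a b::int. t = 1 + 2 * of_int a + of_int b * (2 * pi * \<i> / h)"
proof -
  have h0: "h \<noteq> 0" using assms by auto
  have q: "norm (exp (- 2 * h)) < 1" using assms by simp
  have *: "\<exists>a b::int. t = 1 + 2 * of_int a + of_int b * (2 * pi * \<i> / h)"
    if "exp (- h * (1 - t)) * exp (- 2 * h) ^ j = 1" for j t
  proof -
    have "exp (- h * (1 - t)) * exp (- 2 * h) ^ j = exp (h * (t - 1 - 2 * of_nat j))"
      by (simp add: algebra_simps flip: exp_of_nat_mult exp_add)
    then have "exp (h * (t - 1 - 2 * of_nat j)) = 1" using that by simp
    then obtain n :: int where "Re (h * (t - 1 - 2 * of_nat j)) = 0"
      "Im (h * (t - 1 - 2 * of_nat j)) = of_int (2 * n) * pi"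
      unfolding exp_eq_1 by blast
    then have n: "h * (t - 1 - 2 * of_nat j) = 2 * of_int n * pi * \<i>"
      by (intro complex_eqI) simp_all
    then have "t = 1 + 2 * of_nat j + of_int n * (2 * pi * \<i> / h)"
      using h0 by (simp add: field_simps)
    then show ?thesis by (intro exI[of _ "int j"] exI[of _ n]) simp
  qed
  from assms(2) consider "qpoch_inf (exp (- h * (1 + t))) (exp (- 2 * h)) = 0"
    | "qpoch_inf (exp (- h * (1 - t))) (exp (- 2 * h)) = 0" by (auto simp: qtheta_def)
  then show ?thesis
  proof cases
    \<comment> \<open>The first symbol is the second one at \<open>- t\<close>, and the set of zeros
      is symmetric: \<open>- (1 + 2 * a) = 1 + 2 * (- a - 1)\<close>.\<close>
    case 1
    then obtain j where "exp (- h * (1 - (- t))) * exp (- 2 * h) ^ j = 1"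
      using qpoch_eq_0_iff[OF q] by auto
    from *[OF this] obtain a b :: int where "- t = 1 + 2 * of_int a + of_int b * (2 * pi * \<i> / h)"
      by blast
    then have "t = - (1 + 2 * of_int a + of_int b * (2 * pi * \<i> / h))"
      by (simp only: minus_equation_iff[of t] eq_commute[of "- t"])
    then have "t = 1 + 2 * of_int (- a - 1) + of_int (- b) * (2 * pi * \<i> / h)"
      by simp
    then show ?thesis by blast
  next
    case 2
    then show ?thesis using * qpoch_eq_0_iff[OF q] by auto
  qed
qed

lemma holomorphic_qtheta:
  assumes "Re h > 0"
  shows "qtheta h holomorphic_on S"
  unfolding qtheta_def [abs_def] using assms by (intro holomorphic_intros) auto

text \<open>Splits off the simple zero at \<open>t = 1\<close>. Applied to both \<open>h\<close> and
  \<open>cnj h\<close>, it reduces the behaviour of the theta quotient at 1 to that of two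
  elementary factors.\<close>

lemma qtheta_near_1:
  assumes "Re h > 0"
  shows "\<exists>f. isCont f 1 \<and> f 1 = (qpoch_inf (exp (- 2 * h)) (exp (- 2 * h)))\<^sup>2 \<and>
    (\<forall>t. qtheta h t = (1 - exp (- h * (1 - t))) * f t)"
proof -
  define f where "f t = qpoch_inf (exp (- h * (1 + t))) (exp (- 2 * h)) *
    qpoch_inf (exp (- h * (1 - t)) * exp (- 2 * h)) (exp (- 2 * h))" for t
  have "isCont f 1" unfolding f_def using assms
    by (intro continuous_on_interior[of UNIV] continuous_intros) auto
  moreover have "f 1 = (qpoch_inf (exp (- 2 * h)) (exp (- 2 * h)))\<^sup>2"
    by (simp add: f_def power2_eq_square mult_ac)
  moreover have "qtheta h t = (1 - exp (- h * (1 - t))) * f t" for t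
    unfolding qtheta_def f_def using qpoch_step[OF norm_exp_minus2_lt_1[OF assms], of "exp (- h * (1 - t))"]
    by (simp add: mult_ac)
  ultimately show ?thesis by blast
qed

section \<open>Entire functions with two periods\<close>

lemma entire_imp_analytic: "f holomorphic_on UNIV \<Longrightarrow> f analytic_on S"
  by (metis analytic_on_open analytic_on_subset open_UNIV subset_UNIV)

lemma periodic_int:
  fixes f :: "complex \<Rightarrow> 'a"
  assumes "\<And>t. f (t + T) = f t"
  shows "f (t + of_int n * T) = f t"
proof (induction n arbitrary: t rule: int_induct[of _ 0])
  case (step1 i)
  have "f (t + of_int (i + 1) * T) = f ((t + of_int i * T) + T)" by (simp add: algebra_simps)
  then show ?case using assms step1 by simp
next
  case (step2 i)
  have "f (t + of_int (i - 1) * T) = f ((t + of_int (i - 1) * T) + T)" by (simp only: assms)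
  also have "\<dots> = f (t + of_int i * T)" by (simp add: algebra_simps)
  finally show ?case using step2 by simp
qed simp

text \<open>Reducing the real coordinates modulo 1 shows that all values of \<open>f\<close> are
  taken on the compact image of the unit square, so \<open>f\<close> is bounded and Liouville's
  theorem applies.\<close>

lemma entire_doubly_periodic_constant:
  fixes f :: "complex \<Rightarrow> complex"
  assumes hol: "f holomorphic_on UNIV"
    and per: "\<And>t. f (t + T1) = f t" "\<And>t. f (t + T2) = f t"
    and indep: "\<And>t. \<exists>x y::real. t = of_real x * T1 + of_real y * T2"
  shows "f constant_on UNIV"
proof (rule Liouville_theorem[OF hol])
  let ?g = "\<lambda>z::real \<times> real. of_real (fst z) * T1 + of_real (snd z) * T2"
  have "compact (f ` (?g ` ({0..1} \<times> {0..1})))"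
    by (intro compact_continuous_image compact_Times continuous_intros
        holomorphic_on_imp_continuous_on holomorphic_on_subset[OF hol]) auto
  moreover have "range f \<subseteq> f ` (?g ` ({0..1} \<times> {0..1}))"
  proof
    fix w assume "w \<in> range f"
    then obtain t where t: "w = f t" by auto
    obtain x y :: real where xy: "t = of_real x * T1 + of_real y * T2" using indep by blast
    have "of_real (frac x) * T1 + of_real (frac y) * T2 + of_int \<lfloor>x\<rfloor> * T1 + of_int \<lfloor>y\<rfloor> * T2 = t"
      unfolding xy frac_def by (simp add: algebra_simps)
    then have "f t = f (of_real (frac x) * T1 + of_real (frac y) * T2 + of_int \<lfloor>x\<rfloor> * T1)"
      using periodic_int[where f = f and T = T2] per by metis
    also have "\<dots> = f (?g (frac x, frac y))"
      using periodic_int[where f = f and T = T1] per by simp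
    finally have "w = f (?g (frac x, frac y))" unfolding t .
    moreover have "(frac x, frac y) \<in> {0..1} \<times> {0..1}" by (auto simp: frac_lt_1 less_imp_le)
    ultimately show "w \<in> f ` (?g ` ({0..1} \<times> {0..1}))" by (metis (no_types, lifting) imageI)
  qed
  ultimately show "bounded (range f)"
    using bounded_subset compact_imp_bounded by blast
qed

text \<open>The relation between \<open>h\<close> and \<open>cnj h\<close> is the modular one: with \<open>q = exp (- 2 * h) = exp (2 * pi * \<i> * \<tau>)\<close>
  it reads \<open>cnj q = exp (- 2 * pi * \<i> / \<tau>)\<close>.\<close>

definition qtheta_ratio :: "complex \<Rightarrow> complex \<Rightarrow> complex" where
  "qtheta_ratio h t = exp (- \<i> * h * cnj h * t\<^sup>2 / (4 * pi)) * (qtheta (cnj h) t / qtheta h t)"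

context
  fixes h :: complex
  assumes Re_h: "Re h > 0" and modular: "cnj h - h = \<i> * h * cnj h / pi"
begin

lemma h_nz: "h \<noteq> 0" using Re_h by auto

text \<open>This is the modular relation divided by \<open>h * cnj h\<close>. It says that
  \<open>2\<close> and \<open>2 * pi * \<i> / h\<close> span the same lattice as \<open>2\<close>
  and \<open>2 * pi * \<i> / cnj h\<close>, so the two theta functions have the same zeros.\<close>

lemma periods: "2 * pi * \<i> / cnj h = 2 + 2 * pi * \<i> / h"
proof -
  have "2 * pi * \<i> * (h - cnj h) = 2 * h * cnj h"
  proof -
    have "h - cnj h = - (\<i> * h * cnj h / pi)" using modular by (metis minus_diff_eq)
    then show ?thesis by simp
  qed
  then have "2 * pi * \<i> * h = (2 * h + 2 * pi * \<i>) * cnj h" by (simp add: algebra_simps)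
  then show ?thesis using h_nz by (simp add: divide_simps mult_ac)
qed

text \<open>The shift is a period of the numerator. For the denominator it is \<open>2\<close> plus
  a period, which costs the factor \<open>- exp (h * (1 + t))\<close>; the coefficient in the
  Gaussian is the one for which it acquires the same factor.\<close>

lemma qtheta_ratio_period: "qtheta_ratio h (t + 2 * pi * \<i> / cnj h) = qtheta_ratio h t"
proof -
  define T where "T = 2 * pi * \<i> / cnj h"
  have T: "cnj h * T = 2 * pi * \<i>" "h * T = 2 * h + 2 * pi * \<i>"
    using h_nz unfolding T_def by (simp, subst periods, simp add: field_simps)
  have 1: "qtheta (cnj h) (t + T) = qtheta (cnj h) t"
    unfolding T_def using qtheta_period[of "cnj h" t] h_nz by simp
  have "qtheta h (t + T) = qtheta h ((t + 2) + 2 * pi * \<i> / h)"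
    unfolding T_def periods by (simp add: algebra_simps)
  also have "\<dots> = - exp (h * (1 + t)) * qtheta h t"
    using qtheta_period[OF h_nz] qtheta_add_2[OF Re_h] by simp
  finally have 2: "qtheta h (t + T) = - exp (h * (1 + t)) * qtheta h t" .
  have "- \<i> * h * cnj h * (t + T)\<^sup>2 / (4 * pi) =
      - \<i> * h * cnj h * t\<^sup>2 / (4 * pi) + (- \<i> * (2 * (h * t) * (cnj h * T) + (cnj h * T) * (h * T)) / (4 * pi))"
    by (simp add: field_simps power2_eq_square)
  also have "- \<i> * (2 * (h * t) * (cnj h * T) + (cnj h * T) * (h * T)) / (4 * pi) = h * (1 + t) + pi * \<i>"
    unfolding T by (simp add: field_simps)
  finally have "exp (- \<i> * h * cnj h * (t + T)\<^sup>2 / (4 * pi)) =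
      exp (- \<i> * h * cnj h * t\<^sup>2 / (4 * pi)) * (- exp (h * (1 + t)))"
    by (simp only: exp_add) (simp add: exp_pi_i)
  then have "qtheta_ratio h (t + T) = qtheta_ratio h t"
    unfolding qtheta_ratio_def 1 2 by simp
  then show ?thesis by (simp add: T_def)
qed

text \<open>Mirror image of the previous lemma: the denominator is invariant, and the numerator sees
  the shift as \<open>- 2\<close> plus a period.\<close>

lemma qtheta_ratio_period': "qtheta_ratio h (t + 2 * pi * \<i> / h) = qtheta_ratio h t"
proof -
  define T where "T = 2 * pi * \<i> / h"
  have T: "h * T = 2 * pi * \<i>" "cnj h * T = 2 * pi * \<i> - 2 * cnj h"
  proof -
    show "h * T = 2 * pi * \<i>" using h_nz by (simp add: T_def)
    have "T = 2 * pi * \<i> / cnj h - 2" using periods by (simp add: T_def)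
    then show "cnj h * T = 2 * pi * \<i> - 2 * cnj h" using h_nz by (simp add: field_simps)
  qed
  have 1: "qtheta h (t + T) = qtheta h t"
    unfolding T_def using qtheta_period[OF h_nz, of t] by simp
  have "qtheta (cnj h) (t - 2 + 2 * pi * \<i> / cnj h) = qtheta (cnj h) (t - 2)"
    using qtheta_period[of "cnj h"] h_nz by simp
  then have "qtheta (cnj h) (t + T) = qtheta (cnj h) (t - 2)"
    unfolding periods T_def by (simp add: algebra_simps)
  moreover have "qtheta (cnj h) t = - exp (cnj h * (t - 1)) * qtheta (cnj h) (t - 2)"
    using qtheta_add_2[of "cnj h" "t - 2"] Re_h by simp
  ultimately have 2: "qtheta (cnj h) t = - exp (cnj h * (t - 1)) * qtheta (cnj h) (t + T)" by simp
  have "- \<i> * h * cnj h * (t + T)\<^sup>2 / (4 * pi) =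
      - \<i> * h * cnj h * t\<^sup>2 / (4 * pi) + (- \<i> * (2 * (cnj h * t) * (h * T) + (h * T) * (cnj h * T)) / (4 * pi))"
    by (simp add: field_simps power2_eq_square)
  also have "- \<i> * (2 * (cnj h * t) * (h * T) + (h * T) * (cnj h * T)) / (4 * pi) = cnj h * (t - 1) + pi * \<i>"
    unfolding T by (simp add: field_simps)
  finally have "exp (- \<i> * h * cnj h * (t + T)\<^sup>2 / (4 * pi)) =
      exp (- \<i> * h * cnj h * t\<^sup>2 / (4 * pi)) * (- exp (cnj h * (t - 1)))"
    by (simp only: exp_add) (simp add: exp_pi_i)
  then have "qtheta_ratio h (t + T) = qtheta_ratio h t"
    unfolding qtheta_ratio_def 1 2 by simp
  then show ?thesis by (simp add: T_def)
qed

lemma qtheta_ratio_analytic_at: "qtheta h t \<noteq> 0 \<Longrightarrow> qtheta_ratio h analytic_on {t}"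
  unfolding qtheta_ratio_def [abs_def]
  by (intro analytic_intros entire_imp_analytic
      holomorphic_qtheta) (use Re_h in auto)

text \<open>At a zero of the denominator the numerator vanishes too. The zero differs from
  \<open>1\<close> by a lattice vector, so periodicity moves it to \<open>t = 1\<close>, where
  l'Hopital's rule handles the quotient of the two split-off factors.\<close>

lemma qtheta_ratio_limit: "\<exists>c. qtheta_ratio h \<midarrow>t\<rightarrow> c"
proof (cases "qtheta h t = 0")
  case False
  then show ?thesis using qtheta_ratio_analytic_at analytic_at_imp_isCont isContD by blast
next
  case True
  obtain f where f: "isCont f 1" "f 1 = (qpoch_inf (exp (- 2 * h)) (exp (- 2 * h)))\<^sup>2"
    "\<And>t. qtheta h t = (1 - exp (- h * (1 - t))) * f t"
    using qtheta_near_1[OF Re_h] by blast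
  obtain g where g: "isCont g 1" "\<And>t. qtheta (cnj h) t = (1 - exp (- cnj h * (1 - t))) * g t"
    using qtheta_near_1[of "cnj h"] Re_h by auto
  have "f 1 \<noteq> 0"
  proof
    assume "f 1 = 0"
    then obtain j where "exp (- 2 * h) * exp (- 2 * h) ^ j = 1"
      using f(2) qpoch_eq_0_iff[OF norm_exp_minus2_lt_1[OF Re_h]] by auto
    then have "norm (exp (- 2 * h)) ^ Suc j = 1" by (metis norm_one norm_power power_Suc)
    then show False using norm_exp_minus2_lt_1[OF Re_h]
      by (metis norm_ge_zero power_Suc_less_one less_irrefl power_eq_1_iff real_norm_def abs_norm_cancel nat.distinct(1))
  qed
  have lim: "((\<lambda>t. (1 - exp (- cnj h * (1 - t))) / (1 - exp (- h * (1 - t)))) \<longlongrightarrow> (- cnj h) / (- h)) (at 1)"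
  proof (rule lhopital_complex_simple)
    have "((\<lambda>t. 1 - exp (- w * (1 - t))) has_field_derivative - w) (at 1)" for w :: complex
      by (auto intro!: derivative_eq_intros)
    note D = this
    show "((\<lambda>t. 1 - exp (- cnj h * (1 - t))) has_field_derivative - cnj h) (at 1)"
      "((\<lambda>t. 1 - exp (- h * (1 - t))) has_field_derivative - h) (at 1)"
      by (rule D)+
  qed (use h_nz in auto)
  have "((\<lambda>t. exp (- \<i> * h * cnj h * t\<^sup>2 / (4 * pi)) *
      ((1 - exp (- cnj h * (1 - t))) / (1 - exp (- h * (1 - t))) * (g t / f t)))
      \<longlongrightarrow> exp (- \<i> * h * cnj h * 1\<^sup>2 / (4 * pi)) * ((- cnj h) / (- h) * (g 1 / f 1))) (at 1)"
    using f(1) g(1) \<open>f 1 \<noteq> 0\<close> unfolding isCont_def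
    by (intro tendsto_mult[OF _ tendsto_mult[OF lim tendsto_divide]] tendsto_intros) auto
  moreover have "qtheta_ratio h t = exp (- \<i> * h * cnj h * t\<^sup>2 / (4 * pi)) *
      ((1 - exp (- cnj h * (1 - t))) / (1 - exp (- h * (1 - t))) * (g t / f t))" for t
    by (simp add: qtheta_ratio_def f(3) g(2))
  ultimately obtain c where c: "qtheta_ratio h \<midarrow>1\<rightarrow> c"
    by (metis (no_types, lifting) Lim_cong_within)
  obtain a b :: int where ab: "t = 1 + 2 * of_int a + of_int b * (2 * pi * \<i> / h)"
    using qtheta_eq_0[OF Re_h True] by blast
  define w where "w = t - 1"
  \<comment> \<open>In terms of \<open>u\<close>, the vector \<open>2 * a + b * u\<close> is
    expressed in the periods \<open>2 + u\<close> and \<open>u\<close>, hence the coefficients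
    \<open>a\<close> and \<open>b - a\<close>.\<close>
  have "w = of_int a * (2 * pi * \<i> / cnj h) + of_int (b - a) * (2 * pi * \<i> / h)"
  proof -
    define u where "u = 2 * pi * \<i> / h"
    show ?thesis unfolding w_def ab periods u_def [symmetric] by (simp add: algebra_simps)
  qed
  then have "qtheta_ratio h (x + w) = qtheta_ratio h x" for x
    using periodic_int[where f = "qtheta_ratio h", OF qtheta_ratio_period]
      periodic_int[where f = "qtheta_ratio h", OF qtheta_ratio_period']
    by (metis add.assoc)
  then have "qtheta_ratio h (x + (1 - t)) = qtheta_ratio h x" for x
    by (metis add.assoc add.right_neutral diff_add_cancel add_diff_eq w_def minus_diff_eq uminus_add_conv_diff add.commute)
  moreover have "(\<lambda>x. qtheta_ratio h (x + (1 - t))) \<midarrow>1 - (1 - t)\<rightarrow> c"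
    using LIM_offset[OF c, of "1 - t"] .
  ultimately show ?thesis by auto
qed

text \<open>Filling the removable singularities gives an entire doubly periodic function. Zeros of
  the denominator are excluded in the statement because division by 0 yields 0 there instead of the
  limit.\<close>

lemma qtheta_ratio_constant: "\<exists>c. \<forall>t. qtheta h t \<noteq> 0 \<longrightarrow> qtheta_ratio h t = c"
proof -
  define F where "F = remove_sings (qtheta_ratio h)"
  have "F analytic_on {t}" for t
  proof -
    have "qtheta_ratio h meromorphic_on {t}"
      unfolding qtheta_ratio_def [abs_def]
      by (intro meromorphic_intros analytic_on_imp_meromorphic_on analytic_intros
          entire_imp_analytic holomorphic_qtheta)
        (use Re_h in auto)
    then have "isolated_singularity_at (qtheta_ratio h) t"
      by (simp add: meromorphic_on_isolated_singularity)
    then show ?thesis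
      unfolding F_def using qtheta_ratio_limit remove_sings_analytic_at by blast
  qed
  then have "F holomorphic_on UNIV"
    by (intro analytic_imp_holomorphic) (subst analytic_on_analytic_at, simp)
  moreover have per: "F (t + T) = F t" if "\<And>t. qtheta_ratio h (t + T) = qtheta_ratio h t" for t T
  proof -
    have "F (t + T) = remove_sings (\<lambda>w. qtheta_ratio h (t + T + w)) 0"
      unfolding F_def by (subst remove_sings_shift_0) simp
    also have "(\<lambda>w. qtheta_ratio h (t + T + w)) = (\<lambda>w. qtheta_ratio h (t + w))"
      using that[of "t + _"] by (simp add: add_ac)
    also have "remove_sings \<dots> 0 = F t"
      unfolding F_def by (subst (2) remove_sings_shift_0) simp
    finally show ?thesis .
  qed
  moreover have "\<exists>x y::real. t = of_real x * (2 * pi * \<i> / cnj h) + of_real y * (2 * pi * \<i> / h)" for t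
  proof -
    define T where "T = 2 * pi * \<i> / h"
    have "Im T = 2 * pi * Re h / (norm h)\<^sup>2"
      by (simp add: T_def Im_divide cmod_def)
    then have T: "Im T \<noteq> 0" using Re_h h_nz by simp
    define y where "y = Im t / Im T"
    define x where "x = (Re t - y * Re T) / 2"
    have "t = of_real x * (2 + T) + of_real (y - x) * T"
      using T by (simp add: complex_eq_iff x_def y_def field_simps)
    then show ?thesis unfolding periods T_def by blast
  qed
  ultimately have "F constant_on UNIV"
    by (intro entire_doubly_periodic_constant[where ?T1.0 = "2 * pi * \<i> / cnj h" and ?T2.0 = "2 * pi * \<i> / h"]
         per qtheta_ratio_period qtheta_ratio_period')
  then obtain c where "\<And>t. F t = c" by (auto simp: constant_on_def)
  then show ?thesis
    using qtheta_ratio_analytic_at unfolding F_def by (metis remove_sings_at_analytic)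
qed

text \<open>The constant is computed up to a cube root of unity by multiplying its values at three half periods.\<close>

lemma qtheta_ratio_0_cubed: "qtheta_ratio h 0 ^ 3 = exp ((h - cnj h) / 4 + pi * \<i> / 2)"
  and qtheta_0_nz: "qtheta h 0 \<noteq> 0"
proof -
  define p where "p = exp (- h)"
  define P where "P x = qpoch_inf x (p\<^sup>2)" for x
  have p: "norm p < 1" using Re_h by (simp add: p_def)
  have p2: "norm (p\<^sup>2) < 1" using p by (simp add: norm_power power_less_one_iff abs_square_less_1)
  have q: "exp (- 2 * h) = p\<^sup>2" by (simp add: p_def flip: exp_of_nat_mult)
  have qc: "exp (- 2 * cnj h) = cnj (p\<^sup>2)" by (simp add: p_def exp_cnj flip: exp_of_nat_mult)
  have cnjP: "qpoch_inf (cnj x) (cnj (p\<^sup>2)) = cnj (P x)" for x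
    unfolding P_def by (rule qpoch_cnj[OF p2])
  have euler: "P p * P (- p) * P (- p\<^sup>2) = 1"
    unfolding P_def using qpoch_euler[OF p] .
  then have nz: "P p \<noteq> 0" "P (- p) \<noteq> 0" "P (- p\<^sup>2) \<noteq> 0" by auto
  have m1: "P (- 1) = 2 * P (- p\<^sup>2)"
    unfolding P_def using qpoch_step[OF p2, of "- 1"] by simp
  have th0: "qtheta h 0 = (P p)\<^sup>2"
    by (simp only: qtheta_def q) (simp add: P_def p_def[symmetric] power2_eq_square)
  show "qtheta h 0 \<noteq> 0" using nz th0 by simp
  have thc0: "qtheta (cnj h) 0 = (cnj (P p))\<^sup>2"
    using qtheta_cnj[OF Re_h, of 0] by (simp add: th0)
  define T where "T = 2 * pi * \<i> / cnj h"
  have T: "cnj h * T = 2 * pi * \<i>" "h * T = 2 * h + 2 * pi * \<i>"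
    using h_nz unfolding T_def by (simp, subst periods, simp add: field_simps)
  have e: "exp (- h * (1 + T / 2)) = - p\<^sup>2" "exp (- h * (1 - T / 2)) = - 1"
    "exp (- cnj h * (1 + T / 2)) = cnj (- p)" "exp (- cnj h * (1 - T / 2)) = cnj (- p)"
  proof -
    have "- h * (1 + T / 2) = - 2 * h - pi * \<i>" "- h * (1 - T / 2) = pi * \<i>"
      "- cnj h * (1 + T / 2) = cnj (- h) - pi * \<i>" "- cnj h * (1 - T / 2) = cnj (- h) + pi * \<i>"
      using T by (simp_all add: algebra_simps) (simp_all add: field_simps)
    then show "exp (- h * (1 + T / 2)) = - p\<^sup>2" "exp (- h * (1 - T / 2)) = - 1"
      "exp (- cnj h * (1 + T / 2)) = cnj (- p)" "exp (- cnj h * (1 - T / 2)) = cnj (- p)"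
      by (simp_all only: exp_diff exp_add q exp_pi_i p_def flip: exp_cnj) (simp_all add: exp_cnj p_def)
  qed
  have thT: "qtheta h (T / 2) = 2 * (P (- p\<^sup>2))\<^sup>2"
    unfolding qtheta_def e q using m1 by (simp add: P_def power2_eq_square)
  have thcT: "qtheta (cnj h) (T / 2) = (cnj (P (- p)))\<^sup>2"
    unfolding qtheta_def e qc cnjP by (simp add: power2_eq_square)
  define T' where "T' = 2 * pi * \<i> / h"
  have T': "h * T' = 2 * pi * \<i>" "cnj h * T' = 2 * pi * \<i> - 2 * cnj h"
  proof -
    show "h * T' = 2 * pi * \<i>" using h_nz by (simp add: T'_def)
    have "T' = 2 * pi * \<i> / cnj h - 2" using periods by (simp add: T'_def)
    then show "cnj h * T' = 2 * pi * \<i> - 2 * cnj h" using h_nz by (simp add: field_simps)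
  qed
  have e': "exp (- h * (1 + T' / 2)) = - p" "exp (- h * (1 - T' / 2)) = - p"
    "exp (- cnj h * (1 + T' / 2)) = cnj (- 1)" "exp (- cnj h * (1 - T' / 2)) = cnj (- p\<^sup>2)"
  proof -
    have "- h * (1 + T' / 2) = - h - pi * \<i>" "- h * (1 - T' / 2) = - h + pi * \<i>"
      "- cnj h * (1 + T' / 2) = - (pi * \<i>)" "- cnj h * (1 - T' / 2) = - 2 * cnj h + pi * \<i>"
      using T' by (simp_all add: algebra_simps) (simp_all add: field_simps)
    then show "exp (- h * (1 + T' / 2)) = - p" "exp (- h * (1 - T' / 2)) = - p"
      "exp (- cnj h * (1 + T' / 2)) = cnj (- 1)" "exp (- cnj h * (1 - T' / 2)) = cnj (- p\<^sup>2)"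
      by (simp_all only: exp_diff exp_add exp_minus qc exp_pi_i) (simp_all add: p_def exp_minus)
  qed
  have thT': "qtheta h (T' / 2) = (P (- p))\<^sup>2"
    unfolding qtheta_def e' q by (simp add: P_def power2_eq_square)
  have thcT': "qtheta (cnj h) (T' / 2) = 2 * (cnj (P (- p\<^sup>2)))\<^sup>2"
    unfolding qtheta_def e' qc cnjP by (simp add: m1 power2_eq_square)
  obtain c where c: "\<And>t. qtheta h t \<noteq> 0 \<Longrightarrow> qtheta_ratio h t = c"
    using qtheta_ratio_constant by blast
  have ex: "exp (- \<i> * h * cnj h * (T / 2)\<^sup>2 / (4 * pi)) = exp ((h + pi * \<i>) / 4)"
  proof -
    have "- \<i> * h * cnj h * (T / 2)\<^sup>2 / (4 * pi) = - \<i> * ((h * T) * (cnj h * T)) / (16 * pi)"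
      by (simp add: power2_eq_square)
    also have "\<dots> = (h + pi * \<i>) / 4" unfolding T by (simp add: field_simps)
    finally show ?thesis by (rule arg_cong)
  qed
  have ex': "exp (- \<i> * h * cnj h * (T' / 2)\<^sup>2 / (4 * pi)) = exp ((pi * \<i> - cnj h) / 4)"
  proof -
    have "- \<i> * h * cnj h * (T' / 2)\<^sup>2 / (4 * pi) = - \<i> * ((h * T') * (cnj h * T')) / (16 * pi)"
      by (simp add: power2_eq_square)
    also have "\<dots> = (pi * \<i> - cnj h) / 4" unfolding T' by (simp add: field_simps)
    finally show ?thesis by (rule arg_cong)
  qed
  have c0: "qtheta_ratio h 0 = c" "qtheta_ratio h (T / 2) = c" "qtheta_ratio h (T' / 2) = c"
    using nz by (auto intro!: c simp: th0 thT thT')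
  have "qtheta_ratio h 0 ^ 3 = qtheta_ratio h 0 * qtheta_ratio h (T / 2) * qtheta_ratio h (T' / 2)"
    unfolding c0 by (simp add: power3_eq_cube)
  \<comment> \<open>At \<open>T / 2\<close> and \<open>T' / 2\<close> the symbols at
    \<open>- p\<close> and \<open>- p\<^sup>2\<close> trade places between numerator and
    denominator, and the factors 2 coming from \<open>P (- 1)\<close> cancel. What remains is built
    from Euler's product, which is 1.\<close>
  also have "\<dots> = exp ((h + pi * \<i>) / 4) * exp ((pi * \<i> - cnj h) / 4) *
      ((cnj (P p * P (- p) * P (- p\<^sup>2)))\<^sup>2 / (P p * P (- p) * P (- p\<^sup>2))\<^sup>2)"
    unfolding qtheta_ratio_def ex ex' th0 thc0 thT thcT thT' thcT'
    using nz by (simp add: field_simps power2_eq_square)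
  also have "\<dots> = exp ((h - cnj h) / 4 + pi * \<i> / 2)"
  proof -
    have "(h + pi * \<i>) / 4 + (pi * \<i> - cnj h) / 4 = (h - cnj h) / 4 + pi * \<i> / 2"
      by (simp add: field_simps)
    then show ?thesis unfolding euler by (simp flip: exp_add)
  qed
  finally show "qtheta_ratio h 0 ^ 3 = exp ((h - cnj h) / 4 + pi * \<i> / 2)" .
qed

end

text \<open>This is \<open>- 2 * pi * \<i> * d / omega2 d\<close>, where \<open>d\<close> is half
  the sum of the periods. It makes \<open>exp (- 2 * hpar d)\<close> the base \<open>q\<close>, and
  by conjugacy of the periods \<open>exp (- 2 * cnj (hpar d))\<close> is the dual base.\<close>

definition hpar :: "real \<Rightarrow> complex" where
  "hpar d = 2 * pi * d / (1 + \<i> * d)"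

lemma one_plus_minus_i_nonzero: "1 + \<i> * of_real d \<noteq> 0" "1 - \<i> * of_real d \<noteq> 0"
  "1 + complex_of_real d * complex_of_real d \<noteq> 0"
  using add_pos_nonneg[of 1 "d * d"] by (auto simp: complex_eq_iff)

lemma Re_hpar: "Re (hpar d) = 2 * pi * d / (1 + d\<^sup>2)"
  and Im_hpar: "Im (hpar d) = - 2 * pi * d\<^sup>2 / (1 + d\<^sup>2)"
  by (simp_all add: hpar_def Re_divide Im_divide power2_eq_square)

lemma Re_hpar_pos: "d > 0 \<Longrightarrow> Re (hpar d) > 0"
  by (simp add: Re_hpar add_pos_nonneg)

lemma hpar_modular: "cnj (hpar d) - hpar d = \<i> * hpar d * cnj (hpar d) / pi"
proof -
  define a b c where "a = 1 + \<i> * complex_of_real d" "b = 1 - \<i> * complex_of_real d"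
    "c = 2 * complex_of_real pi * d"
  have nz: "a \<noteq> 0" "b \<noteq> 0" using one_plus_minus_i_nonzero by (auto simp: a_b_c_def)
  have h: "hpar d = c / a" "cnj (hpar d) = c / b" by (simp_all add: hpar_def a_b_c_def)
  have "c / b - c / a = c * (a - b) / (a * b)" using nz by (simp add: field_simps)
  also have "a - b = \<i> * c / pi" by (simp add: a_b_c_def)
  finally show ?thesis unfolding h(2) unfolding h(1) using nz by (simp add: field_simps)
qed

lemma qtheta_ratio_hpar_0:
  assumes "d > 0"
  shows "exp (- (hpar d - cnj (hpar d)) / 12 - pi * \<i> / 6) * qtheta_ratio (hpar d) 0 = 1"
proof -
  define C where "C d = exp (- (hpar d - cnj (hpar d)) / 12 - pi * \<i> / 6) * qtheta_ratio (hpar d) 0" for d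
  have cube: "C d ^ 3 = 1" if "d > 0" for d
  proof -
    define w where "w = hpar d - cnj (hpar d)"
    have "C d ^ 3 = exp (- w / 12 - pi * \<i> / 6) ^ 3 * qtheta_ratio (hpar d) 0 ^ 3"
      unfolding C_def w_def by (rule power_mult_distrib)
    also have "qtheta_ratio (hpar d) 0 ^ 3 = exp (w / 4 + pi * \<i> / 2)"
      unfolding w_def by (rule qtheta_ratio_0_cubed[OF Re_hpar_pos[OF that] hpar_modular])
    also have "exp (- w / 12 - pi * \<i> / 6) ^ 3 = exp (3 * (- w / 12 - pi * \<i> / 6))"
      using exp_of_nat_mult[of 3 "- w / 12 - pi * \<i> / 6"] by simp
    also have "exp (3 * (- w / 12 - pi * \<i> / 6)) * exp (w / 4 + pi * \<i> / 2) = exp 0"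
      unfolding exp_add [symmetric] by (rule arg_cong[of _ _ exp]) (simp add: field_simps)
    also have "exp 0 = (1::complex)" by simp
    finally show ?thesis .
  qed
  have cont: "continuous_on {0<..} C"
  proof -
    have h: "continuous_on {0<..} hpar"
      unfolding hpar_def by (intro continuous_intros) (auto simp: one_plus_minus_i_nonzero)
    have th: "continuous_on {0<..} (\<lambda>d. qtheta (hpar d) 0)"
      unfolding qtheta_def using Re_hpar_pos by (intro continuous_intros h) auto
    have thc: "continuous_on {0<..} (\<lambda>d. qtheta (cnj (hpar d)) 0)"
      unfolding qtheta_def using Re_hpar_pos by (intro continuous_intros h) auto
    have "continuous_on {0<..} (\<lambda>d. exp (- (hpar d - cnj (hpar d)) / 12 - pi * \<i> / 6))"
      by (intro continuous_intros h) auto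
    moreover have "continuous_on {0<..} (\<lambda>d. qtheta_ratio (hpar d) 0)"
      unfolding qtheta_ratio_def using qtheta_0_nz[OF Re_hpar_pos hpar_modular]
      by (intro continuous_intros h th thc) auto
    ultimately show ?thesis unfolding C_def by (rule continuous_on_mult)
  qed
  have "C constant_on {0<..}"
  proof (rule continuous_finite_range_constant[OF _ cont])
    have "C ` {0<..} \<subseteq> {z. z ^ 3 = 1}" using cube by auto
    then show "finite (C ` {0<..})"
      by (rule finite_subset) (rule finite_roots_unity, simp)
  qed auto
  then have "C d = C 1" using assms by (auto simp: constant_on_def)
  \<comment> \<open>At \<open>d = 1\<close>, \<open>exp (- h) = - exp (- pi)\<close> and
    \<open>q = exp (- 2 * pi)\<close> are real. The theta value is then its own conjugate, so the
    quotient is 1, and the exponent of the prefactor vanishes.\<close>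
  also have "C 1 = 1"
  proof -
    have h1: "hpar 1 = pi * (1 - \<i>)"
      by (simp add: hpar_def complex_eq_iff Re_divide Im_divide)
    have e: "exp (- hpar 1) = - exp (- of_real pi)" "exp (- 2 * hpar 1) = exp (- 2 * of_real pi)"
    proof -
      have *: "- hpar 1 = - of_real pi + pi * \<i>" "- 2 * hpar 1 = - 2 * of_real pi + 2 * pi * \<i>"
        by (simp_all add: h1 algebra_simps)
      show "exp (- hpar 1) = - exp (- of_real pi)" "exp (- 2 * hpar 1) = exp (- 2 * of_real pi)"
        unfolding * exp_add by (simp_all add: exp_pi_i exp_two_pi_i)
    qed
    have "cnj (qtheta (hpar 1) 0) = qtheta (cnj (hpar 1)) 0"
      using qtheta_cnj[of "hpar 1" 0] Re_hpar_pos[of 1] by simp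
    moreover have "cnj (qtheta (hpar 1) 0) = qtheta (hpar 1) 0"
    proof -
      define E where "E = exp (- 2 * complex_of_real pi)"
      have E: "norm E < 1" "cnj E = E" by (simp_all add: E_def exp_cnj)
      have "qtheta (hpar 1) 0 = qpoch_inf (- exp (- of_real pi)) E ^ 2"
        unfolding qtheta_def using e by (simp add: E_def power2_eq_square)
      moreover have "cnj (qpoch_inf (- exp (- of_real pi)) E) = qpoch_inf (- exp (- of_real pi)) E"
        using qpoch_cnj[OF E(1), of "- exp (- of_real pi)"] E(2) by (simp add: exp_cnj)
      ultimately show ?thesis by simp
    qed
    ultimately have "qtheta_ratio (hpar 1) 0 = 1"
      using qtheta_0_nz[OF Re_hpar_pos[of 1] hpar_modular] by (simp add: qtheta_ratio_def)
    moreover have "- (hpar 1 - cnj (hpar 1)) / 12 - pi * \<i> / 6 = 0"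
      by (simp add: h1 complex_eq_iff)
    ultimately show ?thesis unfolding C_def by (simp only: exp_zero mult_1)
  qed
  finally show ?thesis by (simp add: C_def)
qed

text \<open>\<open>qgam h t\<close> with \<open>h = hpar d\<close> is the hyperbolic gamma function at \<open>d * (1 + t)\<close>, where
  \<open>d\<close> is half the sum of the two periods.\<close>

definition qgam :: "complex \<Rightarrow> complex \<Rightarrow> complex" where
  "qgam h t = exp (- \<i> * h * cnj h * t\<^sup>2 / (8 * pi) - (h - cnj h) / 24 - pi * \<i> / 12) *
     (qpoch_inf (exp (- cnj h * (1 - t))) (exp (- 2 * cnj h)) / qpoch_inf (exp (- h * (1 + t))) (exp (- 2 * h)))"

text \<open>The four symbols regroup into \<open>qtheta (cnj h) t / qtheta h t\<close> and the
  Gaussian doubles, which gives a multiple of \<open>qtheta_ratio\<close>; this is constant in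
  \<open>t\<close>, with known value at 0.\<close>

lemma qgam_reflection:
  assumes "d > 0" "qtheta (hpar d) t \<noteq> 0"
  shows "qgam (hpar d) t * qgam (hpar d) (- t) = 1"
proof -
  define h where "h = hpar d"
  have h: "Re h > 0" "cnj h - h = \<i> * h * cnj h / pi"
    using Re_hpar_pos[OF assms(1)] hpar_modular by (simp_all add: h_def)
  have nz: "qtheta h 0 \<noteq> 0" by (rule qtheta_0_nz[OF h])
  define L where "L = - \<i> * h * cnj h * t\<^sup>2 / (8 * pi) - (h - cnj h) / 24 - pi * \<i> / 12"
  have "qgam h t = exp L * (qpoch_inf (exp (- cnj h * (1 - t))) (exp (- 2 * cnj h)) / qpoch_inf (exp (- h * (1 + t))) (exp (- 2 * h)))"
    "qgam h (- t) = exp L * (qpoch_inf (exp (- cnj h * (1 + t))) (exp (- 2 * cnj h)) / qpoch_inf (exp (- h * (1 - t))) (exp (- 2 * h)))"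
    by (simp_all add: qgam_def L_def)
  then have "qgam h t * qgam h (- t) = exp L * exp L * (qtheta (cnj h) t / qtheta h t)"
    by (simp only: qtheta_def) simp
  also have "\<dots> =
    exp ((- \<i> * h * cnj h * t\<^sup>2 / (8 * pi) - (h - cnj h) / 24 - pi * \<i> / 12) +
         (- \<i> * h * cnj h * t\<^sup>2 / (8 * pi) - (h - cnj h) / 24 - pi * \<i> / 12)) *
    (qtheta (cnj h) t / qtheta h t)"
    unfolding L_def [symmetric] exp_add ..
  also have "(- \<i> * h * cnj h * t\<^sup>2 / (8 * pi) - (h - cnj h) / 24 - pi * \<i> / 12) +
         (- \<i> * h * cnj h * t\<^sup>2 / (8 * pi) - (h - cnj h) / 24 - pi * \<i> / 12) =
      (- (h - cnj h) / 12 - pi * \<i> / 6) + - \<i> * h * cnj h * t\<^sup>2 / (4 * pi)"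
    by (simp add: field_simps)
  also have "exp \<dots> * (qtheta (cnj h) t / qtheta h t) = exp (- (h - cnj h) / 12 - pi * \<i> / 6) * qtheta_ratio h t"
    by (simp only: qtheta_ratio_def exp_add mult.assoc)
  also have "qtheta_ratio h t = qtheta_ratio h 0"
    using qtheta_ratio_constant[OF h] nz assms(2) by (metis h_def)
  also have "exp (- (h - cnj h) / 12 - pi * \<i> / 6) * qtheta_ratio h 0 = 1"
    unfolding h_def by (rule qtheta_ratio_hpar_0[OF assms(1)])
  finally show ?thesis by (simp add: h_def)
qed

text \<open>A nonzero denominator makes the quotient analytic at the point, so
  \<open>remove_sings\<close> returns its plain value. The rest is a rewriting of
  \<open>B22\<close>.\<close>

lemma hyp_gamma_eq_qgam:
  assumes "d > 0" "qpoch_inf (exp (- hpar d * (1 + t))) (exp (- 2 * hpar d)) \<noteq> 0"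
  shows "hyp_gamma (d * (1 + t)) (omega1 d) (omega2 d) = qgam (hpar d) t"
proof -
  define w1 w2 h where "w1 = omega1 d" "w2 = omega2 d" "h = hpar d"
  have w: "w1 \<noteq> 0" "w2 \<noteq> 0" by (auto simp: w1_w2_h_def omega1_def omega2_def complex_eq_iff)
  have h: "2 * pi * \<i> / w2 = - h / d" "2 * pi * \<i> / w1 = cnj h / d" "Re h > 0"
  proof -
    have "w2 = - \<i> * (1 + \<i> * d)" "w1 = \<i> * (1 - \<i> * d)"
      by (simp_all add: w1_w2_h_def omega1_def omega2_def algebra_simps)
    then show "2 * pi * \<i> / w2 = - h / d" "2 * pi * \<i> / w1 = cnj h / d"
      using assms(1) one_plus_minus_i_nonzero[of d] by (simp_all add: w1_w2_h_def hpar_def)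
  qed (use Re_hpar_pos[OF assms(1)] w1_w2_h_def in auto)
  have sum: "w1 + w2 = 2 * d" by (simp add: w1_w2_h_def omega1_def omega2_def)
  have q: "exp (2 * of_real pi * \<i> * w1 / w2) = exp (- 2 * h)"
  proof -
    have "2 * of_real pi * \<i> * w1 / w2 = 2 * pi * \<i> / w2 * (2 * d) - 2 * pi * \<i>"
      using w unfolding sum [symmetric] by (simp add: field_simps)
    also have "\<dots> = - 2 * h - 2 * pi * \<i>" unfolding h(1) using assms(1) by simp
    finally show ?thesis by (simp add: exp_diff exp_two_pi_i)
  qed
  have q': "exp (- 2 * of_real pi * \<i> * w2 / w1) = exp (- 2 * cnj h)"
  proof -
    have "- 2 * of_real pi * \<i> * w2 / w1 = 2 * pi * \<i> - 2 * pi * \<i> / w1 * (2 * d)"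
      using w unfolding sum [symmetric] by (simp add: field_simps)
    also have "\<dots> = - 2 * cnj h + 2 * pi * \<i>" unfolding h(2) using assms(1) by simp
    finally show ?thesis by (simp add: exp_add exp_diff exp_two_pi_i exp_minus inverse_eq_divide)
  qed
  define f where "f z = exp (- (of_real pi * \<i> / 2) * B22 z w1 w2) *
                (qpoch_inf (exp (- 2 * cnj h) * exp (2 * of_real pi * \<i> * z / w1)) (exp (- 2 * cnj h)) /
                 qpoch_inf (exp (2 * of_real pi * \<i> * z / w2)) (exp (- 2 * h)))" for z
  have e1: "2 * of_real pi * \<i> * (d * (1 + t)) / w1 = cnj h * (1 + t)"
    and e2: "2 * of_real pi * \<i> * (d * (1 + t)) / w2 = - h * (1 + t)"
  proof -
    have "2 * of_real pi * \<i> * (d * (1 + t)) / w1 = 2 * pi * \<i> / w1 * (d * (1 + t))"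
      "2 * of_real pi * \<i> * (d * (1 + t)) / w2 = 2 * pi * \<i> / w2 * (d * (1 + t))" by simp_all
    then show "2 * of_real pi * \<i> * (d * (1 + t)) / w1 = cnj h * (1 + t)"
      "2 * of_real pi * \<i> * (d * (1 + t)) / w2 = - h * (1 + t)"
      unfolding h(1,2) using assms(1) by simp_all
  qed
  have "hyp_gamma (d * (1 + t)) w1 w2 = remove_sings f (d * (1 + t))"
    by (simp only: hyp_gamma_def Let_def q q' f_def [abs_def])
  also have "\<dots> = f (d * (1 + t))"
  proof (rule remove_sings_at_analytic)
    have "(\<lambda>z. qpoch_inf (exp (2 * of_real pi * \<i> * z / w2)) (exp (- 2 * h))) analytic_on {d * (1 + t)}"
      by (intro entire_imp_analytic holomorphic_intros)
         (use w h in auto)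
    moreover have "(\<lambda>z. qpoch_inf (exp (- 2 * cnj h) * exp (2 * of_real pi * \<i> * z / w1)) (exp (- 2 * cnj h))) analytic_on {d * (1 + t)}"
      by (intro entire_imp_analytic holomorphic_intros)
         (use w h in auto)
    moreover have "(\<lambda>z. exp (- (of_real pi * \<i> / 2) * B22 z w1 w2)) analytic_on {d * (1 + t)}"
      unfolding B22_def by (intro analytic_intros) (use w in auto)
    moreover have "qpoch_inf (exp (2 * of_real pi * \<i> * (d * (1 + t)) / w2)) (exp (- 2 * h)) \<noteq> 0"
      unfolding e2 using assms(2) by (simp add: w1_w2_h_def)
    ultimately show "f analytic_on {d * (1 + t)}"
      unfolding f_def [abs_def] by (intro analytic_on_mult analytic_on_divide) auto
  qed
  also have "\<dots> = qgam h t"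
  proof -
    have s: "w1 * w2 = 1 + d\<^sup>2" "w1\<^sup>2 + w2\<^sup>2 = 2 * d\<^sup>2 - 2"
      by (simp_all add: w1_w2_h_def omega1_def omega2_def complex_eq_iff power2_eq_square algebra_simps)
    have nz: "1 + (complex_of_real d)\<^sup>2 \<noteq> 0"
      using s w by (metis mult_eq_0_iff of_real_1 of_real_add of_real_power)
    have hh: "h * cnj h = 4 * pi\<^sup>2 * d\<^sup>2 / (1 + d\<^sup>2)"
      using one_plus_minus_i_nonzero[of d] nz
      by (simp add: w1_w2_h_def hpar_def field_simps power2_eq_square)
    have hm: "h - cnj h = - 4 * pi * \<i> * d\<^sup>2 / (1 + d\<^sup>2)"
    proof -
      have "h - cnj h = - (\<i> * (h * cnj h) / pi)" using hpar_modular[of d]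
        by (simp add: w1_w2_h_def algebra_simps)
      then show ?thesis unfolding hh by (simp add: power2_eq_square)
    qed
    have "- (of_real pi * \<i> / 2) * B22 (d * (1 + t)) w1 w2 =
      - \<i> * (h * cnj h) * t\<^sup>2 / (8 * pi) - (h - cnj h) / 24 - pi * \<i> / 12"
    proof -
      \<comment> \<open>Both sides become polynomials once expressed through \<open>r\<close>, by
        \<open>d\<^sup>2 * r = 1 - r\<close>.\<close>
      define r where "r = 1 / (1 + (complex_of_real d)\<^sup>2)"
      have r: "(complex_of_real d)\<^sup>2 * r = 1 - r" using nz by (simp add: r_def field_simps)
      have hh': "h * cnj h = 4 * (complex_of_real pi)\<^sup>2 * (1 - r)"
        unfolding hh r [symmetric] by (simp add: r_def)
      have hm': "h - cnj h = - 4 * pi * \<i> * (1 - r)"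
        unfolding hm r [symmetric] by (simp add: r_def)
      have "B22 (d * (1 + t)) w1 w2 = ((complex_of_real d)\<^sup>2 * r) * t\<^sup>2 - (2 * ((complex_of_real d)\<^sup>2 * r) - 2 * r) / 12"
      proof -
        have r': "1 / (w1 * w2) = r" by (simp add: r_def s)
        show ?thesis unfolding B22_def r' s(2) sum by (simp add: field_simps power2_eq_square)
      qed
      also have "\<dots> = (1 - r) * t\<^sup>2 - (1 - 2 * r) / 6" unfolding r by (simp add: field_simps)
      finally have B: "B22 (d * (1 + t)) w1 w2 = (1 - r) * t\<^sup>2 - (1 - 2 * r) / 6" .
      show ?thesis unfolding B hh' hm' by (simp add: field_simps power2_eq_square)
    qed
    moreover have "exp (- 2 * cnj h) * exp (cnj h * (1 + t)) = exp (- cnj h * (1 - t))"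
      by (simp add: algebra_simps flip: exp_add)
    ultimately show ?thesis
      unfolding f_def qgam_def e1 e2 by (simp add: mult.assoc)
  qed
  finally show ?thesis by (simp add: w1_w2_h_def)
qed

section \<open>A uniform bound for ratios of q-Pochhammer symbols\<close>

text \<open>With \<open>q = exp (- 2 * h)\<close>, the arguments are \<open>x\<close> times
  \<open>q\<close> to the powers \<open>(1 + A) / 2\<close> and \<open>(1 - A) / 2\<close>. As
  \<open>h\<close> tends to 0, the ratio behaves like \<open>(1 - x) powr (- A)\<close>.\<close>

definition qratio :: "complex \<Rightarrow> complex \<Rightarrow> complex \<Rightarrow> complex" where
  "qratio h A x = qpoch_inf (exp (- h * (1 + A)) * x) (exp (- 2 * h)) / qpoch_inf (exp (- h * (1 - A)) * x) (exp (- 2 * h))"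

text \<open>The bound must hold up to the boundary of the unit disc, where the limit
  \<open>(1 - x) powr (- \<nu>)\<close> is singular. The weight is \<open>1 - q * x\<close>, nonzero
  even there, because the comparison of factors starts at index 1. The condition
  \<open>norm h \<le> 2 * Re h\<close> keeps \<open>h\<close> in a sector away from the imaginary
  axis.\<close>

definition is_ratio_bound :: "real \<Rightarrow> real \<Rightarrow> bool" where
  "is_ratio_bound \<nu>1 C \<longleftrightarrow> (\<forall>h x \<nu>. Re h > 0 \<longrightarrow> norm h \<le> 2 * Re h \<longrightarrow> norm h \<le> 1 \<longrightarrow> 0 \<le> \<nu> \<longrightarrow> \<nu> \<le> \<nu>1 \<longrightarrow>
    norm x \<le> 1 \<longrightarrow> norm (qratio h (of_real \<nu>) x) * norm (1 - exp (- 2 * h) * x) powr \<nu> \<le> C)"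

lemma exp_mult_eqI: "u + v = w \<Longrightarrow> exp u * exp v = exp (w::complex)"
  by (simp add: exp_add flip: exp_add)

lemma norm_exp_minus_1_le:
  fixes z :: complex
  assumes "norm z \<le> 2"
  shows "norm (exp z - 1) \<le> exp 2 * norm z"
    and "norm (exp z - 1 - z) \<le> exp 2 * (norm z)\<^sup>2"
proof -
  have r: "exp \<bar>Re z\<bar> \<le> exp 2" using abs_Re_le_cmod[of z] assms by simp
  have "norm (exp z - (\<Sum>k\<le>0. z ^ k / fact k)) \<le> exp \<bar>Re z\<bar> * (norm z ^ Suc 0) / fact 0"
    by (rule Taylor_exp)
  also have "\<dots> \<le> exp 2 * norm z" using r by (simp add: mult_right_mono)
  finally show "norm (exp z - 1) \<le> exp 2 * norm z" by simp
  have "norm (exp z - (\<Sum>k\<le>1. z ^ k / fact k)) \<le> exp \<bar>Re z\<bar> * (norm z ^ Suc 1) / fact 1"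
    by (rule Taylor_exp)
  also have "\<dots> \<le> exp 2 * (norm z)\<^sup>2" using r by (simp add: mult_right_mono power2_eq_square)
  finally show "norm (exp z - 1 - z) \<le> exp 2 * (norm z)\<^sup>2" by (simp add: algebra_simps)
qed

text \<open>The bound is linear in \<open>Re z\<close> rather than in \<open>norm z\<close>, so
  first-order cancellations between several factors survive. It comes from expanding the squared
  norm and needs no smallness of \<open>z\<close>.\<close>

lemma norm_1_plus_le_exp: "norm (1 + z) \<le> exp (Re z + (norm z)\<^sup>2 / 2)" for z :: complex
proof -
  have "(norm (1 + z))\<^sup>2 = 1 + (2 * Re z + (norm z)\<^sup>2)"
    unfolding cmod_power2 by (simp add: algebra_simps power2_eq_square)
  also have "\<dots> \<le> exp (2 * Re z + (norm z)\<^sup>2)" by (rule exp_ge_add_one_self)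
  also have "\<dots> = (exp (Re z + (norm z)\<^sup>2 / 2))\<^sup>2"
    by (simp flip: exp_of_nat_mult exp_double)
  finally show ?thesis by (rule power2_le_imp_le) simp
qed

text \<open>Taken at \<open>\<tau> = 2 * Re h * j\<close>, it turns the error of the
  \<open>j\<close>-th factor, which carries \<open>(norm h)\<^sup>2\<close>, into a multiple of
  \<open>1 / j\<^sup>2\<close> independent of \<open>h\<close>.\<close>

lemma exp_minus_over_square_le:
  fixes \<tau> :: real
  assumes "\<tau> > 0"
  shows "exp (- \<tau>) / (1 - exp (- \<tau>))\<^sup>2 \<le> 2 / \<tau>\<^sup>2"
proof -
  have "(1 + \<tau>)\<^sup>2 \<le> 2 * (1 + \<tau> + \<tau>\<^sup>2 / 2)" by (simp add: power2_eq_square algebra_simps)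
  also have "\<dots> \<le> 2 * exp \<tau>" using exp_lower_Taylor_quadratic[of \<tau>] assms by simp
  finally have 1: "(1 + \<tau>)\<^sup>2 \<le> 2 * exp \<tau>" .
  have "1 + \<tau> \<le> exp \<tau>" by (rule exp_ge_add_one_self)
  then have "exp (- \<tau>) \<le> 1 / (1 + \<tau>)" using assms by (simp add: exp_minus field_simps)
  then have 2: "\<tau> / (1 + \<tau>) \<le> 1 - exp (- \<tau>)" using assms by (simp add: field_simps)
  have "exp (- \<tau>) / (1 - exp (- \<tau>))\<^sup>2 \<le> exp (- \<tau>) / (\<tau> / (1 + \<tau>))\<^sup>2"
    using assms 2 by (intro divide_left_mono power_mono mult_pos_pos zero_less_power) auto
  also have "\<dots> = (1 + \<tau>)\<^sup>2 / exp \<tau> / \<tau>\<^sup>2"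
    using assms by (simp add: exp_minus field_simps power_divide)
  also have "\<dots> \<le> 2 / \<tau>\<^sup>2"
    using 1 by (intro divide_right_mono) (auto simp: field_simps)
  finally show ?thesis .
qed

text \<open>With \<open>K = exp 2\<close> this is \<open>2 * (12 * K + 4 * K\<^sup>2)\<close>: three
  terms \<open>4 * K\<close> bound the first-order combination, \<open>4 * K\<^sup>2\<close> the
  quadratic remainders, and the outer 2 is that of \<open>exp_minus_over_square_le\<close>.\<close>

definition ratio_err :: real where "ratio_err = 24 * exp 2 + 8 * (exp 2)\<^sup>2"

text \<open>The logarithm of a factor of the ratio is, up to a summable error, \<open>\<nu>\<close> times the increment of
  \<open>ln (norm (1 - exp (- h * t) * x))\<close> over \<open>[2 * j, 2 * j + 2]\<close>, so that the product telescopes.\<close>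

lemma qratio_factor_bound:
  fixes h x :: complex and \<nu> :: real and j :: nat
  assumes h: "Re h > 0" "norm h \<le> 2 * Re h" "norm h \<le> 1" and \<nu>: "0 \<le> \<nu>" "\<nu> \<le> 1"
    and x: "norm x \<le> 1" and j: "j > 0"
  shows "norm (1 - exp (- h * (2 * of_nat j + 1 + of_real \<nu>)) * x) * norm (1 - exp (- h * (2 * of_nat j)) * x) powr \<nu>
    \<le> exp (ratio_err / j\<^sup>2) *
      (norm (1 - exp (- h * (2 * of_nat j + 1 - of_real \<nu>)) * x) * norm (1 - exp (- h * (2 * of_nat j + 2)) * x) powr \<nu>)"
proof -
  define K :: real where "K = exp 2"
  have K: "K \<ge> 0" by (simp add: K_def)
  define \<tau> where "\<tau> = 2 * Re h * j"
  have \<tau>: "\<tau> > 0" using h j by (simp add: \<tau>_def)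
  define E where "E = exp (- \<tau>) / (1 - exp (- \<tau>))\<^sup>2"
  have e1: "0 < 1 - exp (- \<tau>)" "1 - exp (- \<tau>) \<le> 1" using \<tau> by auto
  have E0: "E \<ge> 0" by (simp add: E_def)
  have E: "E \<le> 2 / \<tau>\<^sup>2" unfolding E_def by (rule exp_minus_over_square_le[OF \<tau>])
  define a b where "a = exp (- h * (2 * of_nat j + 1 - of_real \<nu>)) * x" and "b = exp (- h * (2 * of_nat j + 2)) * x"
  have small: "norm (exp (- h * of_real s) * x) \<le> exp (- \<tau>)" if "s \<ge> 2 * real j" for s
  proof -
    have "2 * Re h * real j \<le> Re h * s" using that h by (simp add: mult.assoc mult_left_mono)
    then have "exp (- (Re h * s)) \<le> exp (- \<tau>)" by (simp add: \<tau>_def)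
    then have "exp (- (Re h * s)) * norm x \<le> exp (- \<tau>) * 1"
      using x by (intro mult_mono) auto
    then show ?thesis by (simp add: norm_mult)
  qed
  have a: "norm a \<le> exp (- \<tau>)" using small[of "2 * real j + 1 - \<nu>"] \<nu> by (simp add: a_def)
  have b: "norm b \<le> exp (- \<tau>)" using small[of "2 * real j + 2"] by (simp add: b_def)
  have lower: "1 - exp (- \<tau>) \<le> norm (1 - w)" if "norm w \<le> exp (- \<tau>)" for w :: complex
    using norm_triangle_ineq2[of 1 w] that by simp
  have nz: "1 - a \<noteq> 0" "1 - b \<noteq> 0" using lower[OF a] lower[OF b] e1 by auto
  have q1: "norm (w / (1 - w)) \<le> exp (- \<tau>) / (1 - exp (- \<tau>))" if "norm w \<le> exp (- \<tau>)" for w :: complex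
    unfolding norm_divide using lower[OF that] that e1 by (intro frac_le) auto
  have q2: "exp (- \<tau>) / (1 - exp (- \<tau>)) \<le> E"
  proof -
    have "(1 - exp (- \<tau>)) * (1 - exp (- \<tau>)) \<le> (1 - exp (- \<tau>)) * 1"
      using e1 by (intro mult_left_mono) auto
    then show ?thesis unfolding E_def power2_eq_square using e1 by (intro divide_left_mono) auto
  qed
  have q3: "(exp (- \<tau>) / (1 - exp (- \<tau>)))\<^sup>2 \<le> E"
  proof -
    have "(exp (- \<tau>))\<^sup>2 \<le> exp (- \<tau>)" using \<tau> by (simp add: power2_eq_square flip: exp_add)
    then show ?thesis unfolding E_def power_divide by (intro divide_right_mono) auto
  qed
  have qE: "norm (w / (1 - w)) \<le> E" "(norm (w / (1 - w)))\<^sup>2 \<le> E" if "norm w \<le> exp (- \<tau>)" for w :: complex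
  proof -
    show "norm (w / (1 - w)) \<le> E" using q1[OF that] q2 by linarith
    have "(norm (w / (1 - w)))\<^sup>2 \<le> (exp (- \<tau>) / (1 - exp (- \<tau>)))\<^sup>2"
      by (intro power_mono q1 that) auto
    then show "(norm (w / (1 - w)))\<^sup>2 \<le> E" using q3 by linarith
  qed
  define A B where "A = 1 - exp (- (2 * h * \<nu>))" and "B = exp (2 * h) - 1"
  define n where "n = norm h"
  have n: "0 \<le> n" "n \<le> 1" "n\<^sup>2 \<le> 4 * (Re h)\<^sup>2"
  proof -
    show "n\<^sup>2 \<le> 4 * (Re h)\<^sup>2" using power_mono[OF h(2), of 2] by (simp add: n_def power_mult_distrib)
  qed (use h in \<open>auto simp: n_def\<close>)
  have hk: "norm (2 * h * \<nu>) \<le> 2 * n" "norm (2 * h) = 2 * n"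
    using \<nu> by (auto simp: norm_mult n_def mult_left_le)
  have A1: "norm A \<le> 2 * K * n"
  proof -
    have "norm A = norm (exp (- (2 * h * \<nu>)) - 1)" by (simp add: A_def norm_minus_commute)
    also have "\<dots> \<le> K * norm (2 * h * \<nu>)"
      using norm_exp_minus_1_le(1)[of "- (2 * h * \<nu>)"] hk n by (simp add: K_def)
    also have "\<dots> \<le> K * (2 * n)" by (intro mult_left_mono hk K)
    finally show ?thesis by simp
  qed
  have A2: "norm (A - 2 * h * \<nu>) \<le> 4 * K * n\<^sup>2"
  proof -
    have "norm (A - 2 * h * \<nu>) = norm (exp (- (2 * h * \<nu>)) - 1 - (- (2 * h * \<nu>)))"
      by (subst norm_minus_cancel[symmetric]) (simp add: A_def)
    also have "\<dots> \<le> K * (norm (2 * h * \<nu>))\<^sup>2"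
      using norm_exp_minus_1_le(2)[of "- (2 * h * \<nu>)"] hk n by (simp add: K_def)
    also have "\<dots> \<le> K * (2 * n)\<^sup>2" by (intro mult_left_mono power_mono hk K) auto
    finally show ?thesis by (simp add: power_mult_distrib)
  qed
  have B1: "norm B \<le> 2 * K * n"
    using norm_exp_minus_1_le(1)[of "2 * h"] hk n by (simp add: B_def K_def)
  have B2: "norm (B - 2 * h) \<le> 4 * K * n\<^sup>2"
    using norm_exp_minus_1_le(2)[of "2 * h"] hk n by (simp add: B_def K_def power_mult_distrib)
  \<comment> \<open>\<open>1 + \<eta>\<close> is the numerator factor over the denominator factor,
    \<open>1 + \<eta>'\<close> the ratio of the weights at \<open>2 * j\<close> and
    \<open>2 * j + 2\<close>. To first order \<open>\<eta>\<close> is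
    \<open>2 * h * \<nu> * a / (1 - a)\<close> and \<open>\<eta>'\<close> is
    \<open>- 2 * h * b / (1 - b)\<close>, so \<open>\<eta> + \<nu> * \<eta>'\<close> is of second
    order in \<open>h\<close>.\<close>
  define \<eta> \<eta>' where "\<eta> = a / (1 - a) * A" and "\<eta>' = - (b / (1 - b) * B)"
  have eta: "1 - exp (- h * (2 * of_nat j + 1 + of_real \<nu>)) * x = (1 - a) * (1 + \<eta>)"
  proof -
    have "exp (- h * (2 * of_nat j + 1 - of_real \<nu>)) * exp (- (2 * h * \<nu>)) = exp (- h * (2 * of_nat j + 1 + of_real \<nu>))"
      by (rule exp_mult_eqI) (simp add: algebra_simps)
    then have "exp (- h * (2 * of_nat j + 1 + of_real \<nu>)) * x = a * exp (- (2 * h * \<nu>))"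
      unfolding a_def by (metis mult.assoc mult.commute)
    then show ?thesis using nz by (simp add: \<eta>_def A_def field_simps)
  qed
  have eta': "1 - exp (- h * (2 * of_nat j)) * x = (1 - b) * (1 + \<eta>')"
  proof -
    have "exp (- h * (2 * of_nat j + 2)) * exp (2 * h) = exp (- h * (2 * of_nat j))"
      by (rule exp_mult_eqI) (simp add: algebra_simps)
    then have "exp (- h * (2 * of_nat j)) * x = b * exp (2 * h)"
      unfolding b_def by (metis mult.assoc mult.commute)
    then show ?thesis using nz by (simp add: \<eta>'_def B_def field_simps)
  qed
  have ab: "norm (a / (1 - a) - b / (1 - b)) \<le> 2 * K * n * E"
  proof -
    have "exp (- h * (2 * of_nat j + 2)) * exp (h * (1 + \<nu>)) = exp (- h * (2 * of_nat j + 1 - of_real \<nu>))"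
      by (rule exp_mult_eqI) (simp add: algebra_simps)
    then have "a = b * exp (h * (1 + \<nu>))"
      unfolding a_def b_def by (metis mult.assoc mult.commute)
    then have "a - b = b * (exp (h * (1 + \<nu>)) - 1)" by (simp add: algebra_simps)
    moreover have "norm (exp (h * (1 + \<nu>)) - 1) \<le> 2 * K * n"
    proof -
      have "norm (h * (1 + \<nu>)) \<le> n * 2"
        unfolding norm_mult n_def using \<nu> norm_triangle_ineq[of 1 "complex_of_real \<nu>"]
        by (intro mult_left_mono) auto
      then have b: "norm (h * (1 + \<nu>)) \<le> 2 * n" "norm (h * (1 + \<nu>)) \<le> 2" using n by linarith+
      have "norm (exp (h * (1 + \<nu>)) - 1) \<le> K * norm (h * (1 + \<nu>))"
        unfolding K_def by (rule norm_exp_minus_1_le) (rule b)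
      also have "\<dots> \<le> K * (2 * n)" by (intro mult_left_mono b K)
      finally show ?thesis by simp
    qed
    ultimately have *: "norm (a - b) \<le> exp (- \<tau>) * (2 * K * n)"
      using b by (simp only: norm_mult) (intro mult_mono, auto)
    have "a / (1 - a) - b / (1 - b) = (a - b) / ((1 - a) * (1 - b))"
      using nz by (simp add: field_simps)
    then have "norm (a / (1 - a) - b / (1 - b)) = norm (a - b) / (norm (1 - a) * norm (1 - b))"
      by (simp add: norm_divide norm_mult)
    also have "\<dots> \<le> exp (- \<tau>) * (2 * K * n) / ((1 - exp (- \<tau>)) * (1 - exp (- \<tau>)))"
      using * lower[OF a] lower[OF b] e1 n K by (intro frac_le mult_mono mult_pos_pos) auto
    also have "\<dots> = 2 * K * n * E" by (simp add: E_def power2_eq_square)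
    finally show ?thesis .
  qed
  have main: "norm (\<eta> + \<nu> * \<eta>') \<le> 12 * K * (n\<^sup>2 * E)"
  proof -
    have "\<eta> + \<nu> * \<eta>' = a / (1 - a) * (A - 2 * h * \<nu>) - \<nu> * (b / (1 - b) * (B - 2 * h)) +
        2 * h * \<nu> * (a / (1 - a) - b / (1 - b))"
      by (simp add: \<eta>_def \<eta>'_def algebra_simps)
    also have "norm \<dots> \<le> norm (a / (1 - a) * (A - 2 * h * \<nu>)) + norm (\<nu> * (b / (1 - b) * (B - 2 * h))) +
        norm (2 * h * \<nu> * (a / (1 - a) - b / (1 - b)))"
      by (intro order_trans[OF norm_triangle_ineq] add_mono norm_triangle_ineq4 order_refl)
    also have "norm (a / (1 - a) * (A - 2 * h * \<nu>)) \<le> E * (4 * K * n\<^sup>2)"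
      unfolding norm_mult using qE(1)[OF a] A2 E0 by (intro mult_mono) auto
    also have "norm (\<nu> * (b / (1 - b) * (B - 2 * h))) \<le> 1 * (E * (4 * K * n\<^sup>2))"
      unfolding norm_mult using qE(1)[OF b] B2 E0 \<nu> K by (intro mult_mono) auto
    also have "norm (2 * h * \<nu> * (a / (1 - a) - b / (1 - b))) \<le> (2 * n) * (2 * K * n * E)"
      unfolding norm_mult[of "2 * h * \<nu>"] using hk ab n by (intro mult_mono) auto
    also have "E * (4 * K * n\<^sup>2) + 1 * (E * (4 * K * n\<^sup>2)) + (2 * n) * (2 * K * n * E) = 12 * K * (n\<^sup>2 * E)"
      by (simp add: power2_eq_square algebra_simps)
    finally show ?thesis by simp
  qed
  have sq: "(norm \<eta>)\<^sup>2 \<le> 4 * K\<^sup>2 * (n\<^sup>2 * E)" "(norm \<eta>')\<^sup>2 \<le> 4 * K\<^sup>2 * (n\<^sup>2 * E)"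
  proof -
    have *: "(norm (w / (1 - w) * C))\<^sup>2 \<le> 4 * K\<^sup>2 * (n\<^sup>2 * E)"
      if "norm w \<le> exp (- \<tau>)" "norm C \<le> 2 * K * n" for w C :: complex
    proof -
      have "(norm (w / (1 - w) * C))\<^sup>2 = (norm (w / (1 - w)))\<^sup>2 * (norm C)\<^sup>2"
        by (simp only: norm_mult power_mult_distrib)
      also have "\<dots> \<le> E * (2 * K * n)\<^sup>2"
        by (intro mult_mono power_mono qE that E0) auto
      finally show ?thesis by (simp add: power_mult_distrib mult_ac)
    qed
    show "(norm \<eta>)\<^sup>2 \<le> 4 * K\<^sup>2 * (n\<^sup>2 * E)" unfolding \<eta>_def by (rule *[OF a A1])
    show "(norm \<eta>')\<^sup>2 \<le> 4 * K\<^sup>2 * (n\<^sup>2 * E)" unfolding \<eta>'_def norm_minus_cancel by (rule *[OF b B1])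
  qed
  have nE: "n\<^sup>2 * E \<le> 2 / (real j)\<^sup>2"
  proof -
    have "n\<^sup>2 * E \<le> 4 * (Re h)\<^sup>2 * (2 / \<tau>\<^sup>2)" by (intro mult_mono n E E0) auto
    also have "\<dots> = 2 / (real j)\<^sup>2" using h j by (simp add: \<tau>_def power_mult_distrib)
    finally show ?thesis .
  qed
  have "norm (1 + \<eta>) * norm (1 + \<eta>') powr \<nu> \<le>
      exp (Re \<eta> + (norm \<eta>)\<^sup>2 / 2) * exp (Re \<eta>' + (norm \<eta>')\<^sup>2 / 2) powr \<nu>"
    by (intro mult_mono powr_mono2 norm_1_plus_le_exp \<nu>) auto
  also have "\<dots> = exp (Re (\<eta> + \<nu> * \<eta>') + (norm \<eta>)\<^sup>2 / 2 + \<nu> * ((norm \<eta>')\<^sup>2 / 2))"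
    by (simp add: powr_def algebra_simps flip: exp_add)
  also have "\<dots> \<le> exp (ratio_err / (real j)\<^sup>2)"
  proof -
    have "Re (\<eta> + \<nu> * \<eta>') \<le> 12 * K * (n\<^sup>2 * E)" using complex_Re_le_cmod main by (rule order_trans)
    moreover have "\<nu> * ((norm \<eta>')\<^sup>2 / 2) \<le> 1 * ((norm \<eta>')\<^sup>2 / 2)" using \<nu> by (intro mult_right_mono) auto
    ultimately have "Re (\<eta> + \<nu> * \<eta>') + (norm \<eta>)\<^sup>2 / 2 + \<nu> * ((norm \<eta>')\<^sup>2 / 2) \<le> (12 * K + 4 * K\<^sup>2) * (n\<^sup>2 * E)"
      using sq by (simp add: algebra_simps)
    also have "\<dots> \<le> (12 * K + 4 * K\<^sup>2) * (2 / (real j)\<^sup>2)"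
      using K by (intro mult_left_mono nE) auto
    also have "\<dots> = ratio_err / (real j)\<^sup>2" by (simp add: ratio_err_def K_def add_divide_distrib algebra_simps)
    finally show ?thesis by simp
  qed
  finally have "norm (1 + \<eta>) * norm (1 + \<eta>') powr \<nu> \<le> exp (ratio_err / (real j)\<^sup>2)" .
  then have "(norm (1 - a) * norm (1 - b) powr \<nu>) * (norm (1 + \<eta>) * norm (1 + \<eta>') powr \<nu>) \<le>
      (norm (1 - a) * norm (1 - b) powr \<nu>) * exp (ratio_err / (real j)\<^sup>2)"
    by (intro mult_left_mono) auto
  then show ?thesis
    unfolding eta eta' norm_mult a_def [symmetric] b_def [symmetric]
    by (simp add: powr_mult mult_ac)
qed

text \<open>Multiplying the factor bounds telescopes the weights from index 1 to the last index,
  where the weight is at most 2, and the errors add up to \<open>ratio_err\<close> times the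
  convergent sum \<open>S\<close>.\<close>

lemma qratio_bound:
  fixes \<nu>1 :: real
  assumes "0 < \<nu>1" "\<nu>1 < 1"
  shows "\<exists>C>0. is_ratio_bound \<nu>1 C"
proof -
  define S where "S = (\<Sum>i. 1 / (real (Suc i))\<^sup>2)"
  have summ: "summable (\<lambda>i. 1 / (real (Suc i))\<^sup>2)"
    using inverse_power_summable[of 2, where 'a = real]
    by (subst summable_Suc_iff) (simp add: inverse_eq_divide power_one_over)
  define F where "F = 1 + 4 * exp 2 / (1 - \<nu>1)"
  have F: "F > 0" using assms by (simp add: F_def add_pos_nonneg)
  have main: "norm (qratio h (of_real \<nu>) x) * norm (1 - exp (- 2 * h) * x) powr \<nu> \<le> F * exp (ratio_err * S) * 2"
    if h: "Re h > 0" "norm h \<le> 2 * Re h" "norm h \<le> 1" and \<nu>: "0 \<le> \<nu>" "\<nu> \<le> \<nu>1" and x: "norm x \<le> 1"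
    for h x :: complex and \<nu> :: real
  proof -
    have q: "norm (exp (- 2 * h)) < 1" using h by simp
    have \<nu>': "\<nu> < 1" using \<nu> assms by simp
    define f g where "f j = norm (1 - exp (- h * (2 * of_nat j + 1 + of_real \<nu>)) * x)"
      and "g j = norm (1 - exp (- h * (2 * of_nat j + 1 - of_real \<nu>)) * x)" for j
    define d where "d j = norm (1 - exp (- h * (2 * of_nat j)) * x)" for j
    have small: "norm (exp (- h * of_real s) * x) \<le> exp (- (Re h * s))" for s
      using x by (simp add: norm_mult mult_left_le)
    have g_lower: "1 - exp (- (Re h * (1 - \<nu>))) \<le> g j" for j
    proof -
      have "norm (exp (- h * of_real (2 * j + 1 - \<nu>)) * x) \<le> exp (- (Re h * (2 * j + 1 - \<nu>)))"
        by (rule small)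
      also have "\<dots> \<le> exp (- (Re h * (1 - \<nu>)))" using h by (simp add: mult_left_mono)
      finally show ?thesis
        using norm_triangle_ineq2[of 1 "exp (- h * of_real (2 * j + 1 - \<nu>)) * x"] by (simp add: g_def add_ac)
    qed
    have pos: "Re h * (1 - \<nu>) > 0" using h \<nu>' by simp
    have g_pos: "g j > 0" for j using g_lower[of j] pos by (smt (verit) exp_less_one_iff)
    \<comment> \<open>The factor of index 0 is outside the telescoping estimate. Its numerator
      differs from its denominator by at most a multiple of \<open>Re h * norm a\<close>, and the
      denominator is at least of the order of that quantity times \<open>1 - \<nu>1\<close>; this is
      where \<open>\<nu>1 < 1\<close> enters.\<close>
    have f0: "f 0 \<le> F * g 0"
    proof -
      define a where "a = exp (- h * (1 - \<nu>)) * x"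
      define t where "t = Re h * (1 - \<nu>)"
      have a: "norm a \<le> exp (- t)" using small[of "1 - \<nu>"] by (simp add: a_def t_def)
      have "exp (- h * (1 - \<nu>)) * exp (- (2 * h * \<nu>)) = exp (- h * (1 + \<nu>))"
        by (rule exp_mult_eqI) (simp add: algebra_simps)
      then have "exp (- h * (1 + \<nu>)) * x = a * exp (- (2 * h * \<nu>))"
        unfolding a_def by (metis mult.assoc mult.commute)
      then have eq: "1 - exp (- h * (1 + \<nu>)) * x = (1 - a) + a * (1 - exp (- (2 * h * \<nu>)))"
        by (simp add: right_diff_distrib)
      have "f 0 = norm (1 - exp (- h * (1 + \<nu>)) * x)" by (simp add: f_def)
      also have "\<dots> \<le> norm (1 - a) + norm (a * (1 - exp (- (2 * h * \<nu>))))"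
        unfolding eq by (rule norm_triangle_ineq)
      also have "norm (1 - a) = g 0" by (simp add: g_def a_def)
      also have "norm (a * (1 - exp (- (2 * h * \<nu>)))) = norm a * norm (1 - exp (- (2 * h * \<nu>)))"
        by (rule norm_mult)
      finally have f: "f 0 \<le> g 0 + norm a * norm (1 - exp (- (2 * h * \<nu>)))" .
      have "norm (1 - exp (- (2 * h * \<nu>))) \<le> 4 * exp 2 * Re h"
      proof -
        have "norm (2 * h * \<nu>) \<le> 2 * norm h" using \<nu> \<nu>' by (simp add: norm_mult mult_left_le)
        then have b: "norm (2 * h * \<nu>) \<le> 2" "norm (2 * h * \<nu>) \<le> 4 * Re h" using h by linarith+
        have "norm (1 - exp (- (2 * h * \<nu>))) = norm (exp (- (2 * h * \<nu>)) - 1)"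
          by (rule norm_minus_commute)
        also have "\<dots> \<le> exp 2 * norm (- (2 * h * \<nu>))"
          by (rule norm_exp_minus_1_le) (use b in \<open>simp only: norm_minus_cancel\<close>)
        also have "\<dots> \<le> exp 2 * (4 * Re h)"
          unfolding norm_minus_cancel by (intro mult_left_mono b) auto
        finally show ?thesis by simp
      qed
      then have "norm a * norm (1 - exp (- (2 * h * \<nu>))) \<le> norm a * (4 * exp 2 * Re h)"
        by (intro mult_left_mono) auto
      moreover have "norm a * (4 * exp 2 * Re h) \<le> (4 * exp 2 / (1 - \<nu>1)) * g 0"
      proof -
        have "t * exp (- t) \<le> 1 - exp (- t)"
          using exp_ge_add_one_self[of t] by (simp add: exp_minus field_simps)
        also have "\<dots> \<le> g 0" using g_lower[of 0] by (simp add: t_def)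
        finally have "t * norm a \<le> g 0" using a pos mult_left_mono[OF a, of t] by (simp add: t_def)
        moreover have "Re h * norm a * (1 - \<nu>1) \<le> Re h * norm a * (1 - \<nu>)"
          using \<nu> h by (intro mult_left_mono) auto
        moreover have "Re h * norm a * (1 - \<nu>) = t * norm a" by (simp add: t_def)
        ultimately have "Re h * norm a * (1 - \<nu>1) \<le> g 0" by linarith
        then have "Re h * norm a \<le> g 0 / (1 - \<nu>1)" using assms by (simp add: field_simps)
        then have "4 * exp 2 * (Re h * norm a) \<le> 4 * exp 2 * (g 0 / (1 - \<nu>1))"
          by (intro mult_left_mono) auto
        then show ?thesis by (simp add: mult_ac)
      qed
      ultimately have "f 0 \<le> g 0 + (4 * exp 2 / (1 - \<nu>1)) * g 0" using f by linarith
      then show ?thesis by (simp add: F_def algebra_simps)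
    qed
    have fnn: "f j \<ge> 0" "d j \<ge> 0" for j by (simp_all add: f_def d_def)
    have ind: "(\<Prod>j<Suc n. f j) * d 1 powr \<nu> \<le>
        F * exp (ratio_err * (\<Sum>i<n. 1 / (real (Suc i))\<^sup>2)) * ((\<Prod>j<Suc n. g j) * d (Suc n) powr \<nu>)" for n
    proof (induction n)
      case 0
      show ?case using mult_right_mono[OF f0, of "d 1 powr \<nu>"] by (simp add: mult_ac)
    next
      case (Suc n)
      define P G where "P = (\<Prod>j<Suc n. f j)" and "G = (\<Prod>j<Suc n. g j)"
      define s where "s = ratio_err * (\<Sum>i<n. 1 / (real (Suc i))\<^sup>2)"
      have G: "G \<ge> 0" unfolding G_def by (intro prod_nonneg) (simp add: g_def)
      have "f (Suc n) * d (Suc n) powr \<nu> \<le> exp (ratio_err / (real (Suc n))\<^sup>2) * (g (Suc n) * d (Suc (Suc n)) powr \<nu>)"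
        using qratio_factor_bound[OF h \<nu>(1) _ x, of "Suc n"] \<nu>'
        by (simp add: f_def g_def d_def algebra_simps)
      then have st: "F * exp s * G * (f (Suc n) * d (Suc n) powr \<nu>) \<le>
         F * exp s * G * (exp (ratio_err / (real (Suc n))\<^sup>2) * (g (Suc n) * d (Suc (Suc n)) powr \<nu>))"
        using F G by (intro mult_left_mono) auto
      have "P * d 1 powr \<nu> \<le> F * exp s * (G * d (Suc n) powr \<nu>)"
        using Suc.IH by (simp only: P_def G_def s_def)
      then have "P * d 1 powr \<nu> * f (Suc n) \<le> F * exp s * (G * d (Suc n) powr \<nu>) * f (Suc n)"
        by (rule mult_right_mono) (rule fnn)
      also have "\<dots> \<le> F * exp s * G * (exp (ratio_err / (real (Suc n))\<^sup>2) * (g (Suc n) * d (Suc (Suc n)) powr \<nu>))"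
        using st by (simp only: mult_ac)
      finally have "P * d 1 powr \<nu> * f (Suc n) \<le>
          F * (exp s * exp (ratio_err / (real (Suc n))\<^sup>2)) * (G * g (Suc n) * d (Suc (Suc n)) powr \<nu>)"
        by (simp only: mult_ac)
      moreover have "exp s * exp (ratio_err / (real (Suc n))\<^sup>2) =
          exp (ratio_err * (\<Sum>i<Suc n. 1 / (real (Suc i))\<^sup>2))"
        by (simp add: s_def algebra_simps flip: exp_add)
      moreover have "(\<Prod>j<Suc (Suc n). f j) = P * f (Suc n)" "(\<Prod>j<Suc (Suc n). g j) = G * g (Suc n)"
        by (simp_all add: P_def G_def)
      ultimately show ?case by (simp only: mult_ac)
    qed
    have ratio_err: "ratio_err \<ge> 0" by (simp add: ratio_err_def)
    have bound: "(\<Prod>j<Suc n. f j) / (\<Prod>j<Suc n. g j) * d 1 powr \<nu> \<le> F * exp (ratio_err * S) * 2" for n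
    proof -
      have G: "(\<Prod>j<Suc n. g j) > 0" by (intro prod_pos) (simp add: g_pos)
      have "d (Suc n) \<le> 1 + 1"
        unfolding d_def using small[of "2 * Suc n"] h
        by (intro order_trans[OF norm_triangle_ineq4] add_mono) (auto intro: order_trans)
      then have "d (Suc n) powr \<nu> \<le> 2 powr \<nu>" using fnn \<nu> by (intro powr_mono2) auto
      also have "\<dots> \<le> 2 powr 1" using \<nu>' by (intro powr_mono) auto
      finally have d2: "d (Suc n) powr \<nu> \<le> 2" by simp
      have "(\<Sum>i<n. 1 / (real (Suc i))\<^sup>2) \<le> S"
        unfolding S_def by (intro sum_le_suminf summ) auto
      then have S: "exp (ratio_err * (\<Sum>i<n. 1 / (real (Suc i))\<^sup>2)) \<le> exp (ratio_err * S)"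
        using ratio_err by (simp add: mult_left_mono)
      have "(\<Prod>j<Suc n. f j) / (\<Prod>j<Suc n. g j) * d 1 powr \<nu> \<le>
          F * exp (ratio_err * (\<Sum>i<n. 1 / (real (Suc i))\<^sup>2)) * d (Suc n) powr \<nu>"
        using ind[of n] G by (simp add: field_simps)
      also have "\<dots> \<le> F * exp (ratio_err * S) * 2"
        using S d2 F by (intro mult_mono) auto
      finally show ?thesis .
    qed
    have "(\<lambda>n. (\<Prod>j<n. 1 - exp (- h * (1 + of_real \<nu>)) * x * exp (- 2 * h) ^ j)) \<longlonglongrightarrow>
        qpoch_inf (exp (- h * (1 + of_real \<nu>)) * x) (exp (- 2 * h))"
      by (rule LIMSEQ_qpoch[OF q])
    moreover have "(\<lambda>n. (\<Prod>j<n. 1 - exp (- h * (1 - of_real \<nu>)) * x * exp (- 2 * h) ^ j)) \<longlonglongrightarrow>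
        qpoch_inf (exp (- h * (1 - of_real \<nu>)) * x) (exp (- 2 * h))"
      by (rule LIMSEQ_qpoch[OF q])
    moreover have fe: "norm (1 - exp (- h * (1 + of_real \<nu>)) * x * exp (- 2 * h) ^ j) = f j"
      and ge: "norm (1 - exp (- h * (1 - of_real \<nu>)) * x * exp (- 2 * h) ^ j) = g j" for j
    proof -
      have "exp (- h * (2 * of_nat j + 1 + of_real \<nu>)) = exp (- h * (1 + of_real \<nu>)) * exp (- 2 * h) ^ j"
        "exp (- h * (2 * of_nat j + 1 - of_real \<nu>)) = exp (- h * (1 - of_real \<nu>)) * exp (- 2 * h) ^ j"
        by (simp_all add: algebra_simps flip: exp_of_nat_mult exp_add)
      then show "norm (1 - exp (- h * (1 + of_real \<nu>)) * x * exp (- 2 * h) ^ j) = f j"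
        "norm (1 - exp (- h * (1 - of_real \<nu>)) * x * exp (- 2 * h) ^ j) = g j"
        by (simp_all only: f_def g_def mult_ac)
    qed
    moreover have "qpoch_inf (exp (- h * (1 - of_real \<nu>)) * x) (exp (- 2 * h)) \<noteq> 0"
      unfolding qpoch_eq_0_iff[OF q] using ge g_pos by (metis less_irrefl norm_zero right_minus_eq)
    ultimately have "(\<lambda>n. norm ((\<Prod>j<n. 1 - exp (- h * (1 + of_real \<nu>)) * x * exp (- 2 * h) ^ j) /
          (\<Prod>j<n. 1 - exp (- h * (1 - of_real \<nu>)) * x * exp (- 2 * h) ^ j)) * d 1 powr \<nu>) \<longlonglongrightarrow>
        norm (qratio h (of_real \<nu>) x) * d 1 powr \<nu>"
      unfolding qratio_def by (intro tendsto_mult_right tendsto_norm tendsto_divide)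
    then have "(\<lambda>n. (\<Prod>j<n. f j) / (\<Prod>j<n. g j) * d 1 powr \<nu>) \<longlonglongrightarrow>
        norm (qratio h (of_real \<nu>) x) * d 1 powr \<nu>"
      by (simp only: norm_divide prod_norm[symmetric] fe ge)
    from LIMSEQ_Suc[OF this] bound
    have "norm (qratio h (of_real \<nu>) x) * d 1 powr \<nu> \<le> F * exp (ratio_err * S) * 2"
      by (intro LIMSEQ_le_const2) auto
    then show ?thesis by (simp add: d_def mult.commute)
  qed
  have "F * exp (ratio_err * S) * 2 > 0" using F by simp
  then show ?thesis using main unfolding is_ratio_bound_def by blast
qed

section \<open>The limit of ratios of q-Pochhammer symbols\<close>

lemma norm_exp_diff_le: "norm (exp z - exp (- z)) \<le> 2 * norm z * exp (norm z)" for z :: complex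
proof -
  have *: "norm (exp w - 1) \<le> norm z * exp (norm z)" if "norm w = norm z" for w :: complex
  proof -
    have "norm (exp w - (\<Sum>k\<le>0. w ^ k / fact k)) \<le> exp \<bar>Re w\<bar> * (norm w ^ Suc 0) / fact 0"
      by (rule Taylor_exp)
    also have "\<dots> \<le> exp (norm z) * norm z"
      using abs_Re_le_cmod[of w] that by (simp add: mult_right_mono)
    finally show ?thesis by (simp add: mult.commute)
  qed
  have "norm (exp z - exp (- z)) \<le> norm (exp z - 1) + norm (exp (- z) - 1)"
    using norm_triangle_ineq4[of "exp z - 1" "exp (- z) - 1"] by simp
  then show ?thesis using *[of z] *[of "- z"] by simp
qed

lemma norm_exp_diff_ge:
  assumes "Re z > 0"
  shows "Re z \<le> norm (exp z - exp (- z))"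
proof -
  have "Re z \<le> exp (Re z) - 1" using exp_ge_add_one_self[of "Re z"] by linarith
  also have "\<dots> \<le> norm (exp z) - norm (exp (- z))" using assms by simp
  also have "\<dots> \<le> norm (exp z - exp (- z))" by (rule norm_triangle_ineq2)
  finally show ?thesis .
qed

text \<open>Dividing \<open>exp w - exp (- w)\<close> by \<open>w\<close> leaves
  \<open>\<phi>\<close>, continuous at 0 with value 2. Assigning that value also covers the
  parameters with \<open>A t = 0\<close>, where a direct quotient would fail.\<close>

lemma tendsto_exp_diff_quotient:
  fixes h A :: "'a \<Rightarrow> complex"
  assumes h: "(h \<longlongrightarrow> 0) F" and A: "(A \<longlongrightarrow> A0) F" and nz: "\<forall>\<^sub>F t in F. h t \<noteq> 0" and N: "N \<noteq> 0"
  shows "((\<lambda>t. (exp (h t * A t * N) - exp (- (h t * A t * N))) / (exp (h t * N) - exp (- (h t * N)))) \<longlongrightarrow> A0) F"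
proof -
  define \<phi> :: "complex \<Rightarrow> complex" where "\<phi> w = (if w = 0 then 2 else (exp w - exp (- w)) / w)" for w
  have mult: "exp w - exp (- w) = w * \<phi> w" for w by (simp add: \<phi>_def)
  have "((\<lambda>w. exp w - exp (- w)) has_field_derivative 2) (at (0::complex))"
    by (auto intro!: derivative_eq_intros)
  then have "((\<lambda>w. (exp w - exp (- w)) / w) \<longlongrightarrow> 2) (at (0::complex))"
    by (simp add: DERIV_def)
  then have "(\<phi> \<longlongrightarrow> 2) (at 0)"
    by (rule Lim_transform_eventually) (auto simp: eventually_at_filter \<phi>_def)
  then have cont: "isCont \<phi> 0" by (simp add: isCont_def \<phi>_def)
  have l1: "((\<lambda>t. \<phi> (h t * N)) \<longlongrightarrow> 2) F"
    using isCont_tendsto_compose[OF cont tendsto_mult_left_zero[OF h]] by (simp add: \<phi>_def)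
  have l2: "((\<lambda>t. \<phi> (h t * A t * N)) \<longlongrightarrow> 2) F"
  proof -
    have "((\<lambda>t. h t * A t * N) \<longlongrightarrow> 0 * A0 * N) F" by (intro tendsto_intros h A)
    then show ?thesis using isCont_tendsto_compose[OF cont, of "\<lambda>t. h t * A t * N" F] by (simp add: \<phi>_def)
  qed
  have "((\<lambda>t. A t * \<phi> (h t * A t * N) / \<phi> (h t * N)) \<longlongrightarrow> A0 * 2 / 2) F"
    by (intro tendsto_intros A l1 l2) auto
  then have "((\<lambda>t. A t * \<phi> (h t * A t * N) / \<phi> (h t * N)) \<longlongrightarrow> A0) F" by simp
  then show ?thesis
  proof (rule Lim_transform_eventually)
    show "\<forall>\<^sub>F t in F. A t * \<phi> (h t * A t * N) / \<phi> (h t * N) =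
      (exp (h t * A t * N) - exp (- (h t * A t * N))) / (exp (h t * N) - exp (- (h t * N)))"
      using nz by eventually_elim (use N in \<open>simp add: mult field_simps\<close>)
  qed
qed

text \<open>In the difference of the two logarithmic series the factor \<open>1 - q ^ n\<close>
  combines with the powers of \<open>exp (- h)\<close> into a quotient of hyperbolic sines. The
  hypothesis puts both arguments of the symbols inside the unit disc.\<close>

lemma qratio_series:
  fixes h A x :: complex
  assumes h: "Re h > 0" and x: "norm x * exp (norm (h * A)) < 1"
  shows "qratio h A x = exp (\<Sum>n. x ^ Suc n / of_nat (Suc n) *
      ((exp (h * A * of_nat (Suc n)) - exp (- (h * A * of_nat (Suc n)))) /
       (exp (h * of_nat (Suc n)) - exp (- (h * of_nat (Suc n))))))"
proof -
  define q where "q = exp (- 2 * h)"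
  have q: "norm q < 1" using h by (simp add: q_def)
  have small: "norm (exp (- h * (1 + B)) * x) < 1" if "norm (h * B) = norm (h * A)" for B
  proof -
    have "norm (exp (- h * (1 + B))) = exp (- Re h - Re (h * B))" by (simp add: algebra_simps)
    also have "\<dots> \<le> exp (norm (h * A))" using abs_Re_le_cmod[of "h * B"] h that by simp
    finally have "norm x * norm (exp (- h * (1 + B))) \<le> norm x * exp (norm (h * A))"
      by (intro mult_left_mono) auto
    moreover have "norm (exp (- h * (1 + B)) * x) = norm x * norm (exp (- h * (1 + B)))"
      by (simp only: norm_mult mult.commute)
    ultimately show ?thesis using x by linarith
  qed
  define a b where "a = exp (- h * (1 + A)) * x" and "b = exp (- h * (1 - A)) * x"
  have ab: "norm a < 1" "norm b < 1" using small[of A] small[of "- A"] by (simp_all add: a_def b_def)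
  define S where "S y n = y ^ Suc n / (of_nat (Suc n) * (1 - q ^ Suc n))" for y :: complex and n
  have summ: "summable (S a)" "summable (S b)"
    unfolding S_def [abs_def] by (rule qpoch_exp_series(1)[OF ab(1) q], rule qpoch_exp_series(1)[OF ab(2) q])
  have "qpoch_inf a q / qpoch_inf b q = exp (- (\<Sum>n. S a n)) / exp (- (\<Sum>n. S b n))"
    unfolding S_def using ab q by (simp only: qpoch_exp_series(2))
  also have "\<dots> = exp ((\<Sum>n. S b n) - (\<Sum>n. S a n))" by (simp add: exp_minus exp_diff field_simps)
  also have "(\<Sum>n. S b n) - (\<Sum>n. S a n) = (\<Sum>n. S b n - S a n)" using summ by (intro suminf_diff)
  also have "\<dots> = (\<Sum>n. x ^ Suc n / of_nat (Suc n) *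
      ((exp (h * A * of_nat (Suc n)) - exp (- (h * A * of_nat (Suc n)))) /
       (exp (h * of_nat (Suc n)) - exp (- (h * of_nat (Suc n))))))"
  proof (rule suminf_cong)
    fix n
    define N where "N = Suc n"
    define u where "u = exp (- (h * of_nat N))"
    define v where "v = exp (h * A * of_nat N)"
    have uv: "u \<noteq> 0" "v \<noteq> 0" by (simp_all add: u_def v_def)
    have "norm u < 1" using h by (simp add: u_def N_def)
    have u1: "1 - u\<^sup>2 \<noteq> 0"
    proof
      assume "1 - u\<^sup>2 = 0"
      then have "norm u = 1" by (metis norm_one norm_power eq_iff_diff_eq_0 power2_eq_1_iff norm_minus_cancel)
      then show False using \<open>norm u < 1\<close> by simp
    qed
    have e: "exp (- h * (1 + A)) ^ N = u / v" "exp (- h * (1 - A)) ^ N = u * v" "q ^ N = u\<^sup>2"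
      "exp (- (h * A * of_nat N)) = 1 / v" "exp (h * of_nat N) = 1 / u"
      by (simp_all add: u_def v_def q_def algebra_simps flip: exp_of_nat_mult exp_add exp_diff exp_minus)
        (simp_all add: exp_minus inverse_eq_divide)
    have "S b n - S a n = x ^ N / of_nat N * ((u * v - u / v) / (1 - u\<^sup>2))"
      unfolding S_def N_def [symmetric] a_def b_def power_mult_distrib e
      by (simp add: diff_divide_distrib algebra_simps)
    also have "(u * v - u / v) / (1 - u\<^sup>2) = (v - 1 / v) / (1 / u - u)"
      using uv u1 by (simp add: divide_simps) (simp add: algebra_simps power2_eq_square)
    finally show "S b n - S a n = x ^ Suc n / of_nat (Suc n) *
      ((exp (h * A * of_nat (Suc n)) - exp (- (h * A * of_nat (Suc n)))) /
       (exp (h * of_nat (Suc n)) - exp (- (h * of_nat (Suc n)))))"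
      unfolding N_def [symmetric] e by (simp only: u_def v_def)
  qed
  finally show ?thesis by (simp only: a_def b_def q_def qratio_def)
qed

text \<open>Tannery's theorem for the series: its terms tend to \<open>A0\<close> times those of
  \<open>- Ln (1 - x0)\<close>. The ratio \<open>r\<close> of the geometric majorant lies strictly
  between \<open>norm x0\<close> and 1, which leaves room to absorb the growth of
  \<open>exp (norm (h t * A t) * N)\<close>.\<close>

lemma tendsto_qratio:
  fixes h A x :: "'a \<Rightarrow> complex"
  assumes h: "(h \<longlongrightarrow> 0) F" and Re_h: "\<forall>\<^sub>F t in F. Re (h t) > 0 \<and> norm (h t) \<le> 2 * Re (h t)"
    and A: "(A \<longlongrightarrow> A0) F" and x: "(x \<longlongrightarrow> x0) F" and x0: "norm x0 < 1"
  shows "((\<lambda>t. qratio (h t) (A t) (x t)) \<longlongrightarrow> exp (- A0 * Ln (1 - x0))) F"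
proof (cases "F = bot")
  case True
  then show ?thesis by simp
next
  case False
  define a where "a n t = x t ^ Suc n / of_nat (Suc n) *
      ((exp (h t * A t * of_nat (Suc n)) - exp (- (h t * A t * of_nat (Suc n)))) /
       (exp (h t * of_nat (Suc n)) - exp (- (h t * of_nat (Suc n)))))" for n t
  define r where "r = (1 + norm x0) / 2"
  have r: "norm x0 < r" "0 < r" "r < 1" using x0 by (auto simp: r_def add_pos_nonneg)
  have "((\<lambda>t. norm (x t) * exp (norm (h t * A t))) \<longlongrightarrow> norm x0 * exp (norm (0 * A0))) F"
    by (intro tendsto_intros h A x)
  then have ev1: "\<forall>\<^sub>F t in F. norm (x t) * exp (norm (h t * A t)) < r"
    using r by (intro order_tendstoD) auto
  have ev2: "\<forall>\<^sub>F t in F. norm (A t) < norm A0 + 1"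
    using tendsto_norm[OF A] by (rule order_tendstoD) simp
  \<comment> \<open>The factor 4 is one 2 from \<open>norm_exp_diff_le\<close> and one from
    \<open>norm (h t) \<le> 2 * Re (h t)\<close>.\<close>
  define M where "M n = 4 * (norm A0 + 1) * r ^ Suc n" for n
  have bound: "\<forall>\<^sub>F t in F. \<forall>n. norm (a n t) \<le> M n"
    using ev1 ev2 Re_h
  proof eventually_elim
    case (elim t)
    show ?case
    proof
      fix n
      define N where "N = real (Suc n)"
      have N: "N \<ge> 1" by (simp add: N_def)
      define \<rho> where "\<rho> = Re (h t)"
      have \<rho>: "\<rho> > 0" "norm (h t) \<le> 2 * \<rho>" using elim by (auto simp: \<rho>_def)
      have den: "\<rho> * N \<le> norm (exp (h t * of_nat (Suc n)) - exp (- (h t * of_nat (Suc n))))"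
        using norm_exp_diff_ge[of "h t * of_nat (Suc n)"] \<rho> N by (simp add: \<rho>_def N_def)
      have z: "norm (h t * A t * of_nat (Suc n)) = norm (h t * A t) * N"
        unfolding norm_mult N_def norm_of_nat ..
      have num: "norm (exp (h t * A t * of_nat (Suc n)) - exp (- (h t * A t * of_nat (Suc n)))) \<le>
          2 * (norm (h t * A t) * N) * exp (norm (h t * A t) * N)"
        using norm_exp_diff_le[of "h t * A t * of_nat (Suc n)"] unfolding z .
      also have "\<dots> \<le> 2 * (2 * \<rho> * (norm A0 + 1) * N) * exp (norm (h t * A t) * N)"
        unfolding norm_mult[of "h t"] using elim(2) \<rho> N
        by (intro mult_right_mono mult_left_mono mult_mono) auto
      finally have num': "norm (exp (h t * A t * of_nat (Suc n)) - exp (- (h t * A t * of_nat (Suc n)))) \<le>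
          4 * (norm A0 + 1) * exp (norm (h t * A t) * N) * (\<rho> * N)" by (simp add: mult_ac)
      have quot: "norm ((exp (h t * A t * of_nat (Suc n)) - exp (- (h t * A t * of_nat (Suc n)))) /
       (exp (h t * of_nat (Suc n)) - exp (- (h t * of_nat (Suc n))))) \<le> 4 * (norm A0 + 1) * exp (norm (h t * A t) * N)"
      proof -
        have "norm ((exp (h t * A t * of_nat (Suc n)) - exp (- (h t * A t * of_nat (Suc n)))) /
          (exp (h t * of_nat (Suc n)) - exp (- (h t * of_nat (Suc n))))) \<le>
          (4 * (norm A0 + 1) * exp (norm (h t * A t) * N) * (\<rho> * N)) / (\<rho> * N)"
          unfolding norm_divide using num' den \<rho> N by (intro frac_le) auto
        then show ?thesis using \<rho> N by simp
      qed
      have "norm (a n t) \<le> norm (x t) ^ Suc n * (4 * (norm A0 + 1) * exp (norm (h t * A t) * N))"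
        unfolding a_def norm_mult[of "x t ^ Suc n / of_nat (Suc n)"]
      proof (intro mult_mono quot)
        have "norm (x t ^ Suc n / of_nat (Suc n)) = norm (x t) ^ Suc n / N"
          by (simp only: norm_divide norm_power N_def norm_of_nat)
        also have "\<dots> \<le> norm (x t) ^ Suc n / 1" using N by (intro divide_left_mono) auto
        finally show "norm (x t ^ Suc n / of_nat (Suc n)) \<le> norm (x t) ^ Suc n" by simp
      qed auto
      also have "exp (norm (h t * A t) * N) = exp (norm (h t * A t)) ^ Suc n"
        unfolding N_def using exp_of_nat_mult[of "Suc n" "norm (h t * A t)"] by (simp only: mult.commute)
      also have "norm (x t) ^ Suc n * (4 * (norm A0 + 1) * exp (norm (h t * A t)) ^ Suc n) =
          4 * (norm A0 + 1) * (norm (x t) * exp (norm (h t * A t))) ^ Suc n"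
        by (simp only: power_mult_distrib mult_ac)
      also have "\<dots> \<le> M n"
        unfolding M_def using elim(1) by (intro mult_left_mono power_mono) auto
      finally show "norm (a n t) \<le> M n" .
    qed
  qed
  have lim: "((\<lambda>t. a n t) \<longlongrightarrow> x0 ^ Suc n / of_nat (Suc n) * A0) F" for n
    unfolding a_def
  proof (intro tendsto_mult tendsto_divide tendsto_power x tendsto_const tendsto_exp_diff_quotient h A)
    show "\<forall>\<^sub>F t in F. h t \<noteq> 0" using Re_h by eventually_elim auto
  qed (simp_all del: of_nat_Suc)
  have "((\<lambda>t. \<Sum>n. a n t) \<longlongrightarrow> (\<Sum>n. x0 ^ Suc n / of_nat (Suc n) * A0)) F"
  proof -
    have "\<forall>\<^sub>F (k, t) in at_top \<times>\<^sub>F F. norm (a k t) \<le> M k"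
    proof -
      have "\<forall>\<^sub>F (k::nat, t) in at_top \<times>\<^sub>F F. \<forall>n. norm (a n t) \<le> M n"
        using bound by (subst eventually_prod2) auto
      then show ?thesis by (rule eventually_mono) auto
    qed
    moreover have "summable M"
      unfolding M_def using r by (intro summable_mult) (simp add: summable_geometric)
    ultimately show ?thesis using tannerys_theorem[where a = a and M = M, OF lim _ _ False] by blast
  qed
  also have "(\<Sum>n. x0 ^ Suc n / of_nat (Suc n) * A0) = - A0 * Ln (1 - x0)"
  proof -
    have "(\<lambda>n. (- 1) ^ Suc n / of_nat n * (- x0) ^ n) sums Ln (1 + (- x0))"
      by (rule Ln_series) (use x0 in simp)
    then have "(\<lambda>n. (- 1) ^ Suc (Suc n) / of_nat (Suc n) * (- x0) ^ Suc n) sums Ln (1 - x0)"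
      by (subst sums_Suc_iff) simp
    also have "(\<lambda>n. (- 1) ^ Suc (Suc n) / of_nat (Suc n) * (- x0) ^ Suc n) = (\<lambda>n. - (x0 ^ Suc n / of_nat (Suc n)))"
    proof
      fix n
      have "(- 1) ^ n * (- x0) ^ n = x0 ^ n" by (simp flip: power_mult_distrib)
      then show "(- 1) ^ Suc (Suc n) / of_nat (Suc n) * (- x0) ^ Suc n = - (x0 ^ Suc n / of_nat (Suc n))"
        by (simp add: mult.left_commute)
    qed
    finally have "(\<lambda>n. - (- (x0 ^ Suc n / of_nat (Suc n)))) sums - Ln (1 - x0)" by (rule sums_minus)
    then have "(\<lambda>n. x0 ^ Suc n / of_nat (Suc n) * A0) sums (- Ln (1 - x0) * A0)"
      by (intro sums_mult2) simp
    then show ?thesis by (simp add: sums_unique[symmetric] mult.commute)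
  qed
  finally have "((\<lambda>t. exp (\<Sum>n. a n t)) \<longlongrightarrow> exp (- A0 * Ln (1 - x0))) F" by (rule tendsto_exp)
  then show ?thesis
  proof (rule Lim_transform_eventually)
    show "\<forall>\<^sub>F t in F. exp (\<Sum>n. a n t) = qratio (h t) (A t) (x t)"
      using ev1 Re_h
    proof eventually_elim
      case (elim t)
      have "norm (x t) * exp (norm (h t * A t)) < 1" using elim r by linarith
      then show ?case using elim qratio_series[of "h t" "x t" "A t"] by (simp only: a_def)
    qed
  qed
qed

section \<open>Averaging over unit cells\<close>

text \<open>Substituting \<open>y\<close> for the second variable and exchanging the integrals, the
  \<open>a\<close> that contribute to a fixed \<open>y\<close> are those with
  \<open>\<lfloor>a / d\<rfloor> = \<lfloor>y + 1/2\<rfloor>\<close>, an interval of length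
  \<open>d\<close>. Half-open cells make this exact.\<close>

lemma nn_integral_floor_cell:
  fixes g :: "real \<Rightarrow> ennreal"
  assumes [measurable]: "g \<in> borel_measurable borel" and d: "d > 0"
  shows "(\<integral>\<^sup>+p. indicator {-1/2..<1/2} (snd p) * g (of_int \<lfloor>fst p / d\<rfloor> + snd p) \<partial>(lborel \<Otimes>\<^sub>M lborel)) =
    ennreal d * (\<integral>\<^sup>+y. g y \<partial>lborel)"
proof -
  have "(\<integral>\<^sup>+p. indicator {-1/2..<1/2} (snd p) * g (of_int \<lfloor>fst p / d\<rfloor> + snd p) \<partial>(lborel \<Otimes>\<^sub>M lborel)) =
    (\<integral>\<^sup>+a. (\<integral>\<^sup>+b. indicator {-1/2..<1/2} b * g (of_int \<lfloor>a / d\<rfloor> + b) \<partial>lborel) \<partial>lborel)"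
    by (subst lborel.nn_integral_fst[symmetric]) simp_all
  also have "\<dots> = (\<integral>\<^sup>+a. (\<integral>\<^sup>+y. indicator {-1/2..<1/2} (y - of_int \<lfloor>a / d\<rfloor>) * g y \<partial>lborel) \<partial>lborel)"
  proof (rule nn_integral_cong)
    fix a :: real
    show "(\<integral>\<^sup>+b. indicator {-1/2..<1/2} b * g (of_int \<lfloor>a / d\<rfloor> + b) \<partial>lborel) =
      (\<integral>\<^sup>+y. indicator {-1/2..<1/2} (y - of_int \<lfloor>a / d\<rfloor>) * g y \<partial>lborel)"
      by (subst nn_integral_real_affine[where c = 1 and t = "- of_int \<lfloor>a / d\<rfloor>"]) simp_all
  qed
  also have "\<dots> = (\<integral>\<^sup>+y. (\<integral>\<^sup>+a. indicator {-1/2..<1/2} (y - of_int \<lfloor>a / d\<rfloor>) * g y \<partial>lborel) \<partial>lborel)"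
    by (rule lborel_pair.Fubini') simp
  also have "\<dots> = (\<integral>\<^sup>+y. ennreal d * g y \<partial>lborel)"
  proof (rule nn_integral_cong)
    fix y :: real
    define k where "k = \<lfloor>y + 1/2\<rfloor>"
    have *: "indicator {-1/2..<1/2} (y - of_int \<lfloor>a / d\<rfloor>) = (indicator {d * k..<d * (k + 1)} a :: ennreal)" for a
    proof -
      have "y - of_int \<lfloor>a / d\<rfloor> \<in> {-1/2..<1/2} \<longleftrightarrow> \<lfloor>a / d\<rfloor> = k"
        unfolding k_def eq_commute[of "\<lfloor>a / d\<rfloor>"] floor_eq_iff[of "y + 1 / 2"] by auto
      also have "\<dots> \<longleftrightarrow> a \<in> {d * k..<d * (k + 1)}"
        using d by (auto simp: floor_eq_iff field_simps)
      finally show ?thesis by (simp add: indicator_def)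
    qed
    have "(\<integral>\<^sup>+a. indicator {-1/2..<1/2} (y - of_int \<lfloor>a / d\<rfloor>) * g y \<partial>lborel) =
        (\<integral>\<^sup>+a. indicator {d * k..<d * (k + 1)} a * g y \<partial>lborel)" unfolding * ..
    also have "\<dots> = emeasure lborel {d * k..<d * (k + 1)} * g y" by (simp add: nn_integral_multc)
    also have "emeasure lborel {d * k..<d * (k + 1)} = ennreal d"
      using d by (subst emeasure_lborel_Ico) (auto simp: algebra_simps)
    finally show "(\<integral>\<^sup>+a. indicator {-1/2..<1/2} (y - of_int \<lfloor>a / d\<rfloor>) * g y \<partial>lborel) = ennreal d * g y" .
  qed
  also have "\<dots> = ennreal d * (\<integral>\<^sup>+y. g y \<partial>lborel)" by (simp add: nn_integral_cmult)
  finally show ?thesis .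
qed

text \<open>The nonnegative case identifies the image of the cell measure under \<open>T\<close> as
  \<open>d\<close> times Lebesgue measure; integrability and integrals of vector-valued functions
  transfer through that image measure.\<close>

lemma integral_floor_cell:
  fixes f :: "real \<Rightarrow> 'b::{banach, second_countable_topology}"
  assumes [measurable]: "f \<in> borel_measurable borel" and d: "d > 0"
    and int: "integrable (lborel \<Otimes>\<^sub>M lborel)
      (\<lambda>p. indicator {-1/2..<1/2} (snd p) *\<^sub>R f (of_int \<lfloor>fst p / d\<rfloor> + snd p))"
  shows "integrable lborel f"
    and "(\<integral>p. indicator {-1/2..<1/2} (snd p) *\<^sub>R f (of_int \<lfloor>fst p / d\<rfloor> + snd p) \<partial>(lborel \<Otimes>\<^sub>M lborel)) =
      d *\<^sub>R (\<integral>y. f y \<partial>lborel)"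
proof -
  define N where "N = density (lborel \<Otimes>\<^sub>M lborel :: (real \<times> real) measure) (\<lambda>p. ennreal (indicator {-1/2..<1/2} (snd p)))"
  define T where "T p = of_int \<lfloor>fst p / d\<rfloor> + snd p" for p :: "real \<times> real"
  have [measurable]: "T \<in> N \<rightarrow>\<^sub>M borel" unfolding T_def N_def by simp
  have eq: "distr N borel T = density lborel (\<lambda>_. ennreal d)"
  proof (rule measure_eqI)
    fix A assume "A \<in> sets (distr N borel T)"
    then have [measurable]: "A \<in> sets borel" by simp
    have "emeasure (distr N borel T) A = (\<integral>\<^sup>+y. indicator A y \<partial>distr N borel T)" by simp
    also have "\<dots> = (\<integral>\<^sup>+p. indicator A (T p) \<partial>N)" by (subst nn_integral_distr) auto
    also have "\<dots> = (\<integral>\<^sup>+p. indicator {-1/2..<1/2} (snd p) * indicator A (T p) \<partial>(lborel \<Otimes>\<^sub>M lborel))"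
      unfolding N_def by (subst nn_integral_density) (auto simp: T_def ennreal_indicator)
    also have "\<dots> = ennreal d * (\<integral>\<^sup>+y. indicator A y \<partial>lborel)"
      unfolding T_def by (rule nn_integral_floor_cell[OF _ d]) simp
    also have "\<dots> = emeasure (density lborel (\<lambda>_. ennreal d)) A"
      by (simp add: emeasure_density nn_integral_cmult)
    finally show "emeasure (distr N borel T) A = emeasure (density lborel (\<lambda>_. ennreal d)) A" .
  qed simp
  have "integrable N (\<lambda>p. f (T p))"
    unfolding N_def using int
    by (subst integrable_density) (auto simp: T_def indicator_def)
  then have "integrable (distr N borel T) f" by (subst integrable_distr_eq) auto
  then have "integrable lborel (\<lambda>y. d *\<^sub>R f y)"
    unfolding eq using d by (subst (asm) integrable_density) auto
  then have "integrable lborel (\<lambda>y. (1 / d) *\<^sub>R d *\<^sub>R f y)" by (rule integrable_scaleR_right)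
  then show "integrable lborel f" using d by simp
  have "(\<integral>p. indicator {-1/2..<1/2} (snd p) *\<^sub>R f (T p) \<partial>(lborel \<Otimes>\<^sub>M lborel)) = (\<integral>p. f (T p) \<partial>N)"
    unfolding N_def by (subst integral_density) (auto simp: T_def indicator_def)
  also have "\<dots> = (\<integral>y. f y \<partial>distr N borel T)" by (subst integral_distr) auto
  also have "\<dots> = (\<integral>y. d *\<^sub>R f y \<partial>lborel)" unfolding eq using d by (subst integral_density) auto
  also have "\<dots> = d *\<^sub>R (\<integral>y. f y \<partial>lborel)" by simp
  finally show "(\<integral>p. indicator {-1/2..<1/2} (snd p) *\<^sub>R f (of_int \<lfloor>fst p / d\<rfloor> + snd p) \<partial>(lborel \<Otimes>\<^sub>M lborel)) =
      d *\<^sub>R (\<integral>y. f y \<partial>lborel)" unfolding T_def .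
qed

section \<open>The integrand in terms of q-Pochhammer symbols\<close>

text \<open>Any logarithm of \<open>w\<close> will do: two choices differ by a multiple of
  \<open>2 * pi * \<i>\<close>, harmless since \<open>a - a'\<close> is an integer. Later steps are
  thereby free of the branch of \<open>Arg\<close>.\<close>

lemma cpow_pair_exp:
  assumes w: "exp l = w" and n: "a - a' = of_int n"
  shows "cpow_pair w a a' = exp (a * l + a' * cnj l)"
proof -
  have nw: "norm w = exp (Re l)" using w by auto
  have wnz: "w \<noteq> 0" using w by auto
  have l: "l = of_real (Re l) + \<i> * of_real (Im l)" by (rule complex_eq)
  have "of_real (norm w) * exp (\<i> * of_real (Arg w)) = w" using Arg_eq[OF wnz] by simp
  also have "w = of_real (norm w) * exp (\<i> * of_real (Im l))"
    unfolding nw using w by (subst (asm) l) (simp add: exp_add flip: exp_of_real)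
  finally have arg: "exp (\<i> * of_real (Arg w)) = exp (\<i> * of_real (Im l))" using wnz by simp
  have "exp (\<i> * (a - a') * of_real (Arg w)) = exp (of_int n * (\<i> * of_real (Arg w)))"
    unfolding n by (simp add: mult_ac)
  also have "\<dots> = exp (\<i> * of_real (Arg w)) powi n" by (rule exp_power_int[symmetric])
  also have "\<dots> = exp (of_int n * (\<i> * of_real (Im l)))" unfolding arg by (rule exp_power_int)
  finally have 1: "exp (\<i> * (a - a') * of_real (Arg w)) = exp ((a - a') * (\<i> * of_real (Im l)))"
    unfolding n .
  have "ln (complex_of_real (exp (Re l))) = of_real (Re l)" by (subst Ln_of_real) auto
  then have 2: "of_real (norm w) powr (a + a') = exp ((a + a') * of_real (Re l))"
    unfolding nw by (simp add: powr_def)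
  have cl: "cnj l = of_real (Re l) - \<i> * of_real (Im l)" by (simp add: complex_eq_iff)
  have "cpow_pair w a a' = exp ((a + a') * of_real (Re l) + (a - a') * (\<i> * of_real (Im l)))"
    unfolding cpow_pair_def 1 2 by (simp add: exp_add)
  also have "(a + a') * of_real (Re l) + (a - a') * (\<i> * of_real (Im l)) = a * l + a' * cnj l"
    unfolding cl by (subst (3) l) (simp add: algebra_simps)
  finally show ?thesis .
qed

text \<open>Adding \<open>\<i> * pi\<close> to the logarithm changes the exponent by
  \<open>2 * m * pi * \<i>\<close>, because the two powers differ by the even number
  \<open>2 * m\<close>.\<close>

lemma cpow_pair_minus:
  fixes m :: int and u w :: complex
  assumes "w \<noteq> 0"
  shows "cpow_pair (- w) (of_int m + \<i> * u) (- of_int m + \<i> * u) = cpow_pair w (of_int m + \<i> * u) (- of_int m + \<i> * u)"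
proof -
  define a a' where "a = of_int m + \<i> * u" and "a' = - of_int m + \<i> * u"
  have d: "a - a' = of_int (2 * m)" by (simp add: a_def a'_def)
  define l where "l = Ln w"
  have l: "exp l = w" using assms by (simp add: l_def)
  have l': "exp (l + \<i> * pi) = - w" using l by (simp add: exp_add exp_pi_i')
  have "a * (l + \<i> * pi) + a' * cnj (l + \<i> * pi) = (a * l + a' * cnj l) + (a - a') * \<i> * pi"
    by (simp add: algebra_simps)
  also have "(a - a') * \<i> * pi = (2 * of_int m * pi) * \<i>" unfolding d by simp
  finally have "exp (a * (l + \<i> * pi) + a' * cnj (l + \<i> * pi)) = exp (a * l + a' * cnj l) * exp ((2 * of_int m * pi) * \<i>)"
    by (simp only: exp_add)
  also have "exp ((2 * of_int m * pi) * \<i>) = 1" by (rule exp_integer_2pi) simp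
  finally show ?thesis
    using cpow_pair_exp[OF l' d] cpow_pair_exp[OF l d] by (simp add: a_def a'_def)
qed

text \<open>For \<open>\<alpha> > 0\<close>, \<open>2 * sinh W = exp W * (1 - exp (- 2 * W))\<close>
  has the logarithm \<open>W + L\<close>. The three exponentials match the limits of the phase and
  of the two ratios.\<close>

lemma cpow_pair_sinh:
  fixes m :: int and u :: complex and \<alpha> \<beta> :: real
  assumes "\<alpha> > 0"
  defines "L \<equiv> Ln (1 - exp (- (2 * of_real pi * (of_real \<alpha> + \<i> * of_real \<beta>))))"
  shows "cpow_pair (2 * sinh (of_real pi * (of_real \<alpha> + \<i> * of_real \<beta>))) (of_int m + \<i> * u) (- of_int m + \<i> * u) =
    exp (2 * pi * \<i> * (of_real \<beta> * of_int m + of_real \<alpha> * u)) * exp ((of_int m + \<i> * u) * L) *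
    exp (- (of_int m - \<i> * u) * cnj L)"
proof -
  define W where "W = of_real pi * (of_real \<alpha> + \<i> * of_real \<beta>)"
  have "norm (exp (- (2 * W))) < 1" using assms by (simp add: W_def)
  then have nz: "1 - exp (- (2 * W)) \<noteq> 0" by (metis less_irrefl norm_one right_minus_eq)
  have L: "L = Ln (1 - exp (- (2 * W)))" by (simp add: L_def W_def mult.assoc)
  have "exp (W + L) = exp W * (1 - exp (- (2 * W)))"
    using nz by (simp add: L exp_add)
  also have "\<dots> = 2 * sinh W"
    by (simp add: sinh_field_def algebra_simps flip: exp_add)
  finally have e: "exp (W + L) = 2 * sinh W" .
  have "(of_int m + \<i> * u) - (- of_int m + \<i> * u) = of_int (2 * m)" by simp
  from cpow_pair_exp[OF e this]
  have "cpow_pair (2 * sinh W) (of_int m + \<i> * u) (- of_int m + \<i> * u) =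
    exp ((of_int m + \<i> * u) * (W + L) + (- of_int m + \<i> * u) * cnj (W + L))" .
  also have "(of_int m + \<i> * u) * (W + L) + (- of_int m + \<i> * u) * cnj (W + L) =
    2 * pi * \<i> * (of_real \<beta> * of_int m + of_real \<alpha> * u) + (of_int m + \<i> * u) * L + (- (of_int m - \<i> * u) * cnj L)"
    by (simp add: W_def algebra_simps)
  finally show ?thesis by (simp only: exp_add W_def)
qed

lemma sinh_pi_nonzero:
  fixes \<alpha> \<beta> :: real
  assumes "\<alpha> \<noteq> 0"
  shows "sinh (of_real pi * (of_real \<alpha> + \<i> * of_real \<beta>)) \<noteq> (0::complex)"
proof
  define W where "W = of_real pi * (of_real \<alpha> + \<i> * of_real \<beta>)"
  assume "sinh (of_real pi * (of_real \<alpha> + \<i> * of_real \<beta>)) = (0::complex)"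
  then have "exp W = exp (- W)" by (simp add: W_def sinh_field_def)
  then have "norm (exp W) = norm (exp (- W))" by simp
  then show False using assms by (simp add: W_def)
qed

section \<open>Size of one gamma factor\<close>

definition sq :: "real \<Rightarrow> real" where "sq d = sqrt (1 + d\<^sup>2)"

lemma sq_square: "(sq d)\<^sup>2 = 1 + d\<^sup>2"
  by (simp add: sq_def add_nonneg_nonneg)

lemma sq_ge_1: "sq d \<ge> 1"
  by (simp add: sq_def)

lemma sq_le: "d \<ge> 0 \<Longrightarrow> sq d \<le> 1 + d"
  unfolding sq_def by (rule real_le_lsqrt) (auto simp: power2_eq_square algebra_simps)

lemma sq_minus_1: "d \<ge> 0 \<Longrightarrow> sq d - 1 \<le> d\<^sup>2" "0 \<le> sq d - 1"
proof -
  have "(sq d - 1) * 1 \<le> (sq d - 1) * (sq d + 1)"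
    using sq_ge_1[of d] by (intro mult_left_mono) auto
  also have "\<dots> = d\<^sup>2" using sq_square[of d] by (simp add: algebra_simps power2_eq_square)
  finally show "sq d - 1 \<le> d\<^sup>2" by simp
qed (use sq_ge_1 in auto)

lemma hpar_inverse:
  assumes "d > 0"
  shows "2 * pi * \<i> / hpar d = \<i> / d - 1"
  using assms one_plus_minus_i_nonzero[of d] by (simp add: hpar_def field_simps)

lemma norm_hpar_sq: "(norm (hpar d))\<^sup>2 = 4 * pi\<^sup>2 * d\<^sup>2 / (1 + d\<^sup>2)"
proof -
  have "(norm (1 + \<i> * of_real d))\<^sup>2 = 1 + d\<^sup>2" by (simp add: cmod_power2)
  then show ?thesis by (simp add: hpar_def norm_divide norm_mult power_divide power_mult_distrib)
qed

lemma norm_hpar_le: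
  assumes "0 < d" "d \<le> 1 / 16"
  shows "norm (hpar d) \<le> 2 * Re (hpar d)" "norm (hpar d) \<le> 1"
proof -
  have "\<bar>Im (hpar d)\<bar> = d * Re (hpar d)"
    using assms by (simp add: Re_hpar Im_hpar power2_eq_square abs_mult)
  also have "\<dots> \<le> 1 * Re (hpar d)"
    using assms Re_hpar_pos[of d] by (intro mult_right_mono) auto
  finally have "\<bar>Im (hpar d)\<bar> \<le> Re (hpar d)" by simp
  then show 1: "norm (hpar d) \<le> 2 * Re (hpar d)"
    using cmod_le[of "hpar d"] Re_hpar_pos[OF assms(1)] by linarith
  have "Re (hpar d) \<le> 2 * pi * d / 1"
    unfolding Re_hpar using assms by (intro divide_left_mono) (auto simp: add_pos_nonneg)
  also have "\<dots> \<le> 2 * 4 * (1 / 16)"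
    using assms pi_less_4 by (simp only: div_by_1) (intro mult_mono, auto)
  finally show "norm (hpar d) \<le> 1" using 1 by simp
qed

text \<open>By \<open>hpar_inverse\<close> the period \<open>2 * pi * \<i> / hpar d\<close> has real
  part \<open>- 1\<close>, so every zero of the theta function has integer real part.\<close>

lemma qtheta_hpar_nz:
  assumes "d > 0" "Re t \<notin> \<int>"
  shows "qtheta (hpar d) t \<noteq> 0"
proof
  assume "qtheta (hpar d) t = 0"
  then obtain a b :: int where "t = 1 + 2 * of_int a + of_int b * (2 * pi * \<i> / hpar d)"
    using qtheta_eq_0[OF Re_hpar_pos[OF assms(1)]] by blast
  then have "t = 1 + 2 * of_int a + of_int b * (\<i> / d - 1)"
    unfolding hpar_inverse[OF assms(1)] .
  then have "Re t = of_int (1 + 2 * a - b)" by simp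
  then show False using assms(2) by simp
qed

lemma qpoch_hpar_nz:
  assumes "d > 0" "Re t \<notin> \<int>"
  shows "qpoch_inf (exp (- hpar d * (1 + t))) (exp (- 2 * hpar d)) \<noteq> 0"
  using qtheta_hpar_nz[OF assms] by (auto simp: qtheta_def)

text \<open>At \<open>t = - \<nu> + \<i> * \<eta>\<close> the numerator, with base
  \<open>cnj q\<close>, is the conjugate of a symbol with base \<open>q\<close>; numerator and
  denominator thus form one ratio with the real exponent \<open>\<nu>\<close>. Of the prefactor only
  the quadratic term has a real part.\<close>

lemma norm_qgam:
  fixes \<nu> \<eta> :: real and h :: complex
  assumes h: "Re h > 0"
  shows "norm (qgam h (- of_real \<nu> + \<i> * of_real \<eta>)) = exp (- (norm h)\<^sup>2 * \<nu> * \<eta> / (4 * pi)) *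
    norm (qratio h (of_real \<nu>) (exp (- \<i> * h * of_real \<eta>)))"
proof -
  define t where "t = - of_real \<nu> + \<i> * of_real \<eta>"
  have q: "norm (exp (- 2 * h)) < 1" using h by simp
  have "exp (- cnj h * (1 - t)) = cnj (exp (- h * (1 + of_real \<nu>)) * exp (- \<i> * h * of_real \<eta>))"
    by (simp add: t_def exp_cnj algebra_simps flip: exp_add)
  then have num: "norm (qpoch_inf (exp (- cnj h * (1 - t))) (exp (- 2 * cnj h))) =
      norm (qpoch_inf (exp (- h * (1 + of_real \<nu>)) * exp (- \<i> * h * of_real \<eta>)) (exp (- 2 * h)))"
    using qpoch_cnj[OF q, of "exp (- h * (1 + of_real \<nu>)) * exp (- \<i> * h * of_real \<eta>)"]
    by (metis complex_cnj_minus complex_cnj_mult complex_cnj_numeral complex_mod_cnj exp_cnj)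
  have den: "exp (- h * (1 + t)) = exp (- h * (1 - of_real \<nu>)) * exp (- \<i> * h * of_real \<eta>)"
    by (simp add: t_def algebra_simps flip: exp_add)
  have "h * cnj h = of_real ((norm h)\<^sup>2)" by (rule complex_norm_square[symmetric])
  then have "- \<i> * h * cnj h * t\<^sup>2 / (8 * pi) = of_real ((norm h)\<^sup>2 / (8 * pi)) * (- \<i> * t\<^sup>2)"
    by (simp add: mult.assoc)
  then have "Re (- \<i> * h * cnj h * t\<^sup>2 / (8 * pi)) = Re (of_real ((norm h)\<^sup>2 / (8 * pi)) * (- \<i> * t\<^sup>2))"
    by (rule arg_cong)
  also have "\<dots> = (norm h)\<^sup>2 / (8 * pi) * Im (t\<^sup>2)"
    by (simp only: Re_complex_of_real Im_complex_of_real times_complex.simps) simp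
  also have "Im (t\<^sup>2) = - 2 * \<nu> * \<eta>" by (simp add: t_def power2_eq_square)
  finally have "Re (- \<i> * h * cnj h * t\<^sup>2 / (8 * pi)) = - (norm h)\<^sup>2 * \<nu> * \<eta> / (4 * pi)" by simp
  then have "Re (- \<i> * h * cnj h * t\<^sup>2 / (8 * pi) - (h - cnj h) / 24 - pi * \<i> / 12) = - (norm h)\<^sup>2 * \<nu> * \<eta> / (4 * pi)"
    by (simp del: times_divide_eq_right times_divide_eq_left)
  then show ?thesis
    unfolding qgam_def qratio_def t_def [symmetric] norm_mult norm_divide num den norm_exp_eq_Re by simp
qed

text \<open>For \<open>\<eta> \<ge> 0\<close> the point \<open>x\<close> lies in the closed unit
  disc because \<open>Im h\<close> is negative, and the uniform bound applies. For
  \<open>\<eta> < 0\<close> it would lie outside; reflection passes to \<open>- t\<close>, and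
  inverting its ratio with exponent \<open>- \<nu>\<close> restores the ratio with exponent
  \<open>\<nu>\<close>.\<close>

lemma norm_qgam_le:
  fixes \<nu> \<eta> d :: real
  defines "h \<equiv> hpar d"
  assumes C: "is_ratio_bound \<nu>1 C" and \<nu>: "0 < \<nu>" "\<nu> \<le> \<nu>1" "\<nu>1 < 1" and d: "0 < d" "d \<le> 1 / 16"
  shows "norm (qgam h (- of_real \<nu> + \<i> * of_real \<eta>)) \<le> C * exp (- (pi * d\<^sup>2 / (1 + d\<^sup>2) * \<nu> * \<bar>\<eta>\<bar>)) *
    norm (1 - exp (- 2 * h) * exp (- \<i> * h * of_real \<bar>\<eta>\<bar>)) powr (- \<nu>)"
proof -
  have h: "Re h > 0" "norm h \<le> 2 * Re h" "norm h \<le> 1"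
    using Re_hpar_pos norm_hpar_le d by (auto simp: h_def)
  define x where "x = exp (- \<i> * h * of_real \<bar>\<eta>\<bar>)"
  define R where "R = norm (qratio h (of_real \<nu>) x)"
  define L where "L = norm (1 - exp (- 2 * h) * x)"
  have x: "norm x \<le> 1"
    by (simp add: x_def h_def Im_hpar add_nonneg_nonneg divide_nonpos_nonneg mult_nonpos_nonneg)
  have "norm (exp (- 2 * h) * x) \<le> norm (exp (- 2 * h)) * 1"
    unfolding norm_mult by (intro mult_left_mono x) auto
  also have "\<dots> < 1" using h by simp
  finally have "exp (- 2 * h) * x \<noteq> 1" by (metis less_irrefl norm_one)
  then have L: "L > 0" unfolding L_def by simp
  have "R * L powr \<nu> \<le> C"
    using C h x \<nu> unfolding is_ratio_bound_def R_def L_def by auto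
  then have R: "R \<le> C * L powr (- \<nu>)"
    using L by (simp add: powr_minus divide_simps)
  have e: "(norm h)\<^sup>2 * \<nu> * e / (4 * pi) = pi * d\<^sup>2 / (1 + d\<^sup>2) * \<nu> * e" for e
    unfolding h_def norm_hpar_sq by (simp add: power2_eq_square)
  have "norm (qgam h (- of_real \<nu> + \<i> * of_real \<eta>)) = exp (- (pi * d\<^sup>2 / (1 + d\<^sup>2) * \<nu> * \<bar>\<eta>\<bar>)) * R"
  proof (cases "\<eta> \<ge> 0")
    case True
    then show ?thesis
      using norm_qgam[OF h(1), of \<nu> \<eta>] e[of \<eta>] by (simp add: R_def x_def)
  next
    case False
    define t where "t = - of_real \<nu> + \<i> * of_real \<eta>"
    have "Re t \<notin> \<int>"
    proof
      assume "Re t \<in> \<int>"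
      then obtain n where "Re t = of_int n" by (auto elim: Ints_cases)
      then have "real_of_int (- 1) < real_of_int n" "real_of_int n < real_of_int 0"
        using \<nu> by (auto simp: t_def)
      then have "- 1 < n" "n < 0" by (simp_all only: of_int_less_iff)
      then show False by simp
    qed
    then have "qgam h t * qgam h (- t) = 1"
      unfolding h_def using d by (intro qgam_reflection qtheta_hpar_nz)
    then have "norm (qgam h (- t)) * norm (qgam h t) = 1"
      by (simp only: mult.commute norm_one flip: norm_mult)
    then have "norm (qgam h t) = inverse (norm (qgam h (- t)))"
      by (rule inverse_unique[symmetric])
    also have "- t = - of_real (- \<nu>) + \<i> * of_real (- \<eta>)" by (simp add: t_def)
    also have "norm (qgam h (- of_real (- \<nu>) + \<i> * of_real (- \<eta>))) =
        exp (pi * d\<^sup>2 / (1 + d\<^sup>2) * \<nu> * \<bar>\<eta>\<bar>) * inverse R"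
    proof -
      have "- (norm h)\<^sup>2 * - \<nu> * - \<eta> / (4 * pi) = pi * d\<^sup>2 / (1 + d\<^sup>2) * \<nu> * \<bar>\<eta>\<bar>"
        using e[of "\<bar>\<eta>\<bar>"] False by simp
      moreover have "\<bar>\<eta>\<bar> = - \<eta>" using False by simp
      ultimately show ?thesis
        unfolding norm_qgam[OF h(1)] R_def x_def qratio_def by (simp add: norm_divide)
    qed
    finally show ?thesis by (simp add: t_def exp_minus)
  qed
  also have "\<dots> \<le> exp (- (pi * d\<^sup>2 / (1 + d\<^sup>2) * \<nu> * \<bar>\<eta>\<bar>)) * (C * L powr (- \<nu>))"
    by (intro mult_left_mono R) auto
  finally show ?thesis by (simp add: L_def x_def mult_ac)
qed

text \<open>With \<open>z = \<i> * (1 + d\<^sup>2) * y\<close>, the two gamma factors of the integrand have the arguments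
  \<open>d * (1 + tpar m u d y)\<close> and \<open>d * (1 + tpar m u d (- y))\<close>.\<close>

definition tpar :: "int \<Rightarrow> complex \<Rightarrow> real \<Rightarrow> real \<Rightarrow> complex" where
  "tpar m u d y = \<i> * (of_real ((1 + d\<^sup>2) * y) - of_real (sq d) * (of_int m + u * of_real d)) / of_real d"

definition gprod :: "int \<Rightarrow> complex \<Rightarrow> real \<Rightarrow> real \<Rightarrow> complex" where
  "gprod m u d y = qgam (hpar d) (tpar m u d y) * qgam (hpar d) (tpar m u d (- y))"

lemma gprod_minus: "gprod m u d (- y) = gprod m u d y"
  by (simp add: gprod_def mult.commute)

lemma tpar_eq:
  assumes "d > 0"
  shows "tpar m u d y = - of_real (- sq d * Im u) +
    \<i> * of_real (((1 + d\<^sup>2) * y - sq d * (of_int m + Re u * d)) / d)"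
  using assms by (simp add: tpar_def complex_eq_iff field_simps)

lemma Re_tpar: "d > 0 \<Longrightarrow> Re (tpar m u d y) = sq d * Im u"
  by (simp add: tpar_eq)

text \<open>Both values of \<open>tpar\<close> have real part \<open>sq d * Im u\<close>; its
  non-integrality keeps the gamma arguments away from theta zeros, so \<open>qgam\<close> may
  replace \<open>hyp_gamma\<close>.\<close>

lemma I_integrand_eq:
  assumes d: "d > 0" and u: "sq d * Im u \<notin> \<int>"
  shows "I_integrand m k u v d (\<i> * of_real ((1 + d\<^sup>2) * y)) =
    exp (- 2 * pi * \<i> * sq d * y * (of_int k + of_real v * d)) * gprod m u d y"
proof -
  have w: "omega1 d * omega2 d = 1 + d\<^sup>2" "(omega1 d + omega2 d) / 2 = d"
    by (simp_all add: omega1_def omega2_def complex_eq_iff power2_eq_square algebra_simps)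
  have nz: "1 + (complex_of_real d)\<^sup>2 \<noteq> 0"
    using one_plus_minus_i_nonzero(3)[of d] by (simp add: power2_eq_square)
  have arg: "\<i> * of_real ((1 + d\<^sup>2) * y) + d - g_par m u d = d * (1 + tpar m u d y)"
    "- (\<i> * of_real ((1 + d\<^sup>2) * y)) + d - g_par m u d = d * (1 + tpar m u d (- y))"
    using d by (simp_all add: g_par_def sqrt_omega_def tpar_def sq_def field_simps)
  have gam: "hyp_gamma (d * (1 + tpar m u d y)) (omega1 d) (omega2 d) = qgam (hpar d) (tpar m u d y)" for y
    using u Re_tpar[OF d] by (intro hyp_gamma_eq_qgam d qpoch_hpar_nz) auto
  have "2 * of_real pi * \<i> / (omega1 d * omega2 d) * lambda_par k v d * (\<i> * of_real ((1 + d\<^sup>2) * y)) =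
    - 2 * pi * \<i> * sq d * y * (of_int k + of_real v * d)"
    unfolding w lambda_par_def sqrt_omega_def sq_def using nz by simp
  then show ?thesis
    unfolding I_integrand_def Let_def w arg gam gprod_def by (simp add: mult.assoc)
qed

lemma continuous_on_gprod:
  assumes d: "d > 0" and u: "sq d * Im u \<notin> \<int>"
  shows "continuous_on UNIV (gprod m u d)"
proof -
  have t: "continuous_on UNIV (\<lambda>y. tpar m u d (c * y))" for c
    unfolding tpar_def using d by (intro continuous_intros) auto
  have "continuous_on UNIV (\<lambda>y. qgam (hpar d) (tpar m u d (c * y)))" for c
    unfolding qgam_def using d Re_hpar_pos[OF d] u Re_tpar[OF d]
    by (intro continuous_intros t qpoch_hpar_nz ballI) auto
  from this[of 1] this[of "- 1"] show ?thesis
    unfolding gprod_def [abs_def] by (intro continuous_on_mult) auto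
qed

section \<open>Pointwise limit of the integrand\<close>

text \<open>The shift \<open>g_par m u d / d\<close> diverges as \<open>d\<close> tends to 0 if
  \<open>m \<noteq> 0\<close>. Subtracting \<open>m * (\<i> / d - 1)\<close>, which is
  \<open>m\<close> times the period \<open>2 * pi * \<i> / hpar d\<close>, leaves this expression,
  with limit \<open>m + \<i> * u\<close>.\<close>

definition apar :: "int \<Rightarrow> complex \<Rightarrow> real \<Rightarrow> complex" where
  "apar m u d = of_int m + \<i> * of_int m * of_real ((sq d - 1) / d) + \<i> * of_real (sq d) * u"

text \<open>Reflection turns the product into \<open>qgam h (\<zeta> - \<gamma> u) / qgam h (\<zeta>
  + \<gamma> u)\<close>. The symbols with base \<open>q\<close> form the ratio for \<open>u\<close>.
  Those with the conjugate base form the conjugate of the inverse ratio for \<open>cnj u\<close>,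
  since \<open>cnj \<zeta> = - \<zeta>\<close> and
  \<open>cnj (\<gamma> u) = - \<gamma> (cnj u)\<close>. Only the cross term of the Gaussians
  survives and gives the phase.\<close>

lemma gprod_eq:
  assumes d: "d > 0" and u: "sq d * Im u \<notin> \<int>"
  defines "x y \<equiv> exp (- (2 * of_real pi * (of_real d + \<i>) * of_real y))"
  shows "gprod m u d y = exp (- 2 * pi * \<i> * sq d * y * (of_int m + u * d)) * qratio (hpar d) (apar m u d) (x y) *
    cnj (inverse (qratio (hpar d) (apar m (cnj u) d) (x y)))"
proof -
  define h s where "h = hpar d" and "s = complex_of_real (sq d)"
  define \<zeta> where "\<zeta> = \<i> * of_real ((1 + d\<^sup>2) * y) / of_real d"
  define \<gamma> where "\<gamma> u = \<i> * s * (of_int m + u * of_real d) / of_real d" for u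
  have d0: "complex_of_real d \<noteq> 0" using d by simp
  have h: "Re h > 0" using Re_hpar_pos[OF d] by (simp add: h_def)
  have q: "norm (exp (- 2 * h)) < 1" using h by simp
  have hz: "h * \<zeta> = 2 * of_real pi * (of_real d + \<i>) * of_real y"
  proof -
    have "1 + (complex_of_real d)\<^sup>2 = (1 + \<i> * d) * (1 - \<i> * d)" by (simp add: algebra_simps power2_eq_square)
    then have "\<zeta> = \<i> * ((1 + \<i> * d) * (1 - \<i> * d) * y) / d" by (simp add: \<zeta>_def)
    then show ?thesis using one_plus_minus_i_nonzero(1)[of d] d0
      by (simp add: h_def hpar_def) (simp add: algebra_simps)
  qed
  have hg: "h * \<gamma> u = h * apar m u d + (2 * of_int m * pi) * \<i>" for u
  proof -
    have "\<gamma> u - apar m u d = of_int m * (\<i> / d - 1)"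
      using d0 by (simp add: \<gamma>_def apar_def s_def field_simps)
    also have "\<dots> = of_int m * (2 * pi * \<i> / h)" unfolding h_def hpar_inverse[OF d] ..
    finally have "h * (\<gamma> u - apar m u d) = h * (of_int m * (2 * pi * \<i> / h))" by (rule arg_cong)
    also have "\<dots> = (2 * of_int m * pi) * \<i>" using h by auto
    finally show ?thesis by (simp add: algebra_simps)
  qed
  have per: "exp ((2 * of_int m * pi) * \<i>) = 1" by (rule exp_integer_2pi) simp
  have e1: "exp (- h * (1 + \<zeta> + \<gamma> u)) = exp (- h * (1 + apar m u d)) * x y"
    and e2: "exp (- h * (1 + \<zeta> - \<gamma> u)) = exp (- h * (1 - apar m u d)) * x y" for u
  proof -
    have "- h * (1 + \<zeta> + \<gamma> u) = - h - h * \<zeta> - h * \<gamma> u" "- h * (1 + \<zeta> - \<gamma> u) = - h - h * \<zeta> + h * \<gamma> u"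
      by (simp_all add: algebra_simps)
    then have *: "- h * (1 + \<zeta> + \<gamma> u) = - h * (1 + apar m u d) + (- (h * \<zeta>)) - (2 * of_int m * pi) * \<i>"
      "- h * (1 + \<zeta> - \<gamma> u) = - h * (1 - apar m u d) + (- (h * \<zeta>)) + (2 * of_int m * pi) * \<i>"
      unfolding hg by (simp_all add: algebra_simps)
    show "exp (- h * (1 + \<zeta> + \<gamma> u)) = exp (- h * (1 + apar m u d)) * x y"
      unfolding *(1) exp_diff exp_add per by (simp add: x_def hz)
    show "exp (- h * (1 + \<zeta> - \<gamma> u)) = exp (- h * (1 - apar m u d)) * x y"
      unfolding *(2) exp_add per by (simp add: x_def hz)
  qed
  have cz: "cnj \<zeta> = - \<zeta>" "cnj (\<gamma> u) = - \<gamma> (cnj u)" for u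
    by (simp_all add: \<zeta>_def \<gamma>_def s_def)
  have c1: "exp (- cnj h * (1 - (\<zeta> - \<gamma> u))) = cnj (exp (- h * (1 - apar m (cnj u) d)) * x y)"
    and c2: "exp (- cnj h * (1 - (\<zeta> + \<gamma> u))) = cnj (exp (- h * (1 + apar m (cnj u) d)) * x y)"
  proof -
    have "- cnj h * (1 - (\<zeta> - \<gamma> u)) = cnj (- h * (1 + \<zeta> - \<gamma> (cnj u)))"
      "- cnj h * (1 - (\<zeta> + \<gamma> u)) = cnj (- h * (1 + \<zeta> + \<gamma> (cnj u)))"
      by (simp_all add: cz)
    then show "exp (- cnj h * (1 - (\<zeta> - \<gamma> u))) = cnj (exp (- h * (1 - apar m (cnj u) d)) * x y)"
      "exp (- cnj h * (1 - (\<zeta> + \<gamma> u))) = cnj (exp (- h * (1 + apar m (cnj u) d)) * x y)"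
      unfolding e1[symmetric] e2[symmetric] exp_cnj by (simp_all only:)
  qed
  have qc: "exp (- 2 * cnj h) = cnj (exp (- 2 * h))" by (simp add: exp_cnj)
  have t: "tpar m u d y = \<zeta> - \<gamma> u" "tpar m u d (- y) = - (\<zeta> + \<gamma> u)"
    using d0 by (simp_all add: tpar_def \<zeta>_def \<gamma>_def s_def field_simps)
  have "Re (\<zeta> + \<gamma> u) \<notin> \<int>"
    using u Re_tpar[OF d, of m u "- y"] minus_in_Ints_iff unfolding t by (metis uminus_complex.sel(1))
  then have refl: "qgam h (\<zeta> + \<gamma> u) * qgam h (- (\<zeta> + \<gamma> u)) = 1"
    unfolding h_def by (intro qgam_reflection qtheta_hpar_nz d)
  then have "qgam h (- (\<zeta> + \<gamma> u)) = inverse (qgam h (\<zeta> + \<gamma> u))"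
    by (metis inverse_unique)
  then have "gprod m u d y = qgam h (\<zeta> - \<gamma> u) / qgam h (\<zeta> + \<gamma> u)"
    unfolding gprod_def t h_def [symmetric] by (simp add: divide_inverse)
  moreover have quot: "qgam h (\<zeta> - \<gamma> u) / qgam h (\<zeta> + \<gamma> u) = exp (EA - EB) * qratio h (apar m u d) (x y) * cnj (inverse (qratio h (apar m (cnj u) d) (x y)))"
    if EA: "EA = - \<i> * h * cnj h * (\<zeta> - \<gamma> u)\<^sup>2 / (8 * pi) - (h - cnj h) / 24 - pi * \<i> / 12"
      and EB: "EB = - \<i> * h * cnj h * (\<zeta> + \<gamma> u)\<^sup>2 / (8 * pi) - (h - cnj h) / 24 - pi * \<i> / 12" for EA EB
  proof -
    define P where "P s w = qpoch_inf (exp (- h * (1 + s * apar m w d)) * x y) (exp (- 2 * h))" for s w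
    have "qgam h (\<zeta> - \<gamma> u) = exp EA * (cnj (P (- 1) (cnj u)) / P (- 1) u)"
      unfolding qgam_def c1 qc qpoch_cnj[OF q] EA P_def add_diff_eq e2 by simp
    moreover have "qgam h (\<zeta> + \<gamma> u) = exp EB * (cnj (P 1 (cnj u)) / P 1 u)"
      unfolding qgam_def c2 qc qpoch_cnj[OF q] EB P_def add.assoc[symmetric] e1 by simp
    moreover have "qratio h (apar m w d) (x y) = P 1 w / P (- 1) w" for w
      unfolding qratio_def P_def by simp
    ultimately show ?thesis by (simp add: divide_inverse exp_diff mult_ac)
  qed
  ultimately have "gprod m u d y = exp ((- \<i> * h * cnj h * (\<zeta> - \<gamma> u)\<^sup>2 / (8 * pi) - (h - cnj h) / 24 - pi * \<i> / 12) -
      (- \<i> * h * cnj h * (\<zeta> + \<gamma> u)\<^sup>2 / (8 * pi) - (h - cnj h) / 24 - pi * \<i> / 12)) *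
      qratio h (apar m u d) (x y) * cnj (inverse (qratio h (apar m (cnj u) d) (x y)))"
    by (simp only:)
  also have "(- \<i> * h * cnj h * (\<zeta> - \<gamma> u)\<^sup>2 / (8 * pi) - (h - cnj h) / 24 - pi * \<i> / 12) -
      (- \<i> * h * cnj h * (\<zeta> + \<gamma> u)\<^sup>2 / (8 * pi) - (h - cnj h) / 24 - pi * \<i> / 12) =
      \<i> * (h * cnj h) * (\<zeta> * \<gamma> u) / (2 * pi)"
    by (simp add: field_simps power2_eq_square)
  also have "\<dots> = - 2 * pi * \<i> * sq d * y * (of_int m + u * d)"
  proof -
    define N where "N = 1 + (complex_of_real d)\<^sup>2"
    have N: "N \<noteq> 0" using one_plus_minus_i_nonzero(3)[of d] by (simp add: N_def power2_eq_square)
    have "h * cnj h = of_real ((norm h)\<^sup>2)" by (rule complex_norm_square[symmetric])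
    also have "\<dots> = 4 * (of_real pi)\<^sup>2 * (of_real d)\<^sup>2 / N" unfolding h_def norm_hpar_sq N_def by simp
    finally have 1: "h * cnj h = 4 * (of_real pi)\<^sup>2 * (of_real d)\<^sup>2 / N" .
    define M where "M = of_int m + u * of_real d"
    have z: "\<zeta> = \<i> * (N * y) / d" "\<gamma> u = \<i> * (s * M) / d"
      by (simp_all add: \<zeta>_def \<gamma>_def N_def M_def)
    have "\<zeta> * \<gamma> u = (\<i> * \<i>) * (N * y * (s * M)) / (of_real d * of_real d)"
      unfolding z by (simp only: times_divide_times_eq mult_ac)
    then have 2: "\<zeta> * \<gamma> u = - (N * y * (s * M)) / (of_real d)\<^sup>2"
      by (simp add: power2_eq_square)
    show ?thesis unfolding 1 2 M_def [symmetric] s_def [symmetric] using N d0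
      by (simp add: field_simps power2_eq_square)
  qed
  finally show ?thesis by (simp only: h_def)
qed

lemma tendsto_sq: "(sq \<longlongrightarrow> 1) (at_right 0)"
proof -
  have "((\<lambda>d. sqrt (1 + d\<^sup>2)) \<longlongrightarrow> sqrt (1 + 0\<^sup>2)) (at_right 0)" by (intro tendsto_intros)
  then show ?thesis by (simp add: sq_def [abs_def])
qed

lemma tendsto_sq_quotient: "((\<lambda>d. (sq d - 1) / d) \<longlongrightarrow> 0) (at_right 0)"
proof (rule tendsto_sandwich[where f = "\<lambda>_. 0" and h = "\<lambda>d. d"])
  show "\<forall>\<^sub>F d in at_right 0. 0 \<le> (sq d - 1) / d"
    unfolding eventually_at_filter using sq_minus_1(2) by (intro always_eventually) auto
  show "\<forall>\<^sub>F d in at_right 0. (sq d - 1) / d \<le> d"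
    unfolding eventually_at_filter using sq_minus_1(1)
    by (intro always_eventually) (auto simp: divide_simps power2_eq_square)
qed (auto intro!: tendsto_intros)

text \<open>The integer \<open>n d\<close> grows like \<open>\<alpha> / d\<close>, so the exponent
  itself diverges. Dropping the integer \<open>n d * l\<close> leaves
  \<open>(sq d - 1) * n d * l\<close>, which tends to 0 because \<open>sq d - 1\<close> is at most
  \<open>d\<^sup>2\<close>.\<close>

lemma tendsto_phase:
  fixes n :: "real \<Rightarrow> int" and \<alpha> \<beta> :: real and l :: int and c :: complex
  assumes n: "((\<lambda>d. d * of_int (n d)) \<longlongrightarrow> \<alpha>) (at_right 0)"
  shows "((\<lambda>d. exp (- 2 * pi * \<i> * sq d * (of_int (n d) + \<beta>) * (of_int l + c * d)))
    \<longlongrightarrow> exp (- 2 * pi * \<i> * (of_real \<beta> * of_int l + of_real \<alpha> * c))) (at_right 0)"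
proof -
  have d0: "((\<lambda>d. d) \<longlongrightarrow> (0::real)) (at_right 0)" by (rule tendsto_ident_at)
  have dy: "((\<lambda>d. d * (of_int (n d) + \<beta>)) \<longlongrightarrow> \<alpha>) (at_right 0)"
    using tendsto_add[OF n tendsto_mult_right[OF d0, of \<beta>]] by (simp add: algebra_simps)
  define f where "f d = - 2 * pi * \<i> * (of_real ((sq d - 1) / d * (d * (of_int (n d) + \<beta>))) * of_int l +
      of_real \<beta> * of_int l + of_real (sq d * (d * (of_int (n d) + \<beta>))) * c)" for d
  have "(f \<longlongrightarrow> - 2 * pi * \<i> * (of_real (0 * \<alpha>) * of_int l + of_real \<beta> * of_int l + of_real (1 * \<alpha>) * c)) (at_right 0)"
    unfolding f_def by (intro tendsto_intros tendsto_of_real tendsto_sq tendsto_sq_quotient dy)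
  then have "((\<lambda>d. exp (f d)) \<longlongrightarrow> exp (- 2 * pi * \<i> * (of_real \<beta> * of_int l + of_real \<alpha> * c))) (at_right 0)"
    by (intro tendsto_exp) simp
  then show ?thesis
  proof (rule Lim_transform_eventually)
    show "\<forall>\<^sub>F d in at_right 0. exp (f d) = exp (- 2 * pi * \<i> * sq d * (of_int (n d) + \<beta>) * (of_int l + c * d))"
      unfolding eventually_at_filter
    proof (intro always_eventually allI impI)
      fix d :: real assume "d \<noteq> 0"
      then have "- 2 * pi * \<i> * sq d * (of_int (n d) + \<beta>) * (of_int l + c * d) =
          f d - (2 * of_int (n d * l) * pi) * \<i>"
        by (simp add: f_def algebra_simps diff_divide_distrib)
      moreover have "exp ((2 * of_int (n d * l) * pi) * \<i>) = 1" by (rule exp_integer_2pi) simp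
      ultimately show "exp (f d) = exp (- 2 * pi * \<i> * sq d * (of_int (n d) + \<beta>) * (of_int l + c * d))"
        by (simp only: exp_diff div_by_1)
    qed
  qed
qed

lemma eventually_sq_Im_not_Ints:
  assumes "Im u \<in> {-1<..<0}"
  shows "\<forall>\<^sub>F d in at_right 0. sq d * Im u \<notin> \<int>"
proof -
  have "((\<lambda>d. sq d * Im u) \<longlongrightarrow> 1 * Im u) (at_right 0)" by (intro tendsto_intros tendsto_sq)
  then have "\<forall>\<^sub>F d in at_right 0. sq d * Im u \<in> {-1<..<0}"
    using assms by (intro topological_tendstoD) auto
  then show ?thesis
  proof eventually_elim
    case (elim d)
    show ?case
    proof
      assume "sq d * Im u \<in> \<int>"
      then obtain n where "sq d * Im u = of_int n" by (auto elim: Ints_cases)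
      then have "real_of_int (- 1) < real_of_int n" "real_of_int n < real_of_int 0" using elim by auto
      then have "- 1 < n" "n < 0" by (simp_all only: of_int_less_iff)
      then show False by simp
    qed
  qed
qed

text \<open>The integer \<open>n d\<close> disappears from the phase of \<open>x d\<close>, while
  \<open>d * n d\<close> fixes its modulus; hence \<open>x d\<close> tends to \<open>x0\<close>,
  inside the unit disc as \<open>\<alpha> > 0\<close>. The two ratios contribute
  \<open>exp (- (m + \<i> * u) * L)\<close> and, after inversion and conjugation,
  \<open>exp ((m - \<i> * u) * cnj L)\<close>.\<close>

lemma gprod_tendsto_pos:
  fixes n :: "real \<Rightarrow> int" and \<alpha> \<beta> :: real
  assumes u: "Im u \<in> {-1<..<0}" and \<alpha>: "\<alpha> > 0"
    and n: "((\<lambda>d. d * of_int (n d)) \<longlongrightarrow> \<alpha>) (at_right 0)"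
  shows "((\<lambda>d. gprod m u d (of_int (n d) + \<beta>)) \<longlongrightarrow>
    inverse (cpow_pair (2 * sinh (of_real pi * (of_real \<alpha> + \<i> * of_real \<beta>))) (of_int m + \<i> * u) (- of_int m + \<i> * u)))
    (at_right 0)"
proof -
  define x where "x d = exp (- (2 * of_real pi * (of_real d + \<i>) * of_real (of_int (n d) + \<beta>)))" for d
  define x0 where "x0 = exp (- (2 * of_real pi * (of_real \<alpha> + \<i> * of_real \<beta>)))"
  define L where "L = Ln (1 - x0)"
  have d0: "((\<lambda>d. d) \<longlongrightarrow> (0::real)) (at_right 0)" by (rule tendsto_ident_at)
  have pos: "\<forall>\<^sub>F d::real in at_right 0. d > 0" by (rule eventually_at_right_less)
  have lt: "\<forall>\<^sub>F d::real in at_right 0. d < 1 / 16" using d0 by (rule order_tendstoD) simp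
  have x0: "norm x0 < 1" using \<alpha> by (simp add: x0_def)
  have xlim: "(x \<longlongrightarrow> x0) (at_right 0)"
  proof -
    have dy: "((\<lambda>d. d * (of_int (n d) + \<beta>)) \<longlongrightarrow> \<alpha>) (at_right 0)"
      using tendsto_add[OF n tendsto_mult_right[OF d0, of \<beta>]] by (simp add: algebra_simps)
    have "((\<lambda>d. exp (- (2 * of_real pi * (of_real (d * (of_int (n d) + \<beta>)) + \<i> * of_real \<beta>)))) \<longlongrightarrow> x0) (at_right 0)"
      unfolding x0_def by (intro tendsto_intros tendsto_of_real dy)
    moreover have "exp (- (2 * of_real pi * (of_real (d * (of_int (n d) + \<beta>)) + \<i> * of_real \<beta>))) = x d" for d
    proof -
      have "- (2 * of_real pi * (of_real d + \<i>) * of_real (of_int (n d) + \<beta>)) =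
        - (2 * of_real pi * (of_real (d * (of_int (n d) + \<beta>)) + \<i> * of_real \<beta>)) - (2 * of_int (n d) * pi) * \<i>"
        by (simp add: algebra_simps)
      moreover have "exp ((2 * of_int (n d) * pi) * \<i>) = 1" by (rule exp_integer_2pi) simp
      ultimately show ?thesis unfolding x_def by (simp only: exp_diff div_by_1)
    qed
    ultimately show ?thesis by simp
  qed
  have hlim: "(hpar \<longlongrightarrow> 0) (at_right 0)"
  proof -
    have "((\<lambda>d. 2 * pi * of_real d / (1 + \<i> * of_real d)) \<longlongrightarrow> 2 * pi * of_real 0 / (1 + \<i> * of_real 0)) (at_right 0)"
      by (intro tendsto_intros tendsto_of_real d0) auto
    then show ?thesis by (simp add: hpar_def [abs_def])
  qed
  have hb: "\<forall>\<^sub>F d in at_right 0. Re (hpar d) > 0 \<and> norm (hpar d) \<le> 2 * Re (hpar d)"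
    using pos lt by eventually_elim (auto intro: norm_hpar_le Re_hpar_pos)
  have alim: "((\<lambda>d. apar m w d) \<longlongrightarrow> of_int m + \<i> * w) (at_right 0)" for w
  proof -
    have "((\<lambda>d. apar m w d) \<longlongrightarrow> of_int m + \<i> * of_int m * of_real 0 + \<i> * of_real 1 * w) (at_right 0)"
      unfolding apar_def by (intro tendsto_intros tendsto_of_real tendsto_sq tendsto_sq_quotient)
    then show ?thesis by simp
  qed
  have rlim: "((\<lambda>d. qratio (hpar d) (apar m w d) (x d)) \<longlongrightarrow> exp (- (of_int m + \<i> * w) * L)) (at_right 0)" for w
    unfolding L_def by (rule tendsto_qratio[OF hlim hb alim xlim x0])
  have "((\<lambda>d. exp (- 2 * pi * \<i> * sq d * (of_int (n d) + \<beta>) * (of_int m + u * d)) *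
      qratio (hpar d) (apar m u d) (x d) * cnj (inverse (qratio (hpar d) (apar m (cnj u) d) (x d)))) \<longlongrightarrow>
      exp (- 2 * pi * \<i> * (of_real \<beta> * of_int m + of_real \<alpha> * u)) * exp (- (of_int m + \<i> * u) * L) *
      cnj (inverse (exp (- (of_int m + \<i> * cnj u) * L)))) (at_right 0)"
    by (intro tendsto_mult tendsto_cnj tendsto_inverse rlim tendsto_phase n) auto
  also have "exp (- 2 * pi * \<i> * (of_real \<beta> * of_int m + of_real \<alpha> * u)) * exp (- (of_int m + \<i> * u) * L) *
      cnj (inverse (exp (- (of_int m + \<i> * cnj u) * L))) =
      inverse (cpow_pair (2 * sinh (of_real pi * (of_real \<alpha> + \<i> * of_real \<beta>))) (of_int m + \<i> * u) (- of_int m + \<i> * u))"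
  proof -
    have "inverse (cpow_pair (2 * sinh (of_real pi * (of_real \<alpha> + \<i> * of_real \<beta>))) (of_int m + \<i> * u) (- of_int m + \<i> * u)) =
        inverse (exp (2 * pi * \<i> * (of_real \<beta> * of_int m + of_real \<alpha> * u))) * inverse (exp ((of_int m + \<i> * u) * L)) *
        inverse (exp (- (of_int m - \<i> * u) * cnj L))"
      unfolding cpow_pair_sinh[OF \<alpha>] L_def x0_def by (simp only: inverse_mult_distrib)
    also have "inverse (exp (2 * pi * \<i> * (of_real \<beta> * of_int m + of_real \<alpha> * u))) = exp (- 2 * pi * \<i> * (of_real \<beta> * of_int m + of_real \<alpha> * u))"
      by (simp flip: exp_minus)
    also have "inverse (exp ((of_int m + \<i> * u) * L)) = exp (- (of_int m + \<i> * u) * L)"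
      by (simp only: exp_minus[symmetric] mult_minus_left)
    also have "inverse (exp (- (of_int m - \<i> * u) * cnj L)) = cnj (inverse (exp (- (of_int m + \<i> * cnj u) * L)))"
      by (simp only: exp_minus[symmetric] exp_cnj) simp
    finally show ?thesis ..
  qed
  finally show ?thesis
  proof (rule Lim_transform_eventually)
    show "\<forall>\<^sub>F d in at_right 0. exp (- 2 * pi * \<i> * sq d * (of_int (n d) + \<beta>) * (of_int m + u * d)) *
      qratio (hpar d) (apar m u d) (x d) * cnj (inverse (qratio (hpar d) (apar m (cnj u) d) (x d))) =
      gprod m u d (of_int (n d) + \<beta>)"
      using pos eventually_sq_Im_not_Ints[OF u]
    proof eventually_elim
      case (elim d)
      show ?case
        using gprod_eq[OF elim, of m "of_int (n d) + \<beta>"] by (simp only: x_def of_real_add of_real_of_int_eq)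
    qed
  qed
qed

lemma gprod_tendsto:
  fixes n :: "real \<Rightarrow> int" and \<alpha> \<beta> :: real
  assumes u: "Im u \<in> {-1<..<0}" and \<alpha>: "\<alpha> \<noteq> 0"
    and n: "((\<lambda>d. d * of_int (n d)) \<longlongrightarrow> \<alpha>) (at_right 0)"
  shows "((\<lambda>d. gprod m u d (of_int (n d) + \<beta>)) \<longlongrightarrow>
    inverse (cpow_pair (2 * sinh (of_real pi * (of_real \<alpha> + \<i> * of_real \<beta>))) (of_int m + \<i> * u) (- of_int m + \<i> * u)))
    (at_right 0)"
proof (cases "\<alpha> > 0")
  case True
  then show ?thesis using gprod_tendsto_pos[OF u _ n] by blast
next
  case False
  have "((\<lambda>d. d * of_int (- n d)) \<longlongrightarrow> - \<alpha>) (at_right 0)" using tendsto_minus[OF n] by simp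
  from gprod_tendsto_pos[OF u _ this, of m "- \<beta>"] False \<alpha>
  have "((\<lambda>d. gprod m u d (- (of_int (n d) + \<beta>))) \<longlongrightarrow>
    inverse (cpow_pair (2 * sinh (of_real pi * (of_real (- \<alpha>) + \<i> * of_real (- \<beta>)))) (of_int m + \<i> * u) (- of_int m + \<i> * u)))
    (at_right 0)" by (simp add: algebra_simps)
  moreover have "2 * sinh (of_real pi * (of_real (- \<alpha>) + \<i> * of_real (- \<beta>))) =
      - (2 * sinh (of_real pi * (of_real \<alpha> + \<i> * complex_of_real \<beta>)))"
  proof -
    have "of_real pi * (of_real (- \<alpha>) + \<i> * of_real (- \<beta>)) = - (of_real pi * (of_real \<alpha> + \<i> * complex_of_real \<beta>))"
      by (simp add: algebra_simps)
    then show ?thesis by (simp only: sinh_minus mult_minus_right)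
  qed
  moreover have nz: "2 * sinh (of_real pi * (of_real \<alpha> + \<i> * complex_of_real \<beta>)) \<noteq> 0"
    using sinh_pi_nonzero[OF \<alpha>] by simp
  ultimately show ?thesis by (simp only: cpow_pair_minus[OF nz] gprod_minus)
qed

section \<open>Domination of the integrand\<close>

text \<open>The Taylor remainder is at most \<open>2 / 3 * \<bar>x\<bar>\<close> in this range. At
  \<open>x = pi * \<beta>\<close> with \<open>\<bar>\<beta>\<bar> \<le> 1 / 2\<close> the constant
  is good enough for \<open>\<bar>\<beta>\<bar> \<le> \<bar>sin (pi * \<beta>)\<bar>\<close>, as
  \<open>pi > 3\<close>.\<close>

lemma abs_sin_ge:
  fixes x :: real
  assumes "\<bar>x\<bar> \<le> 2"
  shows "\<bar>x\<bar> / 3 \<le> \<bar>sin x\<bar>"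
proof -
  have "\<bar>sin x - (\<Sum>m<3. sin_coeff m * x ^ m)\<bar> \<le> inverse (fact 3) * \<bar>x\<bar> ^ 3"
    by (rule Maclaurin_sin_bound)
  moreover have "(\<Sum>m<3. sin_coeff m * x ^ m) = x"
    by (simp add: sin_coeff_def eval_nat_numeral)
  moreover have "inverse (fact 3) * \<bar>x\<bar> ^ 3 \<le> 2 / 3 * \<bar>x\<bar>"
  proof -
    have "\<bar>x\<bar>\<^sup>2 \<le> 2\<^sup>2" using assms by (intro power_mono) auto
    then have "\<bar>x\<bar>\<^sup>2 * \<bar>x\<bar> \<le> 4 * \<bar>x\<bar>" by (intro mult_right_mono) auto
    then show ?thesis by (simp add: fact_numeral power2_eq_square power3_eq_cube)
  qed
  ultimately have "\<bar>sin x - x\<bar> \<le> 2 / 3 * \<bar>x\<bar>" by simp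
  then show ?thesis by linarith
qed

text \<open>With \<open>r = exp (Re z)\<close> and \<open>S = (sin (Im z / 2))\<^sup>2\<close> the
  squared norm is the convex combination
  \<open>(1 - r)\<^sup>2 * (1 - S) + (1 + r)\<^sup>2 * S\<close>. The phase bound will control
  \<open>\<beta>\<close>, the modulus bound \<open>\<alpha>\<close>.\<close>

lemma norm_1_minus_exp_ge:
  fixes z :: complex
  assumes "Re z \<le> 0"
  shows "\<bar>sin (Im z / 2)\<bar> \<le> norm (1 - exp z)" "1 - exp (Re z) \<le> norm (1 - exp z)"
proof -
  define r S where "r = exp (Re z)" and "S = (sin (Im z / 2))\<^sup>2"
  have r: "0 \<le> r" by (simp add: r_def)
  have S: "0 \<le> S" "S \<le> 1" by (auto simp: S_def abs_square_le_1)
  have cos: "cos (Im z) = 1 - 2 * S"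
    using cos_double_sin[of "Im z / 2"] by (simp add: S_def)
  have "(norm (1 - exp z))\<^sup>2 = (1 - r * cos (Im z))\<^sup>2 + (r * sin (Im z))\<^sup>2"
    by (simp add: cmod_power2 Re_exp Im_exp r_def)
  also have "\<dots> = 1 - 2 * r * cos (Im z) + r\<^sup>2 * ((cos (Im z))\<^sup>2 + (sin (Im z))\<^sup>2)"
  proof -
    have "(1 - r * a)\<^sup>2 + (r * b)\<^sup>2 = 1 - 2 * r * a + r\<^sup>2 * (a\<^sup>2 + b\<^sup>2)" for a b
      by (simp add: power2_eq_square algebra_simps)
    then show ?thesis .
  qed
  also have "\<dots> = (1 - r)\<^sup>2 * (1 - S) + (1 + r)\<^sup>2 * S"
    unfolding sin_cos_squared_add2 unfolding cos by (simp add: power2_eq_square algebra_simps)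
  also have "\<dots> \<ge> 0 + 1 * S"
  proof (intro add_mono mult_right_mono)
    show "1 \<le> (1 + r)\<^sup>2" using r by (simp add: power2_eq_square algebra_simps)
  qed (use S in auto)
  finally have "(sin (Im z / 2))\<^sup>2 \<le> (norm (1 - exp z))\<^sup>2" by (simp add: S_def)
  then show "\<bar>sin (Im z / 2)\<bar> \<le> norm (1 - exp z)"
    by (metis abs_le_square_iff abs_norm_cancel)
  show "1 - exp (Re z) \<le> norm (1 - exp z)"
    using norm_triangle_ineq2[of 1 "exp z"] by simp
qed

lemma one_minus_exp_ge:
  fixes a :: real
  assumes "a \<ge> 0"
  shows "min 1 a / 2 \<le> 1 - exp (- a)"
proof -
  have "1 + a \<le> exp a" by (rule exp_ge_add_one_self)
  then have "exp (- a) \<le> 1 / (1 + a)" using assms by (simp add: exp_minus field_simps)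
  also have "\<dots> \<le> 1 - min 1 a / 2"
  proof (cases "a \<le> 1")
    case True
    then have "a * a \<le> 1 * a" using assms by (intro mult_right_mono) auto
    then show ?thesis using assms True by (simp add: divide_simps) (simp add: algebra_simps)
  next
    case False
    then show ?thesis by (simp add: divide_simps)
  qed
  finally have "exp (- a) \<le> 1 - min 1 a / 2" .
  then show ?thesis by (simp only: le_diff_eq diff_le_eq add.commute)
qed

text \<open>\<open>L = norm (1 - q * x)\<close> is bounded below through its modulus by
  \<open>\<alpha>\<close> and through its phase by \<open>\<beta>\<close>; half of the power
  \<open>L powr (- \<nu>)\<close> is spent on each. The sign \<open>e\<close> serves the two gamma
  factors, at \<open>y\<close> and \<open>- y\<close>. \<open>K\<close> bounds the offset
  \<open>b\<close>, and \<open>K + 2\<close> in the exponential absorbs this offset and the rounding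
  of \<open>\<alpha> / d\<close>.\<close>

lemma qgam_tpar_bound:
  fixes \<nu>1 C :: real and u :: complex and m :: int
  defines "K \<equiv> \<bar>of_int m\<bar> + \<bar>Re u\<bar>"
  defines "c \<equiv> 1 / (8 * K + 17)"
  assumes C: "is_ratio_bound \<nu>1 C" "C \<ge> 0" and u: "Im u < 0" "sq d * - Im u \<le> \<nu>1" "\<nu>1 < 1"
    and d: "0 < d" "d \<le> 1 / 16" and y: "y = e * (of_int \<lfloor>\<alpha> / d\<rfloor> + \<beta>)" "e = 1 \<or> e = - 1"
    and \<alpha>: "\<alpha> \<noteq> 0" and \<beta>: "\<beta> \<noteq> 0" "\<bar>\<beta>\<bar> \<le> 1 / 2"
  shows "norm (qgam (hpar d) (tpar m u d y)) \<le> C * exp (- Im u * (K + 2)) * exp (Im u * \<bar>\<alpha>\<bar>) *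
    ((c * min 1 \<bar>\<alpha>\<bar>) powr (- \<nu>1 / 2) * (c * \<bar>\<beta>\<bar>) powr (- \<nu>1 / 2))"
proof -
  define s where "s = sq d"
  have s: "s \<ge> 1" "s\<^sup>2 = 1 + d\<^sup>2" "s - 1 \<le> d\<^sup>2"
    using sq_ge_1 sq_square sq_minus_1(1) d by (auto simp: s_def)
  have d2: "d\<^sup>2 \<le> d" using d by (simp add: power2_eq_square mult_left_le)
  have d3: "1 + d\<^sup>2 \<le> 2" "0 < 1 + d\<^sup>2" using d2 d by (auto simp: add_pos_nonneg)
  have K: "K \<ge> 0" by (simp add: K_def)
  have c: "0 < c" "c \<le> 1" using K by (auto simp: c_def)
  define \<nu> where "\<nu> = s * - Im u"
  have \<nu>: "0 < \<nu>" "\<nu> \<le> \<nu>1" "- Im u \<le> \<nu>"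
    using u s mult_right_mono[of 1 s "- Im u"] mult_pos_pos[of s "- Im u"] by (auto simp: \<nu>_def s_def)
  \<comment> \<open>The value of \<open>y\<close> at which \<open>\<eta>\<close> vanishes; it lies
    within \<open>K * d\<close> of the integer \<open>m\<close>.\<close>
  define b where "b = (of_int m + Re u * d) / s"
  define Y where "Y = \<bar>y - b\<bar>"
  define \<eta> where "\<eta> = ((1 + d\<^sup>2) * y - s * (of_int m + Re u * d)) / d"
  have \<eta>: "\<bar>\<eta>\<bar> = (1 + d\<^sup>2) * Y / d"
  proof -
    have "(1 + d\<^sup>2) * b = s * (of_int m + Re u * d)"
      unfolding b_def s(2)[symmetric] using s(1) by (simp add: power2_eq_square)
    then have "\<eta> = (1 + d\<^sup>2) * (y - b) / d"
      by (simp only: \<eta>_def right_diff_distrib)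
    then show ?thesis using d d3 by (simp add: Y_def abs_mult)
  qed
  have t: "tpar m u d y = - of_real \<nu> + \<i> * of_real \<eta>"
    using tpar_eq[OF d(1), of m u y] by (simp add: \<nu>_def \<eta>_def s_def)
  define h where "h = hpar d"
  define z where "z = - 2 * h + - \<i> * h * of_real \<bar>\<eta>\<bar>"
  define L where "L = norm (1 - exp z)"
  define N where "N = 1 + d\<^sup>2"
  have N: "N \<noteq> 0" using d3 by (simp add: N_def)
  have hN: "Re h = 2 * pi * d / N" "Im h = - 2 * pi * d\<^sup>2 / N" "\<bar>\<eta>\<bar> = N * Y / d"
    using \<eta> by (simp_all add: h_def Re_hpar Im_hpar N_def)
  have prod: "Im h * \<bar>\<eta>\<bar> = - 2 * pi * (d * Y)" "Re h * \<bar>\<eta>\<bar> = 2 * pi * Y"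
    unfolding hN using N d by (simp_all add: power2_eq_square)
  have "Re z = - 2 * Re h + Im h * \<bar>\<eta>\<bar>" by (simp add: z_def)
  then have Rez: "Re z = - (2 * pi * (2 * d / (1 + d\<^sup>2) + d * Y))"
    unfolding prod hN(1) N_def by (simp add: algebra_simps)
  have "Im z / 2 = - Im h - Re h * \<bar>\<eta>\<bar> / 2" by (simp add: z_def)
  then have Imz: "Im z / 2 = 2 * pi * d\<^sup>2 / (1 + d\<^sup>2) - pi * Y"
    unfolding prod hN(2) N_def by simp
  have Y0: "Y \<ge> 0" by (simp add: Y_def)
  have Rez0: "Re z \<le> 0" unfolding Rez using d Y0 d3 by simp
  have bK: "\<bar>b\<bar> \<le> K"
  proof -
    have "\<bar>Re u * d\<bar> \<le> \<bar>Re u\<bar> * 1" unfolding abs_mult using d by (intro mult_left_mono) auto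
    then have "\<bar>of_int m + Re u * d\<bar> \<le> K" unfolding K_def by linarith
    moreover have "\<bar>b\<bar> \<le> \<bar>of_int m + Re u * d\<bar> / 1"
      unfolding b_def abs_divide using s by (intro divide_left_mono) auto
    ultimately show ?thesis by simp
  qed
  have dY: "d * Y \<ge> \<bar>\<alpha>\<bar> - d * (3 / 2 + K)"
  proof -
    have "\<bar>of_int \<lfloor>\<alpha> / d\<rfloor> - \<alpha> / d\<bar> \<le> 1" by linarith
    then have "\<bar>\<alpha> / d\<bar> - 3 / 2 \<le> \<bar>of_int \<lfloor>\<alpha> / d\<rfloor> + \<beta>\<bar>" using \<beta> by linarith
    also have "\<dots> = \<bar>y\<bar>" using y by (auto simp: abs_mult)
    also have "\<dots> \<le> Y + K" unfolding Y_def using bK by linarith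
    finally have "d * (\<bar>\<alpha> / d\<bar> - 3 / 2) \<le> d * (Y + K)" using d by (intro mult_left_mono) auto
    then show ?thesis using d by (simp add: algebra_simps abs_divide)
  qed
  \<comment> \<open>A lower bound for \<open>- Re z\<close> that dominates \<open>d\<close> and, up
    to the factor \<open>K + 5 / 2\<close>, also \<open>\<bar>\<alpha>\<bar>\<close>. The former
    yields \<open>d / 2 \<le> L\<close>, by which errors of order \<open>d\<close> are absorbed
    later.\<close>
  define a where "a = d + d * Y"
  have a: "a \<ge> d" using d Y0 by (simp add: a_def)
  have aRe: "a \<le> - Re z"
  proof -
    have "d * 1 \<le> d * (2 / (1 + d\<^sup>2))" using d3 d by (intro mult_left_mono) (auto simp: field_simps)
    then have "a \<le> 1 * (2 * d / (1 + d\<^sup>2) + d * Y)" by (simp add: a_def mult.commute)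
    also have "\<dots> \<le> 2 * pi * (2 * d / (1 + d\<^sup>2) + d * Y)"
      using pi_gt3 d Y0 d3 by (intro mult_right_mono) auto
    finally show ?thesis by (simp add: Rez)
  qed
  have "min 1 a / 2 \<le> 1 - exp (- a)" using a d by (intro one_minus_exp_ge) auto
  also have "\<dots> \<le> 1 - exp (Re z)" using aRe by simp
  also have "\<dots> \<le> L" unfolding L_def by (rule norm_1_minus_exp_ge[OF Rez0])
  finally have La: "min 1 a / 2 \<le> L" .
  have "d \<le> min 1 a" using a d by simp
  then have Ld: "d / 2 \<le> L" using La by linarith
  have cL: "c * ((8 * K + 17) * L) = L"
  proof -
    have "8 * K + 17 \<noteq> 0" using K by linarith
    then show ?thesis by (simp add: c_def)
  qed
  have L\<alpha>: "c * min 1 \<bar>\<alpha>\<bar> \<le> L"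
  proof -
    have "d * K \<le> a * K" using a K by (rule mult_right_mono)
    moreover have "\<bar>\<alpha>\<bar> \<le> d * Y + 3 / 2 * d + d * K" using dY by (simp add: algebra_simps)
    moreover have "(K + 5 / 2) * a = a * K + 5 / 2 * a" by (simp add: algebra_simps)
    ultimately have "\<bar>\<alpha>\<bar> \<le> (K + 5 / 2) * a"
      using a a_def d(1) by linarith
    then have "min 1 \<bar>\<alpha>\<bar> \<le> (K + 5 / 2) * min 1 a"
    proof (cases "a \<le> 1")
      case False
      then show ?thesis using K by simp
    qed simp
    also have "\<dots> \<le> (K + 5 / 2) * (2 * L)" using La K by (intro mult_left_mono) auto
    also have "\<dots> \<le> (8 * K + 17) * L"
    proof -
      have "0 \<le> L" using Ld d by linarith
      then have "0 \<le> K * L" using K by simp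
      moreover have "(K + 5 / 2) * (2 * L) = 2 * (K * L) + 5 * L" "(8 * K + 17) * L = 8 * (K * L) + 17 * L"
        by (simp_all add: algebra_simps)
      ultimately show ?thesis using \<open>0 \<le> L\<close> by linarith
    qed
    finally have "c * min 1 \<bar>\<alpha>\<bar> \<le> c * ((8 * K + 17) * L)" using c by (intro mult_left_mono) auto
    then show ?thesis unfolding cL .
  qed
  \<comment> \<open>As \<open>b\<close> is nearly the integer \<open>m\<close>,
    \<open>\<bar>sin (pi * \<beta>)\<bar>\<close> exceeds \<open>\<bar>sin (Im z / 2)\<bar>\<close>
    by at most \<open>4 * (K + 2) * d\<close>, hence by at most \<open>8 * (K + 2) * L\<close>.
    Together this is \<open>(8 * K + 17) * L\<close>, the origin of \<open>c\<close>.\<close>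
  have L\<beta>: "c * \<bar>\<beta>\<bar> \<le> L"
  proof -
    define \<phi> where "\<phi> = 2 * pi * d\<^sup>2 / (1 + d\<^sup>2)"
    have \<phi>: "0 \<le> \<phi>" "\<phi> \<le> 2 * pi * d"
    proof -
      have "\<phi> \<le> 2 * pi * d\<^sup>2 / 1" unfolding \<phi>_def using d d3 by (intro divide_left_mono) auto
      also have "\<dots> \<le> 2 * pi * d" using d2 by simp
      finally show "\<phi> \<le> 2 * pi * d" .
    qed (simp add: \<phi>_def add_nonneg_nonneg)
    have mb: "\<bar>of_int m - b\<bar> \<le> K * d"
    proof -
      have "of_int m - b = (of_int m * (s - 1) - Re u * d) / s" using s by (simp add: b_def field_simps)
      then have "\<bar>of_int m - b\<bar> \<le> \<bar>of_int m * (s - 1) - Re u * d\<bar> / 1"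
        using s by (simp only: abs_divide) (intro divide_left_mono, auto)
      also have "\<dots> \<le> \<bar>of_int m * (s - 1)\<bar> + \<bar>Re u * d\<bar>" by simp
      also have "\<bar>of_int m * (s - 1)\<bar> \<le> \<bar>of_int m\<bar> * d"
        unfolding abs_mult using s d2 by (intro mult_left_mono) auto
      also have "\<bar>Re u * d\<bar> = \<bar>Re u\<bar> * d" using d by (simp add: abs_mult)
      finally show ?thesis by (simp add: K_def algebra_simps)
    qed
    define e' :: real where "e' = (if y - b \<ge> 0 then 1 else - 1)"
    have e': "e' = 1 \<or> e' = - 1" "Y = e' * (y - b)" by (auto simp: e'_def Y_def)
    have se: "\<bar>sin (pi * (f * x))\<bar> = \<bar>sin (pi * x)\<bar>" if "f = 1 \<or> f = - 1" for f x :: real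
      using that by auto
    have "\<bar>sin (pi * \<beta>)\<bar> = \<bar>sin (pi * (y - of_int m))\<bar>"
    proof -
      have sp: "\<bar>sin (x + pi * of_int i)\<bar> = \<bar>sin x\<bar>" for x :: real and i :: int
      proof -
        have s0: "sin (pi * of_int i) = 0" unfolding sin_zero_iff_int2 by (intro exI[of _ i]) simp
        have "(cos (pi * of_int i))\<^sup>2 = 1" using sin_cos_squared_add[of "pi * of_int i"] s0 by simp
        then have "\<bar>cos (pi * of_int i)\<bar> = 1" by (simp only: abs_square_eq_1)
        then show ?thesis unfolding sin_add s0 by (simp add: abs_mult)
      qed
      have "\<exists>i::int. y - of_int m = e * \<beta> + of_int i"
      proof -
        have "e * of_int \<lfloor>\<alpha> / d\<rfloor> \<in> \<int>" using y(2) by auto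
        then obtain i where "e * of_int \<lfloor>\<alpha> / d\<rfloor> = of_int i" by (auto elim: Ints_cases)
        then have "y - of_int m = e * \<beta> + of_int (i - m)" using y(1) by (simp add: algebra_simps)
        then show ?thesis by blast
      qed
      then obtain i :: int where "y - of_int m = e * \<beta> + of_int i" by blast
      then have "pi * (y - of_int m) = pi * (e * \<beta>) + pi * of_int i" by (simp add: algebra_simps)
      then have "\<bar>sin (pi * (y - of_int m))\<bar> = \<bar>sin (pi * (e * \<beta>))\<bar>" by (simp only: sp)
      also have "\<dots> = \<bar>sin (pi * \<beta>)\<bar>" using y(2) by auto
      finally show ?thesis by simp
    qed
    also have "\<dots> = \<bar>sin (pi * (e' * (y - of_int m)))\<bar>" by (rule se[OF e'(1), symmetric])
    also have "\<dots> \<le> \<bar>sin (pi * Y - \<phi>)\<bar> + (pi * (K * d) + 2 * pi * d)"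
    proof -
      have lip: "\<bar>sin x\<bar> \<le> \<bar>sin w\<bar> + \<bar>x - w\<bar>" for x w :: real
      proof -
        have "sin x - sin w = 2 * sin ((x - w) / 2) * cos ((x + w) / 2)" by (rule sin_diff_sin)
        then have "\<bar>sin x - sin w\<bar> = 2 * \<bar>sin ((x - w) / 2)\<bar> * \<bar>cos ((x + w) / 2)\<bar>" by (simp add: abs_mult)
        also have "\<dots> \<le> 2 * \<bar>(x - w) / 2\<bar> * 1"
          by (intro mult_mono mult_left_mono abs_sin_x_le_abs_x) auto
        also have "\<dots> = \<bar>x - w\<bar>" by simp
        finally show ?thesis by linarith
      qed
      have "pi * (e' * (y - of_int m)) - (pi * Y - \<phi>) = \<phi> - pi * (e' * (of_int m - b))"
        unfolding e'(2) by (simp add: algebra_simps)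
      then have "\<bar>pi * (e' * (y - of_int m)) - (pi * Y - \<phi>)\<bar> \<le> \<bar>\<phi>\<bar> + \<bar>pi * (e' * (of_int m - b))\<bar>" by simp
      also have "\<bar>pi * (e' * (of_int m - b))\<bar> = pi * \<bar>of_int m - b\<bar>"
        unfolding abs_mult using e'(1) by auto
      also have "\<dots> \<le> pi * (K * d)" by (intro mult_left_mono mb) auto
      finally show ?thesis using lip[of "pi * (e' * (y - of_int m))" "pi * Y - \<phi>"] \<phi> by linarith
    qed
    also have "\<bar>sin (pi * Y - \<phi>)\<bar> = \<bar>sin (Im z / 2)\<bar>"
      unfolding Imz \<phi>_def by (metis abs_minus_cancel minus_diff_eq sin_minus)
    also have "\<dots> \<le> L" unfolding L_def by (rule norm_1_minus_exp_ge[OF Rez0])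
    also have "pi * (K * d) + 2 * pi * d = pi * ((K + 2) * d)" by (simp add: algebra_simps)
    also have "\<dots> \<le> 4 * ((K + 2) * d)" using pi_less_4 K d by (intro mult_right_mono) auto
    finally have 1: "\<bar>sin (pi * \<beta>)\<bar> \<le> L + 4 * ((K + 2) * d)" by simp
    have "pi * \<bar>\<beta>\<bar> \<le> 4 * (1 / 2)" using \<beta> pi_less_4 by (intro mult_mono) auto
    then have "\<bar>pi * \<beta>\<bar> / 3 \<le> \<bar>sin (pi * \<beta>)\<bar>" by (intro abs_sin_ge) (simp add: abs_mult)
    moreover have "3 * \<bar>\<beta>\<bar> \<le> pi * \<bar>\<beta>\<bar>" using pi_gt3 by (intro mult_right_mono) auto
    ultimately have "\<bar>\<beta>\<bar> \<le> \<bar>sin (pi * \<beta>)\<bar>" by (simp add: abs_mult)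
    then have "\<bar>\<beta>\<bar> \<le> L + 4 * ((K + 2) * d)" using 1 by linarith
    also have "(K + 2) * d \<le> (K + 2) * (2 * L)" using Ld K by (intro mult_left_mono) auto
    finally have "\<bar>\<beta>\<bar> \<le> (8 * K + 17) * L" by (simp add: algebra_simps)
    then have "c * \<bar>\<beta>\<bar> \<le> c * ((8 * K + 17) * L)" using c by (intro mult_left_mono) auto
    then show ?thesis unfolding cL .
  qed
  have p: "0 < c * min 1 \<bar>\<alpha>\<bar>" "c * min 1 \<bar>\<alpha>\<bar> \<le> 1" "0 < c * \<bar>\<beta>\<bar>" "c * \<bar>\<beta>\<bar> \<le> 1"
    using c \<alpha> \<beta> by (auto intro!: mult_le_one)
  \<comment> \<open>Enlarging the exponent from \<open>\<nu>\<close> to the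
    \<open>d\<close>-independent \<open>\<nu>1\<close> is allowed only for bases at most 1, which is
    why \<open>c \<le> 1\<close> and \<open>min 1 \<bar>\<alpha>\<bar>\<close> appear.\<close>
  have powr_bound: "L powr (- \<nu> / 2) \<le> w powr (- \<nu>1 / 2)" if w: "0 < w" "w \<le> 1" "w \<le> L" for w
  proof -
    have "L powr (- \<nu> / 2) \<le> w powr (- \<nu> / 2)" using w \<nu> by (intro powr_mono2') auto
    also have "\<dots> \<le> w powr (- \<nu>1 / 2)" using w \<nu> by (intro powr_mono') auto
    finally show ?thesis .
  qed
  have "norm (qgam h (tpar m u d y)) \<le> C * exp (- (pi * d\<^sup>2 / (1 + d\<^sup>2) * \<nu> * \<bar>\<eta>\<bar>)) *
      norm (1 - exp (- 2 * h) * exp (- \<i> * h * of_real \<bar>\<eta>\<bar>)) powr (- \<nu>)"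
    unfolding t h_def by (rule norm_qgam_le[OF C(1)]) (use \<nu> u d in auto)
  also have "exp (- 2 * h) * exp (- \<i> * h * of_real \<bar>\<eta>\<bar>) = exp z"
    unfolding z_def exp_add ..
  also have "norm (1 - exp z) powr (- \<nu>) = L powr (- \<nu> / 2) * L powr (- \<nu> / 2)"
    unfolding L_def by (simp flip: powr_add)
  also have "C * exp (- (pi * d\<^sup>2 / (1 + d\<^sup>2) * \<nu> * \<bar>\<eta>\<bar>)) * (L powr (- \<nu> / 2) * L powr (- \<nu> / 2)) \<le>
    C * (exp (- Im u * (K + 2)) * exp (Im u * \<bar>\<alpha>\<bar>)) *
    ((c * min 1 \<bar>\<alpha>\<bar>) powr (- \<nu>1 / 2) * (c * \<bar>\<beta>\<bar>) powr (- \<nu>1 / 2))"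
  proof (intro mult_mono mult_left_mono powr_bound p L\<alpha> L\<beta>)
    have "d * (3 / 2 + K) \<le> 1 * (K + 2)" using d K by (intro mult_mono) auto
    then have "\<bar>\<alpha>\<bar> - (K + 2) \<le> \<bar>\<alpha>\<bar> - d * (3 / 2 + K)" unfolding mult_1 by (rule diff_left_mono)
    also have "\<dots> \<le> d * Y" by (rule dY)
    finally have "- Im u * (\<bar>\<alpha>\<bar> - (K + 2)) \<le> - Im u * (d * Y)" using u by (intro mult_left_mono) auto
    also have "\<dots> \<le> (pi * \<nu>) * (d * Y)"
    proof (intro mult_right_mono)
      have "1 * \<nu> \<le> pi * \<nu>" using pi_gt3 \<nu> by (intro mult_right_mono) auto
      then show "- Im u \<le> pi * \<nu>" using \<nu> by linarith
    qed (use d Y0 in auto)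
    also have "\<dots> = pi * d\<^sup>2 / (1 + d\<^sup>2) * \<nu> * \<bar>\<eta>\<bar>"
      unfolding \<eta> using d3 d by (simp add: power2_eq_square)
    finally have "- (pi * d\<^sup>2 / (1 + d\<^sup>2) * \<nu> * \<bar>\<eta>\<bar>) \<le> - Im u * (K + 2) + Im u * \<bar>\<alpha>\<bar>"
      by (simp add: algebra_simps)
    then show "exp (- (pi * d\<^sup>2 / (1 + d\<^sup>2) * \<nu> * \<bar>\<eta>\<bar>)) \<le> exp (- Im u * (K + 2)) * exp (Im u * \<bar>\<alpha>\<bar>)"
      unfolding exp_add [symmetric] by simp
  qed (use C in auto)
  finally show ?thesis by (simp add: h_def mult.assoc)
qed

text \<open>Each of the two gamma factors brings the power \<open>- \<nu>1 / 2\<close> of each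
  variable, so the product has exponent \<open>- \<nu>1\<close> in both, integrable near 0. Charging
  a single variable would give \<open>- 2 * \<nu>1\<close>, which is below
  \<open>- 1\<close>.\<close>

lemma gprod_bound:
  assumes u: "Im u \<in> {-1<..<0}"
  shows "\<exists>d0 \<nu>1 B. 0 < d0 \<and> 0 < \<nu>1 \<and> \<nu>1 < 1 \<and> 0 \<le> B \<and>
    (\<forall>d \<alpha> \<beta>. 0 < d \<longrightarrow> d < d0 \<longrightarrow> \<alpha> \<noteq> 0 \<longrightarrow> \<beta> \<noteq> 0 \<longrightarrow> \<bar>\<beta>\<bar> \<le> 1 / 2 \<longrightarrow>
      norm (gprod m u d (of_int \<lfloor>\<alpha> / d\<rfloor> + \<beta>)) \<le>
        B * (exp (2 * Im u * \<bar>\<alpha>\<bar>) * min 1 \<bar>\<alpha>\<bar> powr (- \<nu>1)) * \<bar>\<beta>\<bar> powr (- \<nu>1))"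
proof -
  \<comment> \<open>Midpoint of \<open>- Im u\<close> and 1. The true exponent
    \<open>sq d * - Im u\<close> exceeds \<open>- Im u\<close> by at most \<open>d\<close>, which
    \<open>d0\<close> keeps within the gap \<open>(1 + Im u) / 2\<close>.\<close>
  define \<nu>1 where "\<nu>1 = (1 + - Im u) / 2"
  have \<nu>1: "0 < \<nu>1" "\<nu>1 < 1" using u by (auto simp: \<nu>1_def)
  define d0 where "d0 = min (1 / 16) ((1 + Im u) / 2)"
  have d0: "d0 > 0" using u by (auto simp: d0_def)
  obtain C where C: "C > 0" "is_ratio_bound \<nu>1 C"
    using qratio_bound[OF \<nu>1] by blast
  define K :: real where "K = \<bar>of_int m\<bar> + \<bar>Re u\<bar>"
  define c where "c = 1 / (8 * K + 17)"
  have c: "c > 0" by (simp add: c_def K_def add_nonneg_pos)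
  define B where "B = (C * exp (- Im u * (K + 2)) * (c powr (- \<nu>1 / 2) * c powr (- \<nu>1 / 2)))\<^sup>2"
  have "norm (gprod m u d (of_int \<lfloor>\<alpha> / d\<rfloor> + \<beta>)) \<le>
        B * (exp (2 * Im u * \<bar>\<alpha>\<bar>) * min 1 \<bar>\<alpha>\<bar> powr (- \<nu>1)) * \<bar>\<beta>\<bar> powr (- \<nu>1)"
    if d: "0 < d" "d < d0" and \<alpha>: "\<alpha> \<noteq> 0" and \<beta>: "\<beta> \<noteq> 0" "\<bar>\<beta>\<bar> \<le> 1 / 2" for d \<alpha> \<beta>
  proof -
    have "sq d * - Im u \<le> (1 + d) * - Im u" using sq_le[of d] d u by (intro mult_right_mono) auto
    also have "\<dots> \<le> - Im u + d * 1" using d u mult_left_mono[of "- Im u" 1 d] by (simp add: algebra_simps)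
    also have "\<dots> \<le> \<nu>1" using d by (auto simp: d0_def \<nu>1_def field_simps)
    finally have su: "sq d * - Im u \<le> \<nu>1" .
    define R where "R = C * exp (- Im u * (K + 2)) * exp (Im u * \<bar>\<alpha>\<bar>) *
      ((c * min 1 \<bar>\<alpha>\<bar>) powr (- \<nu>1 / 2) * (c * \<bar>\<beta>\<bar>) powr (- \<nu>1 / 2))"
    have R: "norm (qgam (hpar d) (tpar m u d y)) \<le> R"
      if "y = e * (of_int \<lfloor>\<alpha> / d\<rfloor> + \<beta>)" "e = 1 \<or> e = - 1" for y e
      unfolding R_def c_def K_def
      by (rule qgam_tpar_bound[OF C(2) _ _ su _ _ _ that \<alpha> \<beta>]) (use C u \<nu>1 d in \<open>auto simp: d0_def\<close>)
    have R0: "R \<ge> 0" unfolding R_def using C by (intro mult_nonneg_nonneg) auto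
    have "norm (gprod m u d (of_int \<lfloor>\<alpha> / d\<rfloor> + \<beta>)) \<le> R * R"
      unfolding gprod_def norm_mult
      by (intro mult_mono R[where e = 1] R[where e = "- 1"] R0) auto
    also have "R = C * exp (- Im u * (K + 2)) * (c powr (- \<nu>1 / 2) * c powr (- \<nu>1 / 2)) *
       (exp (Im u * \<bar>\<alpha>\<bar>) * (min 1 \<bar>\<alpha>\<bar> powr (- \<nu>1 / 2) * \<bar>\<beta>\<bar> powr (- \<nu>1 / 2)))"
      unfolding R_def using c by (simp add: powr_mult mult_ac)
    also have "\<dots> * \<dots> = B * (exp (Im u * \<bar>\<alpha>\<bar>) * exp (Im u * \<bar>\<alpha>\<bar>) *
       (min 1 \<bar>\<alpha>\<bar> powr (- \<nu>1 / 2) * min 1 \<bar>\<alpha>\<bar> powr (- \<nu>1 / 2)) * (\<bar>\<beta>\<bar> powr (- \<nu>1 / 2) * \<bar>\<beta>\<bar> powr (- \<nu>1 / 2)))"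
      unfolding B_def power2_eq_square by (simp only: mult_ac)
    also have "exp (Im u * \<bar>\<alpha>\<bar>) * exp (Im u * \<bar>\<alpha>\<bar>) = exp (2 * Im u * \<bar>\<alpha>\<bar>)" by (simp flip: exp_add)
    also have "min 1 \<bar>\<alpha>\<bar> powr (- \<nu>1 / 2) * min 1 \<bar>\<alpha>\<bar> powr (- \<nu>1 / 2) = min 1 \<bar>\<alpha>\<bar> powr (- \<nu>1)" by (simp flip: powr_add)
    also have "\<bar>\<beta>\<bar> powr (- \<nu>1 / 2) * \<bar>\<beta>\<bar> powr (- \<nu>1 / 2) = \<bar>\<beta>\<bar> powr (- \<nu>1)" by (simp flip: powr_add)
    finally show ?thesis by (simp only: mult.assoc)
  qed
  moreover have "B \<ge> 0" by (simp add: B_def)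
  ultimately show ?thesis using d0 \<nu>1 by blast
qed

section \<open>Integrability of the dominating function\<close>

lemma integrable_abs:
  fixes f :: "real \<Rightarrow> real"
  assumes [measurable]: "f \<in> borel_measurable borel" and f: "set_integrable lborel {0..} f"
  shows "integrable lborel (\<lambda>x. f \<bar>x\<bar>)"
proof -
  have 1: "integrable lborel (\<lambda>x. indicator {0..} x *\<^sub>R f x)" using f by (simp add: set_integrable_def)
  have 2: "integrable lborel (\<lambda>x. indicator {0..} (- x) *\<^sub>R f (- x))"
    using lborel_integrable_real_affine[OF 1, of "- 1" 0] by simp
  show ?thesis
    by (rule Bochner_Integration.integrable_bound[OF Bochner_Integration.integrable_add[OF
          integrable_norm[OF 1] integrable_norm[OF 2]]])
       (auto simp: indicator_def)
qed

lemma set_integrable_lborel_nonneg: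
  fixes f :: "real \<Rightarrow> real"
  assumes "f integrable_on S" "\<And>x. x \<in> S \<Longrightarrow> 0 \<le> f x" and [measurable]: "f \<in> borel_measurable borel" "S \<in> sets borel"
  shows "set_integrable lborel S f"
proof -
  have "f absolutely_integrable_on S" by (rule nonnegative_absolutely_integrable_1) (use assms in auto)
  then show ?thesis unfolding set_integrable_def by (subst (asm) integrable_completion) auto
qed

lemma integrable_dominating:
  fixes c \<nu> :: real
  assumes c: "c > 0" and \<nu>: "0 < \<nu>" "\<nu> < 1"
  shows "integrable (lborel \<Otimes>\<^sub>M lborel) (\<lambda>p. (exp (- c * \<bar>fst p\<bar>) * min 1 \<bar>fst p\<bar> powr (- \<nu>)) *
    (indicator {-1/2..<1/2} (snd p) * \<bar>snd p\<bar> powr (- \<nu>)))"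
proof -
  define P :: "real \<Rightarrow> real" where "P x = indicator {0..1} x * x powr (- \<nu>)" for x
  have [measurable]: "P \<in> borel_measurable borel" unfolding P_def by simp
  have "set_integrable lborel {0..1} (\<lambda>x. x powr (- \<nu>))"
    by (rule set_integrable_lborel_nonneg) (use \<nu> in \<open>auto intro!: integrable_on_powr_from_0\<close>)
  then have "set_integrable lborel {0..} P"
    unfolding set_integrable_def P_def by (rule Bochner_Integration.integrable_cong[THEN iffD1, rotated -1]) (auto simp: indicator_def)
  then have P: "integrable lborel (\<lambda>x. P \<bar>x\<bar>)" by (intro integrable_abs) auto
  have "set_integrable lborel {0..} (\<lambda>x. exp (- c * x))"
    by (rule set_integrable_lborel_nonneg) (use c integrable_on_exp_minus_to_infinity[of c 0] in auto)
  then have E: "integrable lborel (\<lambda>x. exp (- c * \<bar>x\<bar>))" by (intro integrable_abs) auto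
  have F: "integrable lborel (\<lambda>x. exp (- c * \<bar>x\<bar>) * min 1 \<bar>x\<bar> powr (- \<nu>))"
  proof (rule Bochner_Integration.integrable_bound[OF Bochner_Integration.integrable_add[OF E P]])
    show "AE x in lborel. norm (exp (- c * \<bar>x\<bar>) * min 1 \<bar>x\<bar> powr (- \<nu>)) \<le> norm (exp (- c * \<bar>x\<bar>) + P \<bar>x\<bar>)"
    proof (rule AE_I2)
      fix x :: real
      have "exp (- c * \<bar>x\<bar>) * \<bar>x\<bar> powr (- \<nu>) \<le> 1 * \<bar>x\<bar> powr (- \<nu>)" using c by (intro mult_right_mono) auto
      then show "norm (exp (- c * \<bar>x\<bar>) * min 1 \<bar>x\<bar> powr (- \<nu>)) \<le> norm (exp (- c * \<bar>x\<bar>) + P \<bar>x\<bar>)"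
        by (cases "\<bar>x\<bar> \<le> 1") (auto simp: P_def min_def intro: order_trans)
    qed
  qed simp
  have G: "integrable lborel (\<lambda>x. indicator {-1/2..<1/2} x * \<bar>x\<bar> powr (- \<nu>))"
    by (rule Bochner_Integration.integrable_bound[OF P]) (auto simp: P_def indicator_def)
  show ?thesis
  proof (rule lborel_pair.Fubini_integrable)
    show "AE x in lborel. integrable lborel (\<lambda>y. (exp (- c * \<bar>fst (x, y)\<bar>) * min 1 \<bar>fst (x, y)\<bar> powr (- \<nu>)) *
    (indicator {-1/2..<1/2} (snd (x, y)) * \<bar>snd (x, y)\<bar> powr (- \<nu>)))"
      using G by (intro AE_I2) simp
    show "integrable lborel (\<lambda>x. \<integral>y. norm ((exp (- c * \<bar>fst (x, y)\<bar>) * min 1 \<bar>fst (x, y)\<bar> powr (- \<nu>)) *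
    (indicator {-1/2..<1/2} (snd (x, y)) * \<bar>snd (x, y)\<bar> powr (- \<nu>))) \<partial>lborel)"
      using F by (simp add: abs_mult)
  qed simp
qed

section \<open>The limit of the integral\<close>

definition scaled_integrand :: "int \<Rightarrow> int \<Rightarrow> complex \<Rightarrow> real \<Rightarrow> real \<Rightarrow> real \<Rightarrow> complex" where
  "scaled_integrand m k u v d y = exp (- 2 * pi * \<i> * sq d * y * (of_int k + of_real v * d)) * gprod m u d y"

lemma norm_scaled_integrand: "norm (scaled_integrand m k u v d y) = norm (gprod m u d y)"
proof -
  have "Re (- 2 * pi * \<i> * sq d * y * (of_int k + of_real v * d)) = 0" by simp
  then show ?thesis unfolding scaled_integrand_def norm_mult norm_exp_eq_Re by simp
qed

lemma tendsto_scaled_floor: "((\<lambda>d. d * of_int \<lfloor>\<alpha> / d\<rfloor>) \<longlongrightarrow> \<alpha>) (at_right (0::real))"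
proof -
  have "((\<lambda>d. d * frac (\<alpha> / d)) \<longlongrightarrow> 0) (at_right (0::real))"
  proof (rule tendsto_sandwich[where f = "\<lambda>_. 0" and h = "\<lambda>d. d"])
    show "\<forall>\<^sub>F d in at_right 0. 0 \<le> d * frac (\<alpha> / d)"
      unfolding eventually_at_filter by (intro always_eventually) auto
    show "\<forall>\<^sub>F d in at_right 0. d * frac (\<alpha> / d) \<le> d"
      unfolding eventually_at_filter
      by (intro always_eventually) (auto simp: mult_left_le frac_lt_1 less_imp_le)
  qed (auto intro!: tendsto_intros)
  then have "((\<lambda>d. \<alpha> - d * frac (\<alpha> / d)) \<longlongrightarrow> \<alpha> - 0) (at_right 0)" by (intro tendsto_intros)
  then have "((\<lambda>d. \<alpha> - d * frac (\<alpha> / d)) \<longlongrightarrow> \<alpha>) (at_right 0)" by simp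
  then show ?thesis
  proof (rule Lim_transform_eventually)
    show "\<forall>\<^sub>F d in at_right 0. \<alpha> - d * frac (\<alpha> / d) = d * of_int \<lfloor>\<alpha> / d\<rfloor>"
      unfolding eventually_at_filter by (intro always_eventually) (auto simp: frac_def right_diff_distrib)
  qed
qed

lemma scaled_integrand_tendsto:
  assumes u: "Im u \<in> {-1<..<0}" and \<alpha>: "\<alpha> \<noteq> 0"
  shows "((\<lambda>d. scaled_integrand m k u v d (of_int \<lfloor>\<alpha> / d\<rfloor> + \<beta>)) \<longlongrightarrow> J_integrand m k u v \<alpha> \<beta>) (at_right 0)"
proof -
  have "((\<lambda>d. exp (- 2 * pi * \<i> * sq d * (of_int \<lfloor>\<alpha> / d\<rfloor> + \<beta>) * (of_int k + of_real v * d)) *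
      gprod m u d (of_int \<lfloor>\<alpha> / d\<rfloor> + \<beta>)) \<longlongrightarrow>
    exp (- 2 * pi * \<i> * (of_real \<beta> * of_int k + of_real \<alpha> * of_real v)) *
    inverse (cpow_pair (2 * sinh (of_real pi * (of_real \<alpha> + \<i> * of_real \<beta>))) (of_int m + \<i> * u) (- of_int m + \<i> * u)))
    (at_right 0)"
    by (intro tendsto_mult tendsto_phase gprod_tendsto u \<alpha> tendsto_scaled_floor)
  then show ?thesis
    by (simp add: scaled_integrand_def J_integrand_def divide_inverse add.commute)
qed

text \<open>The substitution contributes \<open>1 + d\<^sup>2 = sq d * sq d\<close> and the
  normalisation divides by \<open>sq d\<close>; the remaining factor \<open>sq d\<close> tends to
  1.\<close>

lemma imag_axis_scaled:
  assumes d: "d > 0" and u: "sq d * Im u \<notin> \<int>" and int: "integrable lborel (scaled_integrand m k u v d)"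
  shows "imag_axis_integrable (\<lambda>z. I_integrand m k u v d z / (\<i> * sqrt_omega d))"
    and "imag_axis_integral (\<lambda>z. I_integrand m k u v d z / (\<i> * sqrt_omega d)) =
      of_real (sq d) * (LINT y|lborel. scaled_integrand m k u v d y)"
proof -
  define N where "N = 1 + d\<^sup>2"
  have N: "N > 0" by (simp add: N_def add_pos_nonneg)
  have s: "sq d > 0" "sq d * sq d = N"
    using sq_ge_1[of d] sq_square[of d] by (auto simp: N_def power2_eq_square)
  define f where "f t = I_integrand m k u v d (\<i> * of_real t) / (\<i> * sqrt_omega d) * \<i>" for t
  have f: "f (0 + N * y) = inverse (of_real (sq d)) * scaled_integrand m k u v d y" for y
  proof -
    have "f (0 + N * y) = I_integrand m k u v d (\<i> * of_real (N * y)) / of_real (sq d)"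
      using s by (simp add: f_def sqrt_omega_def sq_def)
    then show ?thesis
      using I_integrand_eq[OF d u, of m k v y] by (simp add: N_def scaled_integrand_def divide_inverse)
  qed
  have "integrable lborel (\<lambda>y. f (0 + N * y))" unfolding f using int by simp
  then have "integrable lborel f" using N by (subst (asm) lborel_integrable_real_affine_iff) auto
  then show "imag_axis_integrable (\<lambda>z. I_integrand m k u v d z / (\<i> * sqrt_omega d))"
    unfolding imag_axis_integrable_def f_def .
  have "imag_axis_integral (\<lambda>z. I_integrand m k u v d z / (\<i> * sqrt_omega d)) = (LINT t|lborel. f t)"
    unfolding imag_axis_integral_def f_def ..
  also have "\<dots> = \<bar>N\<bar> *\<^sub>R (LINT y|lborel. f (0 + N * y))"
    using N by (intro lborel_integral_real_affine) auto
  also have "\<dots> = of_real N * (inverse (of_real (sq d)) * (LINT y|lborel. scaled_integrand m k u v d y))"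
    unfolding f using N by (simp add: scaleR_conv_of_real)
  also have "\<dots> = of_real (sq d) * (LINT y|lborel. scaled_integrand m k u v d y)"
    unfolding s(2)[symmetric] using s(1) by simp
  finally show "imag_axis_integral (\<lambda>z. I_integrand m k u v d z / (\<i> * sqrt_omega d)) =
      of_real (sq d) * (LINT y|lborel. scaled_integrand m k u v d y)" .
qed

text \<open>A Bochner integral of a non-integrable function is 0 by convention, so the first three
  conjuncts record that the integrals in the limit formula really converge.\<close>

theorem theorem1:
  fixes m k :: int and u :: complex and v :: real
  assumes "Im u \<in> {-1<..<0}"
  shows "(\<forall>\<^sub>F \<delta> in at 0 within {\<delta>::real. \<delta> > 0 \<and> 1 / \<delta> \<in> \<int>}.
            imag_axis_integrable (\<lambda>z. I_integrand m k u v \<delta> z / (\<i> * sqrt_omega \<delta>)))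
       \<and> (AE \<alpha> in lborel. set_integrable lborel {-1/2..1/2} (\<lambda>\<beta>. J_integrand m k u v \<alpha> \<beta>))
       \<and> integrable lborel (\<lambda>\<alpha>. LINT \<beta>:{-1/2..1/2}|lborel. J_integrand m k u v \<alpha> \<beta>)
       \<and> ((\<lambda>\<delta>. of_real \<delta> *
               imag_axis_integral (\<lambda>z. I_integrand m k u v \<delta> z / (\<i> * sqrt_omega \<delta>)))
           \<longlongrightarrow> (LINT \<alpha>|lborel. (LINT \<beta>:{-1/2..1/2}|lborel. J_integrand m k u v \<alpha> \<beta>)))
          (at 0 within {\<delta>::real. \<delta> > 0 \<and> 1 / \<delta> \<in> \<int>})"
proof -
  let ?M = "lborel \<Otimes>\<^sub>M lborel :: (real \<times> real) measure"
  let ?H = "{-1/2..<1/2} :: real set" and ?I = "{-1/2..1/2} :: real set"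
  define \<Phi> where "\<Phi> = scaled_integrand m k u v"
  obtain d0 \<nu> B where d0: "0 < d0" and \<nu>: "0 < \<nu>" "\<nu> < 1" and B: "0 \<le> B"
    and bound: "\<And>d \<alpha> \<beta>. 0 < d \<Longrightarrow> d < d0 \<Longrightarrow> \<alpha> \<noteq> 0 \<Longrightarrow> \<beta> \<noteq> 0 \<Longrightarrow> \<bar>\<beta>\<bar> \<le> 1 / 2 \<Longrightarrow>
      norm (gprod m u d (of_int \<lfloor>\<alpha> / d\<rfloor> + \<beta>)) \<le>
        B * (exp (2 * Im u * \<bar>\<alpha>\<bar>) * min 1 \<bar>\<alpha>\<bar> powr (- \<nu>)) * \<bar>\<beta>\<bar> powr (- \<nu>)"
    using gprod_bound[OF assms, of m] by blast
  define D where "D p = B * ((exp (- (- 2 * Im u) * \<bar>fst p\<bar>) * min 1 \<bar>fst p\<bar> powr (- \<nu>)) *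
    (indicator ?H (snd p) * \<bar>snd p\<bar> powr (- \<nu>)))" for p :: "real \<times> real"
  have D: "integrable ?M D"
    unfolding D_def using assms \<nu> by (intro integrable_mult_right integrable_dominating) auto
  define good where "good d \<longleftrightarrow> 0 < d \<and> d < d0 \<and> sq d * Im u \<notin> \<int>" for d
  have ev_good: "\<forall>\<^sub>F d in at_right 0. good d"
  proof -
    have "\<forall>\<^sub>F d::real in at_right 0. d < d0" using d0 tendsto_ident_at by (rule order_tendstoD(2)[rotated])
    then show ?thesis
      using eventually_at_right_less[of 0] eventually_sq_Im_not_Ints[OF assms]
      unfolding good_def by eventually_elim simp
  qed
  define F where "F d p = indicator ?H (snd p) *\<^sub>R \<Phi> d (of_int \<lfloor>fst p / d\<rfloor> + snd p)" for d and p :: "real \<times> real"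
  have meas\<Phi> [measurable]: "\<Phi> d \<in> borel_measurable borel" if "good d" for d
  proof (rule borel_measurable_continuous_onI)
    show "continuous_on UNIV (\<Phi> d)"
      unfolding \<Phi>_def scaled_integrand_def using that
      by (intro continuous_on_mult continuous_on_gprod) (auto simp: good_def intro!: continuous_intros)
  qed
  have measF: "F d \<in> borel_measurable ?M" if "good d" for d
    unfolding F_def using meas\<Phi>[OF that] by measurable
  \<comment> \<open>The pointwise limit needs \<open>\<alpha> \<noteq> 0\<close> and the bound also
    \<open>\<beta> \<noteq> 0\<close>; both exceptional lines are null sets.\<close>
  have AE0: "AE p in ?M. fst p \<noteq> 0 \<and> snd p \<noteq> 0"
  proof (rule lborel_pair.AE_pair_measure)
    show "AE x in lborel. AE y in lborel. fst (x, y) \<noteq> (0::real) \<and> snd (x, y) \<noteq> (0::real)"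
      using AE_lborel_singleton[of "0::real"] by auto
  qed measurable
  have FD: "AE p in ?M. norm (F d p) \<le> D p" if "good d" for d
    using AE0
  proof eventually_elim
    case (elim p)
    show ?case
    proof (cases "snd p \<in> ?H")
      case True
      then have "\<bar>snd p\<bar> \<le> 1 / 2" by auto
      from bound[OF _ _ _ _ this, of d "fst p"] elim that True show ?thesis
        by (simp add: F_def D_def \<Phi>_def norm_scaled_integrand good_def mult.assoc)
    qed (simp add: F_def D_def)
  qed
  have intF: "integrable ?M (F d)" if "good d" for d
  proof (rule Bochner_Integration.integrable_bound[OF D measF[OF that]])
    show "AE p in ?M. norm (F d p) \<le> norm (D p)" using FD[OF that] by eventually_elim simp
  qed
  have int\<Phi>: "integrable lborel (\<Phi> d)" and Feq: "integral\<^sup>L ?M (F d) = d *\<^sub>R (LINT y|lborel. \<Phi> d y)"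
    if "good d" for d
    using integral_floor_cell[OF meas\<Phi>[OF that], of d] intF[OF that] that
    unfolding F_def [abs_def] good_def by auto
  \<comment> \<open>A radius below which every \<open>d\<close> is good; from it a concrete sequence
    \<open>X\<close> of good parameters is built, used to express the limit function.\<close>
  define b where "b = (SOME b. b > 0 \<and> (\<forall>d. 0 < d \<and> d < b \<longrightarrow> good d))"
  have b: "b > 0" "\<And>d. 0 < d \<Longrightarrow> d < b \<Longrightarrow> good d"
  proof -
    have "\<exists>b. b > 0 \<and> (\<forall>d. 0 < d \<and> d < b \<longrightarrow> good d)"
      using ev_good by (auto simp: eventually_at_right_field)
    from someI_ex[OF this] show "b > 0" "\<And>d. 0 < d \<Longrightarrow> d < b \<Longrightarrow> good d"
      unfolding b_def by auto
  qed
  define X where "X n = b / real (n + 2)" for n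
  have X: "good (X n)" for n
  proof (rule b(2))
    show "0 < X n" using b(1) by (simp add: X_def)
    have "X n \<le> b / 2" unfolding X_def using b(1) by (intro divide_left_mono) auto
    then show "X n < b" using b(1) by simp
  qed
  have Xlim: "filterlim X (at_right 0) sequentially"
    unfolding filterlim_at
  proof
    show "X \<longlonglongrightarrow> 0"
      unfolding X_def using lim_const_over_n[of b] by (rule LIMSEQ_ignore_initial_segment)
    show "\<forall>\<^sub>F n in sequentially. X n \<in> {0<..} \<and> X n \<noteq> 0"
    proof (intro always_eventually allI)
      show "X n \<in> {0<..} \<and> X n \<noteq> 0" for n using X[of n] by (simp add: good_def)
    qed
  qed
  \<comment> \<open>As a limit of measurable functions \<open>Gt\<close> is jointly measurable, and
    it agrees with \<open>J_integrand\<close> for \<open>\<alpha> \<noteq> 0\<close>; no direct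
    measurability argument for \<open>Arg\<close> inside \<open>cpow_pair\<close> is
    required.\<close>
  define Gt where "Gt p = lim (\<lambda>n. \<Phi> (X n) (of_int \<lfloor>fst p / X n\<rfloor> + snd p))" for p :: "real \<times> real"
  have measGt [measurable]: "Gt \<in> borel_measurable ?M"
    unfolding Gt_def
  proof (rule borel_measurable_lim_metric)
    show "(\<lambda>p. \<Phi> (X n) (of_int \<lfloor>fst p / X n\<rfloor> + snd p)) \<in> borel_measurable ?M" for n
      using meas\<Phi>[OF X] by measurable
  qed
  have lim\<Phi>: "((\<lambda>d. \<Phi> d (of_int \<lfloor>\<alpha> / d\<rfloor> + \<beta>)) \<longlongrightarrow> J_integrand m k u v \<alpha> \<beta>) (at_right 0)" if "\<alpha> \<noteq> 0" for \<alpha> \<beta>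
    unfolding \<Phi>_def by (rule scaled_integrand_tendsto[OF assms that])
  have Gt: "Gt (\<alpha>, \<beta>) = J_integrand m k u v \<alpha> \<beta>" if "\<alpha> \<noteq> 0" for \<alpha> \<beta>
    unfolding Gt_def using filterlim_compose[OF lim\<Phi>[OF that] Xlim] by (simp add: limI)
  define G where "G p = indicator ?H (snd p) *\<^sub>R Gt p" for p
  have measG [measurable]: "G \<in> borel_measurable ?M" unfolding G_def by measurable
  have limF: "AE p in ?M. ((\<lambda>d. F d p) \<longlongrightarrow> G p) (at_right 0)"
    using AE0
  proof eventually_elim
    case (elim p)
    then have "Gt p = J_integrand m k u v (fst p) (snd p)" using Gt[of "fst p" "snd p"] by simp
    then show ?case unfolding F_def G_def using elim by (auto intro!: tendsto_intros lim\<Phi>)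
  qed
  have lim_int: "(\<lambda>n. integral\<^sup>L ?M (F (Y n))) \<longlonglongrightarrow> integral\<^sup>L ?M G" "integrable ?M G"
    if Y: "\<And>n. good (Y n)" "Y \<longlonglongrightarrow> 0" for Y
  proof -
    have Ylim: "filterlim Y (at_right 0) sequentially"
      unfolding filterlim_at
    proof
      show "Y \<longlonglongrightarrow> 0" by (rule Y(2))
      show "\<forall>\<^sub>F n in sequentially. Y n \<in> {0<..} \<and> Y n \<noteq> 0"
      proof (intro always_eventually allI)
        show "Y n \<in> {0<..} \<and> Y n \<noteq> 0" for n using Y(1)[of n] by (simp add: good_def)
      qed
    qed
    have lim: "AE p in ?M. (\<lambda>n. F (Y n) p) \<longlonglongrightarrow> G p"
      using limF by eventually_elim (rule filterlim_compose[OF _ Ylim])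
    show "(\<lambda>n. integral\<^sup>L ?M (F (Y n))) \<longlonglongrightarrow> integral\<^sup>L ?M G"
      by (rule integral_dominated_convergence[OF measG measF[OF Y(1)] D lim FD[OF Y(1)]])
    show "integrable ?M G"
      by (rule integrable_dominated_convergence[OF measG measF[OF Y(1)] D lim FD[OF Y(1)]])
  qed
  have intG: "integrable ?M G"
    using lim_int(2)[where Y = X, OF X] Xlim unfolding filterlim_at by blast
  \<comment> \<open>Dominated convergence acts along sequences, so the limit at 0 is tested on every
    sequence, after discarding the initial terms that are not good.\<close>
  have limI: "((\<lambda>d. integral\<^sup>L ?M (F d)) \<longlongrightarrow> integral\<^sup>L ?M G) (at_right 0)"
    unfolding tendsto_at_iff_sequentially
  proof (intro allI impI)
    fix Y :: "nat \<Rightarrow> real" assume Y: "\<forall>i. Y i \<in> {0<..} - {0}" "Y \<longlonglongrightarrow> 0"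
    have "filterlim Y (at_right 0) sequentially"
      unfolding filterlim_at
    proof
      show "Y \<longlonglongrightarrow> 0" by (rule Y(2))
      show "\<forall>\<^sub>F n in sequentially. Y n \<in> {0<..} \<and> Y n \<noteq> 0"
      proof (intro always_eventually allI)
        show "Y n \<in> {0<..} \<and> Y n \<noteq> 0" for n using Y(1)[rule_format, of n] by simp
      qed
    qed
    then have "\<forall>\<^sub>F n in sequentially. good (Y n)"
      by (rule eventually_compose_filterlim[OF ev_good])
    then obtain n0 where n0: "\<And>n. n \<ge> n0 \<Longrightarrow> good (Y n)" by (auto simp: eventually_sequentially)
    have "(\<lambda>n. integral\<^sup>L ?M (F (Y (n + n0)))) \<longlonglongrightarrow> integral\<^sup>L ?M G"
      by (rule lim_int(1)[where Y = "\<lambda>n. Y (n + n0)", OF n0 LIMSEQ_ignore_initial_segment[OF Y(2)]]) simp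
    then show "((\<lambda>d. integral\<^sup>L ?M (F d)) \<circ> Y) \<longlonglongrightarrow> integral\<^sup>L ?M G"
      unfolding o_def by (rule LIMSEQ_offset)
  qed
  have measGt\<alpha> [measurable]: "(\<lambda>\<beta>. Gt (\<alpha>, \<beta>)) \<in> borel_measurable lborel" for \<alpha>
    using measurable_compose[OF measurable_Pair1' measGt] by simp
  \<comment> \<open>The closed interval of the statement and the half-open cell differ only in the
    point \<open>1 / 2\<close>.\<close>
  have AEI: "AE \<beta> in lborel. indicator ?I \<beta> *\<^sub>R Gt (\<alpha>, \<beta>) = G (\<alpha>, \<beta>)" for \<alpha>
    using AE_lborel_singleton[of "1 / 2 :: real"]
    by eventually_elim (auto simp: G_def indicator_def)
  have inner: "set_integrable lborel ?I (\<lambda>\<beta>. J_integrand m k u v \<alpha> \<beta>) \<longleftrightarrow> integrable lborel (\<lambda>\<beta>. G (\<alpha>, \<beta>))"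
    "(LINT \<beta>:?I|lborel. J_integrand m k u v \<alpha> \<beta>) = (LINT \<beta>|lborel. G (\<alpha>, \<beta>))" if "\<alpha> \<noteq> 0" for \<alpha>
  proof -
    have [measurable]: "(\<lambda>\<beta>. G (\<alpha>, \<beta>)) \<in> borel_measurable lborel" unfolding G_def by simp
    show "set_integrable lborel ?I (\<lambda>\<beta>. J_integrand m k u v \<alpha> \<beta>) \<longleftrightarrow> integrable lborel (\<lambda>\<beta>. G (\<alpha>, \<beta>))"
      unfolding set_integrable_def Gt[OF that, symmetric]
      by (rule integrable_cong_AE[OF _ _ AEI]; measurable)
    show "(LINT \<beta>:?I|lborel. J_integrand m k u v \<alpha> \<beta>) = (LINT \<beta>|lborel. G (\<alpha>, \<beta>))"
      unfolding set_lebesgue_integral_def Gt[OF that, symmetric]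
      by (rule integral_cong_AE[OF _ _ AEI]; measurable)
  qed
  have AE1: "AE \<alpha> in lborel. (\<alpha>::real) \<noteq> 0" by (rule AE_lborel_singleton)
  have c2: "AE \<alpha> in lborel. set_integrable lborel ?I (\<lambda>\<beta>. J_integrand m k u v \<alpha> \<beta>)"
    using lborel_pair.AE_integrable_fst'[OF intG] AE1 by eventually_elim (rule inner(1)[THEN iffD2])
  define j where "j \<alpha> = (LINT \<beta>:?I|lborel. J_integrand m k u v \<alpha> \<beta>)" for \<alpha>
  have intj: "integrable lborel (\<lambda>\<alpha>. LINT \<beta>|lborel. G (\<alpha>, \<beta>))"
    by (rule lborel_pair.integrable_fst'[OF intG])
  then have [measurable]: "(\<lambda>\<alpha>. LINT \<beta>|lborel. G (\<alpha>, \<beta>)) \<in> borel_measurable lborel"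
    by (rule borel_measurable_integrable)
  \<comment> \<open>Off the single point 0, \<open>j\<close> is the inner integral of
    \<open>G\<close>; in this form its measurability is immediate.\<close>
  have jeq: "j = (\<lambda>\<alpha>. if \<alpha> = 0 then j 0 else LINT \<beta>|lborel. G (\<alpha>, \<beta>))"
  proof
    show "j \<alpha> = (if \<alpha> = 0 then j 0 else LINT \<beta>|lborel. G (\<alpha>, \<beta>))" for \<alpha>
    proof (cases "\<alpha> = 0")
      case False
      then show ?thesis using inner(2)[OF False] by (simp only: j_def if_False)
    qed simp
  qed
  have [measurable]: "j \<in> borel_measurable lborel" by (subst jeq) measurable
  have AEj: "AE \<alpha> in lborel. j \<alpha> = (LINT \<beta>|lborel. G (\<alpha>, \<beta>))"
    using AE1 unfolding j_def by eventually_elim (rule inner(2))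
  have c3: "integrable lborel j"
    using intj by (subst integrable_cong_AE[OF _ _ AEj]) auto
  have "(LINT \<alpha>|lborel. j \<alpha>) = (LINT \<alpha>|lborel. LINT \<beta>|lborel. G (\<alpha>, \<beta>))"
    by (rule integral_cong_AE[OF _ _ AEj]; measurable)
  also have "\<dots> = integral\<^sup>L ?M G" by (rule lborel_pair.integral_fst'[OF intG])
  finally have jG: "(LINT \<alpha>|lborel. j \<alpha>) = integral\<^sup>L ?M G" .
  have c1: "\<forall>\<^sub>F d in at_right 0. imag_axis_integrable (\<lambda>z. I_integrand m k u v d z / (\<i> * sqrt_omega d))"
    using ev_good
  proof eventually_elim
    case (elim d)
    then show ?case using int\<Phi>[OF elim] by (intro imag_axis_scaled) (auto simp: good_def \<Phi>_def)
  qed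
  have "((\<lambda>d. of_real (sq d) * integral\<^sup>L ?M (F d)) \<longlongrightarrow> of_real 1 * integral\<^sup>L ?M G) (at_right 0)"
    by (intro tendsto_mult tendsto_of_real tendsto_sq limI)
  then have "((\<lambda>d. of_real (sq d) * integral\<^sup>L ?M (F d)) \<longlongrightarrow> (LINT \<alpha>|lborel. j \<alpha>)) (at_right 0)"
    unfolding jG by simp
  then have c4: "((\<lambda>d. of_real d * imag_axis_integral (\<lambda>z. I_integrand m k u v d z / (\<i> * sqrt_omega d)))
      \<longlongrightarrow> (LINT \<alpha>|lborel. j \<alpha>)) (at_right 0)"
  proof (rule Lim_transform_eventually)
    show "\<forall>\<^sub>F d in at_right 0. of_real (sq d) * integral\<^sup>L ?M (F d) =
      of_real d * imag_axis_integral (\<lambda>z. I_integrand m k u v d z / (\<i> * sqrt_omega d))"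
      using ev_good
    proof eventually_elim
      case (elim d)
      have "imag_axis_integral (\<lambda>z. I_integrand m k u v d z / (\<i> * sqrt_omega d)) =
          of_real (sq d) * (LINT y|lborel. \<Phi> d y)"
        unfolding \<Phi>_def using elim int\<Phi>[OF elim] by (intro imag_axis_scaled) (auto simp: good_def \<Phi>_def)
      then show ?case unfolding Feq[OF elim] by (simp add: scaleR_conv_of_real mult_ac)
    qed
  qed
  have le: "at 0 within {d::real. d > 0 \<and> 1 / d \<in> \<int>} \<le> at_right 0"
    by (rule at_le) auto
  show ?thesis
    using filter_leD[OF le c1] c2 c3 tendsto_mono[OF le c4] unfolding j_def by blast
qed

end
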